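(* Let $(A,P,\beta,\omega)$ be a twisted semigroup dynamical system and let $X=X(A,P,\beta,\omega)$ be the associated product system over the opposite semigroup $P^o$. Let $i_X:X\to\mathcal T_X$ be the universal Toeplitz representation, let $i_A:A\to\mathcal T_X$ be $i_A(a):=i_X(e,a)$, and let $i_P:P\to M(\mathcal T_X)$ be $i_P(s):=\lim_i i_X(s,\beta_s(a_i))^*$ (strict limit), where $(a_i)$ is an approximate identity for $A$. Let $q:\mathcal T_X\to\mathcal O_X$ be the canonical projection. Then $\mathcal T_X$ and $\mathcal O_X$ are canonically isomorphic to $\mathcal T(A\rtimes_{\beta,\omega}P)$ and $A\rtimes_{\beta,\omega}P$, respectively. More precisely, $(\mathcal T_X,i_A,i_P)$ is a Toeplitz crossed product for $(A,P,\beta,\omega)$, and $(\mathcal O_X,q\circ i_A,\overline q\circ i_P)$ is a crossed product for $(A,P,\beta,\omega)$.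
   Context: Standing assumptions: $A$ is a separable $C^*$-algebra, $P$ is a countable semigroup with identity $e$. Twisted systems. $(A,P,\beta,\omega)$ is a twisted semigroup dynamical system: $\beta$ is an action of $P$ by endomorphisms of $A$ ($\beta_s\beta_t=\beta_{st}$) with $\beta_e=\mathrm{id}$, each $\beta_s$ being extendible, i.e. extending to a strictly continuous endomorphism $\overline{\beta_s}$ of $M(A)$; $\omega:P\times P\to\mathbb T$ is a multiplier: $\omega(e,e)=1$ and $\omega(r,s)\omega(rs,t)=\omega(r,st)\omega(s,t)$. An $\omega$-representation of $P$ in a $C^*$-algebra is a map $V$ with $V_sV_t=\omega(s,t)V_{st}$; it is isometric (partial isometric) if each $V_s$ is an isometry (partial isometry). A covariant representation of $(A,P,\beta,\omega)$ on $\mathcal H$ is a pair $(\pi,V)$ of a nondegenerate representation $\pi:A\to B(\mathcal H)$ and an isometric $\omega$-representation $V:P\to B(\mathcal H)$ with $\pi(\beta_s(a))=V_s\pi(a)V_s^*$ for all $s,a$. A Toeplitz covariant representation is a pair $(\pi,V)$ with $\pi$ a nondegenerate representation of $A$, $V$ a partial isometric $\omega$-representation, $\pi(\beta_s(a))=V_s\pi(a)V_s^*$, and $V_s^*V_s\pi(a)=\pi(a)V_s^*V_s$ for all $s\in P$, $a\in A$. A crossed product (respectively Toeplitz crossed product) for $(A,P,\beta,\omega)$ is a triple $(B,j_A,j_P)$ of a $C^*$-algebra $B$, a nondegenerate homomorphism $j_A:A\to B$ and a map $j_P:P\to M(B)$ such that (a) if $\sigma$ is a nondegenerate representation of $B$,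 then $(\sigma\circ j_A,\overline\sigma\circ j_P)$ is a covariant (respectively Toeplitz covariant) representation; (b) for every covariant (respectively Toeplitz covariant) representation $(\pi,V)$ there is a representation $\pi\times V$ of $B$ with $(\pi\times V)\circ j_A=\pi$ and $\overline{\pi\times V}\circ j_P=V$; (c) $B$ is generated as a $C^*$-algebra by $\{j_A(a)j_P(s):a\in A,s\in P\}$. These are unique up to canonical isomorphism; the algebras are denoted $A\rtimes_{\beta,\omega}P$ and $\mathcal T(A\rtimes_{\beta,\omega}P)$. A bar denotes extension to multiplier algebras. Product systems. A Hilbert bimodule over $A$ is a right Hilbert $A$-module with a left action of $A$ given by a $*$-homomorphism $\phi$ into the adjointable operators. A product system over a semigroup $Q$ with identity $e$ is a semigroup $X$ with a semigroup homomorphism $p:X\to Q$ whose fibres $X_s=p^{-1}(s)$ are Hilbert bimodules over $A$ (left action $\phi_s$), such that for $s,t\neq e$ multiplication extends to a Hilbert bimodule isomorphism of $X_s\otimes_AX_t$ onto the fibre over the product of $s$ and $t$ in $Q$, $X_e=A$ with its usual bimodule structure, and $ax=\phi_s(a)x$, $xa=x\cdot a$ for $a\in X_e$, $x\in X_s$. A Toeplitz representation of $X$ in a $C^*$-algebra $B$ is a map $\psi:X\to B$, with linear restrictions $\psi_s=\psi|_{X_s}$ and $\psi_e$ a $*$-homomorphism, satisfying $\psi(xy)=\psi(x)\psi(y)$ and $\psi_s(x)^*\psi_s(y)=\psi_e(\langle x,y\rangle_A)$ for $x,y\in X_s$. It is Cuntz-Pimsner covariant if $\psi^{(s)}(\phi_s(a))=\psi_e(a)$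 whenever $\phi_s(a)\in\mathcal K(X_s)=\overline{\mathrm{span}}\{\Theta_{x,y}\}$, where $\Theta_{x,y}(z)=x\cdot\langle y,z\rangle_A$ and $\psi^{(s)}:\mathcal K(X_s)\to B$ is the homomorphism with $\psi^{(s)}(\Theta_{x,y})=\psi_s(x)\psi_s(y)^*$. $\mathcal T_X$ (respectively $\mathcal O_X$) is the $C^*$-algebra generated by a universal Toeplitz (respectively Cuntz-Pimsner covariant Toeplitz) representation of $X$; $\mathcal O_X$ is a quotient of $\mathcal T_X$. The product system $X(A,P,\beta,\omega)$. $X_s:=\{s\}\times\overline{\beta_s}(1)A$ with $(s,x)\cdot a=(s,xa)$, $\langle(s,x),(s,y)\rangle_A=x^*y$, $\phi_s(a)(s,x)=(s,\beta_s(a)x)$; $X=\bigsqcup_{s\in P}X_s$, $p(s,x)=s$, with multiplication $(s,x)(t,y):=(ts,\overline{\omega(t,s)}\beta_t(x)y)$. It is a product system over $P^o$, and the strict limits defining $i_P$ exist. *)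

theory Defs
  imports "HOL-Analysis.Analysis" "HOL-Library.Countable"
begin

section \<open>Complex normed spaces, C*-algebras and Hilbert spaces\<close>

class complex_normed_vector = real_normed_vector +
  fixes scaleC :: "complex \<Rightarrow> 'a \<Rightarrow> 'a"  (infixr \<open>*\<^sub>C\<close> 75)
  assumes scaleC_add_right: "c *\<^sub>C (x + y) = c *\<^sub>C x + c *\<^sub>C y"
    and scaleC_add_left: "(c + d) *\<^sub>C x = c *\<^sub>C x + d *\<^sub>C x"
    and scaleC_scaleC: "c *\<^sub>C d *\<^sub>C x = (c * d) *\<^sub>C x"
    and scaleC_of_real: "complex_of_real r *\<^sub>C x = r *\<^sub>R x"
    and norm_scaleC: "norm (c *\<^sub>C x) = norm c * norm x"

text \<open>C*-algebras are not assumed to be unital (nor nonzero).\<close>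

class cstar_algebra = complex_normed_vector + banach + real_normed_algebra +
  fixes star :: "'a \<Rightarrow> 'a"
  assumes scaleC_mult_left: "(c *\<^sub>C x) * y = c *\<^sub>C (x * y)"
    and scaleC_mult_right: "x * (c *\<^sub>C y) = c *\<^sub>C (x * y)"
    and star_add: "star (x + y) = star x + star y"
    and star_scaleC: "star (c *\<^sub>C x) = cnj c *\<^sub>C star x"
    and star_mult: "star (x * y) = star y * star x"
    and star_star: "star (star x) = x"
    and norm_star_mult: "norm (star x * x) = (norm x)\<^sup>2"

text \<open>The inner product is linear in the second variable.\<close>

class complex_hilbert_space = complex_normed_vector + banach +
  fixes cinner :: "'a \<Rightarrow> 'a \<Rightarrow> complex"
  assumes cinner_add_right: "cinner x (y + z) = cinner x y + cinner x z"
    and cinner_scaleC_right: "cinner x (c *\<^sub>C y) = c * cinner x y"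
    and cinner_commute: "cinner y x = cnj (cinner x y)"
    and cinner_norm: "cinner x x = complex_of_real ((norm x)\<^sup>2)"

lemma scaleC_zero_right [simp]: "c *\<^sub>C (0::'a::complex_normed_vector) = 0"
  using scaleC_add_right[of c 0 0] by simp

lemma scaleC_zero_left [simp]: "0 *\<^sub>C (x::'a::complex_normed_vector) = 0"
  using scaleC_of_real[of 0 x] by simp

lemma scaleC_one [simp]: "1 *\<^sub>C (x::'a::complex_normed_vector) = x"
  using scaleC_of_real[of 1 x] by simp

lemma scaleC_minus1: "(-1) *\<^sub>C (x::'a::complex_normed_vector) = - x"
  using scaleC_of_real[of "-1" x] by simp

lemma scaleC_minus_right: "c *\<^sub>C (- x::'a::complex_normed_vector) = - (c *\<^sub>C x)"
  by (metis add.right_inverse add_eq_0_iff scaleC_add_right scaleC_zero_right)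

lemma scaleC_diff_right: "c *\<^sub>C (x - y::'a::complex_normed_vector) = c *\<^sub>C x - c *\<^sub>C y"
  by (metis (no_types) diff_conv_add_uminus scaleC_add_right scaleC_minus_right)

lemma bounded_linear_scaleC: "bounded_linear (\<lambda>x::'a::complex_normed_vector. c *\<^sub>C x)"
proof (rule bounded_linear_intro[where K="norm c"])
  fix r and x :: 'a
  show "c *\<^sub>C r *\<^sub>R x = r *\<^sub>R c *\<^sub>C x"
    by (metis scaleC_of_real scaleC_scaleC mult.commute)
qed (auto simp: scaleC_add_right norm_scaleC)

lemmas tendsto_scaleC = bounded_linear.tendsto[OF bounded_linear_scaleC]

lemma star_zero [simp]: "star (0::'a::cstar_algebra) = 0"
  using star_add[of 0 "0::'a"] by simp

lemma star_minus: "star (- x::'a::cstar_algebra) = - star x"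
  by (metis add_eq_0_iff right_minus star_add star_zero)

lemma star_diff: "star (x - y::'a::cstar_algebra) = star x - star y"
  by (metis (no_types) diff_conv_add_uminus star_add star_minus)

lemma star_scaleR: "star (r *\<^sub>R x::'a::cstar_algebra) = r *\<^sub>R star x"
  by (metis complex_cnj_complex_of_real scaleC_of_real star_scaleC)

lemma norm_star: "norm (star x) = norm (x::'a::cstar_algebra)"
proof -
  have le: "norm y \<le> norm (star y)" for y :: 'a
  proof (cases "y = 0")
    case False
    have "norm y * norm y \<le> norm (star y) * norm y"
      by (metis norm_mult_ineq norm_star_mult power2_eq_square)
    then show ?thesis using False by simp
  qed simp
  show ?thesis by (metis le order_antisym star_star)
qed

lemma bounded_linear_star: "bounded_linear (star :: 'a::cstar_algebra \<Rightarrow> 'a)"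
  by (rule bounded_linear_intro[where K=1]) (auto simp: star_add star_scaleR norm_star)

lemma star_mult_eq_0: "star x * x = 0 \<Longrightarrow> x = (0::'a::cstar_algebra)"
  by (metis norm_eq_zero norm_star_mult power_eq_0_iff)

lemma cstar_eqI_left:
  fixes x y :: "'a::cstar_algebra"
  assumes "\<And>b. b * x = b * y"
  shows "x = y"
proof -
  have "star (x - y) * (x - y) = 0" by (simp add: assms algebra_simps)
  then show ?thesis using star_mult_eq_0 by (metis eq_iff_diff_eq_0)
qed

lemma cstar_eqI_right:
  fixes x y :: "'a::cstar_algebra"
  assumes "\<And>b. x * b = y * b"
  shows "x = y"
proof -
  have "star x = star y"
    by (rule cstar_eqI_left) (metis assms star_mult star_star)
  then show ?thesis by (metis star_star)
qed

definition star_hom :: "('a::cstar_algebra \<Rightarrow> 'b::cstar_algebra) \<Rightarrow> bool" where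
  "star_hom f \<longleftrightarrow> (\<forall>x y. f (x + y) = f x + f y) \<and> (\<forall>c x. f (c *\<^sub>C x) = c *\<^sub>C f x) \<and>
     (\<forall>x y. f (x * y) = f x * f y) \<and> (\<forall>x. f (star x) = star (f x))"

definition cstar_subalgebra :: "'a::cstar_algebra set \<Rightarrow> bool" where
  "cstar_subalgebra C \<longleftrightarrow> closed C \<and> 0 \<in> C \<and> (\<forall>x\<in>C. \<forall>y\<in>C. x + y \<in> C \<and> x * y \<in> C) \<and>
     (\<forall>c. \<forall>x\<in>C. c *\<^sub>C x \<in> C) \<and> (\<forall>x\<in>C. star x \<in> C)"

definition cstar_generated :: "'a::cstar_algebra set \<Rightarrow> 'a set" where
  "cstar_generated S = cstar_subalgebra hull S"

definition approximate_identity :: "'i filter \<Rightarrow> ('i \<Rightarrow> 'a::cstar_algebra) \<Rightarrow> bool" where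
  "approximate_identity F u \<longleftrightarrow> F \<noteq> bot \<and>
     (\<forall>i. norm (u i) \<le> 1 \<and> (\<exists>b. u i = star b * b)) \<and>
     (\<forall>x. ((\<lambda>i. u i * x) \<longlongrightarrow> x) F \<and> ((\<lambda>i. x * u i) \<longlongrightarrow> x) F)"


section \<open>The C*-algebra of bounded operators on a Hilbert space\<close>

lemma cinner_add_left: "cinner (x + y) z = cinner x z + cinner (y::'h::complex_hilbert_space) z"
  by (metis cinner_add_right cinner_commute complex_cnj_add)

lemma cinner_scaleC_left: "cinner (c *\<^sub>C x) z = cnj c * cinner (x::'h::complex_hilbert_space) z"
  by (metis cinner_scaleC_right cinner_commute complex_cnj_mult)

lemma cinner_scaleR_right: "cinner x (r *\<^sub>R y) = of_real r * cinner (x::'h::complex_hilbert_space) y"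
  by (metis cinner_scaleC_right scaleC_of_real)

lemma cinner_diff_right: "cinner x (y - z) = cinner x y - cinner (x::'h::complex_hilbert_space) z"
  by (metis add_diff_cancel_right' cinner_add_right diff_add_cancel)

lemma norm_add_sq: "(norm (x + y :: 'h::complex_hilbert_space))\<^sup>2 =
    (norm x)\<^sup>2 + 2 * Re (cinner x y) + (norm y)\<^sup>2"
proof -
  have "cinner (x + y) (x + y) = cinner x x + cinner x y + cnj (cinner x y) + cinner y y"
    using cinner_commute[of x y] by (simp add: cinner_add_left cinner_add_right)
  then have "complex_of_real ((norm (x + y))\<^sup>2) =
      of_real ((norm x)\<^sup>2) + cinner x y + cnj (cinner x y) + of_real ((norm y)\<^sup>2)"
    by (simp only: cinner_norm)
  then have "Re (complex_of_real ((norm (x + y))\<^sup>2)) =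
      Re (of_real ((norm x)\<^sup>2) + cinner x y + cnj (cinner x y) + of_real ((norm y)\<^sup>2))"
    by simp
  then show ?thesis by simp
qed

lemma cinner_zero_right [simp]: "cinner (x::'h::complex_hilbert_space) 0 = 0"
  using cinner_add_right[of x 0 0] by simp

lemma cinner_cauchy_schwarz: "norm (cinner x y) \<le> norm x * norm (y::'h::complex_hilbert_space)"
proof (cases "norm x = 0 \<or> norm y = 0")
  case True
  then show ?thesis
    by (metis cinner_commute cinner_zero_right complex_cnj_zero norm_eq_zero norm_zero
        mult_zero_left mult_zero_right order_refl)
next
  case False
  define c where "c = cinner x y"
  have Re_le: "\<bar>Re (cinner x z)\<bar> \<le> norm x * norm z" for z :: 'h
  proof -
    have a: "2 * Re (cinner x z) \<le> 2 * norm x * norm z" for x z :: 'h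
    proof -
      have "(norm (x + z))\<^sup>2 \<le> (norm x + norm z)\<^sup>2"
        by (simp add: norm_triangle_ineq power_mono)
      then show ?thesis by (simp add: norm_add_sq power2_sum)
    qed
    have "cinner x (- z) = - cinner x z"
      by (metis add_eq_0_iff cinner_add_right cinner_zero_right right_minus)
    then show ?thesis using a[of x z] a[of x "- z"] by auto
  qed
  have "cinner x (cnj c *\<^sub>C y) = of_real ((norm c)\<^sup>2)"
    by (simp add: cinner_scaleC_right c_def[symmetric] complex_norm_square mult.commute
        del: of_real_power)
  then have "(norm c)\<^sup>2 \<le> norm x * norm (cnj c *\<^sub>C y)"
    using Re_le[of "cnj c *\<^sub>C y"] by simp
  then have "norm c * norm c \<le> norm c * (norm x * norm y)"
    by (simp add: norm_scaleC power2_eq_square algebra_simps)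
  then show ?thesis
    by (cases "norm c = 0") (auto simp: c_def[symmetric])
qed

lemma bounded_linear_cinner_right: "bounded_linear (cinner (x::'h::complex_hilbert_space))"
  by (rule bounded_linear_intro[where K="norm x"])
    (auto simp: cinner_add_right cinner_scaleR_right scaleR_conv_of_real
      intro: order_trans[OF cinner_cauchy_schwarz] simp: mult.commute)

lemma cinner_eqI: "(\<And>z. cinner x z = cinner y z) \<Longrightarrow> x = (y::'h::complex_hilbert_space)"
proof -
  assume a: "\<And>z. cinner x z = cinner y z"
  have "cinner (x - y) z = 0" for z
    by (metis a add_diff_cancel_right' cinner_add_left diff_add_cancel diff_self)
  then have "(norm (x - y))\<^sup>2 = 0" by (metis cinner_norm of_real_eq_0_iff)
  then show ?thesis by simp
qed

lemma riesz_representation: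
  fixes f :: "'h::complex_hilbert_space \<Rightarrow> complex"
  assumes f: "bounded_linear f" and fC: "\<And>c x. f (c *\<^sub>C x) = c * f x"
  shows "\<exists>y. \<forall>x. f x = cinner y x"
proof -
  interpret f: bounded_linear f by (rule f)
  obtain K where K: "\<And>x. norm (f x) \<le> norm x * K" "K \<ge> 0"
    using f.nonneg_bounded by blast
  define g where "g x = (norm x)\<^sup>2 - 2 * Re (f x)" for x
  have glb: "- K\<^sup>2 \<le> g x" for x
  proof -
    have "Re (f x) \<le> norm x * K" using K(1)[of x] complex_Re_le_cmod[of "f x"] by linarith
    moreover have "0 \<le> (norm x - K)\<^sup>2" by simp
    ultimately show ?thesis by (simp add: g_def power2_diff)
  qed
  define m where "m = Inf (range g)"
  have bdd: "bdd_below (range g)" by (rule bdd_belowI2[of _ "- K\<^sup>2"]) (rule glb)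
  have m_le: "m \<le> g x" for x unfolding m_def by (intro cInf_lower bdd) auto
  have "\<exists>x. g x < m + inverse (real (Suc n))" for n
    using cInf_lessD[of "range g" "m + inverse (real (Suc n))"] by (auto simp: m_def)
  then obtain X where X: "\<And>n. g (X n) < m + inverse (real (Suc n))" by metis
  have par: "(norm (x - y))\<^sup>2 \<le> 2 * (g x - m) + 2 * (g y - m)" for x y
  proof -
    have p1: "cinner x (- y) = - cinner x y"
      by (metis add_eq_0_iff cinner_add_right cinner_zero_right right_minus)
    have "(norm (x - y))\<^sup>2 + (norm (x + y))\<^sup>2 = 2 * (norm x)\<^sup>2 + 2 * (norm y)\<^sup>2"
      using norm_add_sq[of x y] norm_add_sq[of x "- y"] by (simp add: p1)
    moreover have "g ((1/2) *\<^sub>R (x + y)) = (norm (x + y))\<^sup>2 / 4 - Re (f x) - Re (f y)"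
      unfolding g_def by (simp add: f.scaleR f.add power_mult_distrib power2_eq_square)
        (simp add: field_simps)
    moreover note m_le[of "(1/2) *\<^sub>R (x + y)"]
    ultimately show ?thesis by (simp add: g_def)
  qed
  have "Cauchy X"
  proof (rule CauchyI)
    fix e :: real assume e: "e > 0"
    obtain M where M: "inverse (real (Suc M)) < e\<^sup>2 / 4"
      using reals_Archimedean[of "e\<^sup>2 / 4"] e by auto
    have sm: "g (X n) - m < e\<^sup>2 / 4" if "n \<ge> M" for n
    proof -
      have "inverse (real (Suc n)) \<le> inverse (real (Suc M))" using that by (simp add: le_imp_inverse_le)
      then show ?thesis using X[of n] M by linarith
    qed
    show "\<exists>M. \<forall>p\<ge>M. \<forall>n\<ge>M. norm (X p - X n) < e"
    proof (intro exI allI impI)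
      fix p n assume pn: "M \<le> p" "M \<le> n"
      have "(norm (X p - X n))\<^sup>2 < e\<^sup>2"
        using par[of "X p" "X n"] sm[OF pn(1)] sm[OF pn(2)] by (simp add: field_simps)
      then show "norm (X p - X n) < e" using e by (simp add: power_less_imp_less_base)
    qed
  qed
  then obtain y where y: "X \<longlonglongrightarrow> y" using Cauchy_convergent_iff convergent_def by blast
  have "(\<lambda>n. g (X n)) \<longlonglongrightarrow> g y"
    unfolding g_def by (intro tendsto_intros y f.tendsto)
  moreover have "(\<lambda>n. m + inverse (real (Suc n))) \<longlonglongrightarrow> m + 0"
    by (intro tendsto_intros LIMSEQ_inverse_real_of_nat)
  ultimately have "g y \<le> m + 0"
    by (rule LIMSEQ_le) (use X less_imp_le in blast)
  then have gy: "g y \<le> g x" for x using m_le[of x] by simp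
  have Re_eq: "Re (cinner y h) = Re (f h)" for h
  proof -
    define b where "b = Re (cinner y h) - Re (f h)"
    have q: "0 \<le> t\<^sup>2 * (norm h)\<^sup>2 + 2 * t * b" for t :: real
    proof -
      have "g (y + t *\<^sub>R h) = g y + (t\<^sup>2 * (norm h)\<^sup>2 + 2 * t * b)"
        by (simp add: g_def norm_add_sq f.add f.scaleR cinner_scaleR_right b_def
            power_mult_distrib algebra_simps)
      then show ?thesis using gy[of "y + t *\<^sub>R h"] by simp
    qed
    have "b = 0"
    proof (rule ccontr)
      assume b: "b \<noteq> 0"
      define N where "N = (norm h)\<^sup>2 + 1"
      have N: "N > 0" by (simp add: N_def add_nonneg_pos)
      have "0 \<le> (b / N)\<^sup>2 * (norm h)\<^sup>2 - 2 * (b / N) * b" using q[of "- (b / N)"] by simp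
      also have "\<dots> < (b / N)\<^sup>2 * N - 2 * (b / N) * b"
        using b N by (simp add: N_def)
      also have "\<dots> = - (b\<^sup>2 / N)" using N by (simp add: power2_eq_square field_simps)
      also have "\<dots> \<le> 0" using N by simp
      finally show False by simp
    qed
    then show ?thesis by (simp add: b_def)
  qed
  have "f x = cinner y x" for x
  proof (rule complex_eqI)
    show "Re (f x) = Re (cinner y x)" by (simp add: Re_eq)
    show "Im (f x) = Im (cinner y x)"
      using Re_eq[of "\<i> *\<^sub>C x"] by (simp add: fC cinner_scaleC_right)
  qed
  then show ?thesis by blast
qed

typedef (overloaded) ('h::complex_hilbert_space) bop =
  "{T :: 'h \<Rightarrow>\<^sub>L 'h. \<forall>c x. blinfun_apply T (c *\<^sub>C x) = c *\<^sub>C blinfun_apply T x}"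
  morphisms bop_blinfun Abs_bop
  by (rule exI[of _ 0]) simp

definition bop_apply :: "'h::complex_hilbert_space bop \<Rightarrow> 'h \<Rightarrow> 'h" (infixr \<open>\<cdot>\<close> 70) where
  "T \<cdot> x = blinfun_apply (bop_blinfun T) x"

lemma bop_apply_scaleC: "T \<cdot> (c *\<^sub>C x) = c *\<^sub>C (T \<cdot> x)"
  using bop_blinfun[of T] by (auto simp: bop_apply_def)

lemma bop_bounded_linear: "bounded_linear (\<lambda>x. T \<cdot> x)"
  by (simp add: bop_apply_def blinfun.bounded_linear_right)

lemma bop_eqI: "(\<And>x. S \<cdot> x = T \<cdot> x) \<Longrightarrow> S = T"
  by (metis bop_apply_def bop_blinfun_inject blinfun_eqI)

lemma bop_ex:
  assumes "bounded_linear f" "\<And>c x. f (c *\<^sub>C x) = c *\<^sub>C f x"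
  shows "\<exists>T. \<forall>x. T \<cdot> x = f x"
  using assms by (intro exI[of _ "Abs_bop (Blinfun f)"])
    (simp add: bop_apply_def Abs_bop_inverse bounded_linear_Blinfun_apply)

text \<open>\<open>bop_of f\<close> is \<open>f\<close> as an element of the type, for bounded complex linear \<open>f\<close>.\<close>

definition bop_of :: "('h::complex_hilbert_space \<Rightarrow> 'h) \<Rightarrow> 'h bop" where
  "bop_of f = Abs_bop (Blinfun f)"

lemma bop_of_apply:
  assumes "bounded_linear f" "\<And>c x. f (c *\<^sub>C x) = c *\<^sub>C f x"
  shows "bop_of f \<cdot> x = f x"
  using assms by (simp add: bop_of_def bop_apply_def Abs_bop_inverse bounded_linear_Blinfun_apply)

lemma bop_adjoint_ex:
  "\<exists>S. \<forall>x y. cinner (S \<cdot> x) y = cinner x ((T::'h::complex_hilbert_space bop) \<cdot> y)"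
proof -
  have "\<exists>z. \<forall>y. cinner x (T \<cdot> y) = cinner z y" for x
    by (rule riesz_representation)
      (auto intro: bounded_linear_compose[OF bounded_linear_cinner_right bop_bounded_linear]
        simp: bop_apply_scaleC cinner_scaleC_right)
  then obtain s where s: "\<And>x y. cinner x (T \<cdot> y) = cinner (s x) y" by metis
  obtain K where K: "\<And>x. norm (T \<cdot> x) \<le> norm x * K" "K \<ge> 0"
    using bounded_linear.nonneg_bounded[OF bop_bounded_linear] by blast
  have sC: "s (c *\<^sub>C x) = c *\<^sub>C s x" for c x
    by (rule cinner_eqI) (simp add: s[symmetric] cinner_scaleC_left)
  have "bounded_linear s"
  proof (rule bounded_linear_intro[where K=K])
    show "s (x + y) = s x + s y" for x y
      by (rule cinner_eqI) (simp add: s[symmetric] cinner_add_left)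
    show "s (r *\<^sub>R x) = r *\<^sub>R s x" for r x by (metis sC scaleC_of_real)
    show "norm (s x) \<le> norm x * K" for x
    proof (cases "s x = 0")
      case True then show ?thesis using K by simp
    next
      case False
      have "(norm (s x))\<^sup>2 = norm (cinner (s x) (s x))" by (simp add: cinner_norm norm_power)
      also have "\<dots> = norm (cinner x (T \<cdot> s x))" by (simp add: s)
      also have "\<dots> \<le> norm x * (norm (s x) * K)"
        by (rule order_trans[OF cinner_cauchy_schwarz]) (simp add: K mult_left_mono)
      finally have "norm (s x) * norm (s x) \<le> norm (s x) * (norm x * K)"
        by (simp add: power2_eq_square algebra_simps)
      then show ?thesis using False by simp
    qed
  qed
  then obtain S where "\<And>x. S \<cdot> x = s x" using bop_ex sC by metis
  then show ?thesis using s by metis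
qed

instantiation bop :: (complex_hilbert_space) "{complex_normed_vector, real_algebra}"
begin

definition "norm_bop T = norm (bop_blinfun T)"
definition "minus_bop S T = bop_of (\<lambda>x. S \<cdot> x - T \<cdot> x)"
definition "uminus_bop T = bop_of (\<lambda>x. - (T \<cdot> x))"
definition "zero_bop = bop_of (\<lambda>x. 0)"
definition "plus_bop S T = bop_of (\<lambda>x. S \<cdot> x + T \<cdot> x)"
definition "scaleR_bop r T = bop_of (\<lambda>x. r *\<^sub>R (T \<cdot> x))"
definition "scaleC_bop c T = bop_of (\<lambda>x. c *\<^sub>C (T \<cdot> x))"
definition "times_bop S T = bop_of (\<lambda>x. S \<cdot> (T \<cdot> x))"
definition "dist_bop S T = norm (S - T :: 'a bop)"
definition [code del]:
  "(uniformity :: ('a bop \<times> 'a bop) filter) = (INF e\<in>{0 <..}. principal {(x, y). dist x y < e})"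
definition [code del]:
  "open_bop (S :: 'a bop set) \<longleftrightarrow> (\<forall>x\<in>S. \<forall>\<^sub>F (x', y) in uniformity. x' = x \<longrightarrow> y \<in> S)"
definition "sgn_bop T = inverse (norm T) *\<^sub>R (T :: 'a bop)"

lemma bop_minus_apply: "(S - T) \<cdot> x = S \<cdot> x - T \<cdot> (x::'a)"
  unfolding minus_bop_def
  by (rule bop_of_apply) (auto intro: bounded_linear_sub bop_bounded_linear
      simp: bop_apply_scaleC scaleC_diff_right)

lemma bop_uminus_apply: "(- T) \<cdot> x = - (T \<cdot> (x::'a))"
  unfolding uminus_bop_def
  by (rule bop_of_apply) (auto intro: bounded_linear_minus bop_bounded_linear
      simp: bop_apply_scaleC scaleC_minus_right)

lemma bop_zero_apply: "0 \<cdot> x = (0::'a)"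
  unfolding zero_bop_def by (rule bop_of_apply) auto

lemma bop_plus_apply: "(S + T) \<cdot> x = S \<cdot> x + T \<cdot> (x::'a)"
  unfolding plus_bop_def
  by (rule bop_of_apply) (auto intro: bounded_linear_add bop_bounded_linear
      simp: bop_apply_scaleC scaleC_add_right)

lemma bop_scaleR_apply: "(r *\<^sub>R T) \<cdot> x = r *\<^sub>R (T \<cdot> (x::'a))"
  unfolding scaleR_bop_def
  by (rule bop_of_apply) (auto intro: bounded_linear_const_scaleR bop_bounded_linear
      simp: bop_apply_scaleC, metis scaleC_of_real scaleC_scaleC mult.commute)

lemma bop_scaleC_apply: "(c *\<^sub>C T) \<cdot> x = c *\<^sub>C (T \<cdot> (x::'a))"
  unfolding scaleC_bop_def
  by (rule bop_of_apply) (auto intro: bounded_linear_compose[OF bounded_linear_scaleC]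
      bop_bounded_linear simp: bop_apply_scaleC scaleC_scaleC mult.commute)

lemma bop_times_apply: "(S * T) \<cdot> x = S \<cdot> (T \<cdot> (x::'a))"
  unfolding times_bop_def
  by (rule bop_of_apply) (auto intro: bounded_linear_compose[OF bop_bounded_linear bop_bounded_linear]
      simp: bop_apply_scaleC)

lemmas bop_apply_simps = bop_minus_apply bop_uminus_apply bop_zero_apply bop_plus_apply
  bop_scaleR_apply bop_scaleC_apply bop_times_apply

lemma bop_apply_add: "T \<cdot> (x + y) = T \<cdot> x + T \<cdot> (y::'a)"
  by (simp add: linear_simps(1)[OF bop_bounded_linear])

lemma bop_apply_scaleR: "T \<cdot> (r *\<^sub>R x) = r *\<^sub>R (T \<cdot> (x::'a))"
  by (simp add: linear_simps(5)[OF bop_bounded_linear])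

lemma bop_norm_apply: "norm (T \<cdot> x) \<le> norm T * norm (x::'a)"
  by (simp add: bop_apply_def norm_bop_def norm_blinfun)

lemma bop_norm_bound: "0 \<le> b \<Longrightarrow> (\<And>x::'a. norm (T \<cdot> x) \<le> b * norm x) \<Longrightarrow> norm T \<le> b"
  by (simp add: bop_apply_def norm_bop_def norm_blinfun_bound)

lemma bop_norm_nonneg: "0 \<le> norm (T :: 'a bop)"
  by (simp add: norm_bop_def)

lemma bop_blinfun_scaleR: "bop_blinfun (r *\<^sub>R T :: 'a bop) = r *\<^sub>R bop_blinfun T"
  by (rule blinfun_eqI) (simp add: bop_apply_def[symmetric] bop_apply_simps blinfun.scaleR_left)

lemma bop_blinfun_minus: "bop_blinfun (S - T :: 'a bop) = bop_blinfun S - bop_blinfun T"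
  by (rule blinfun_eqI) (simp add: bop_apply_def[symmetric] bop_apply_simps blinfun.diff_left)

lemma bop_blinfun_plus: "bop_blinfun (S + T :: 'a bop) = bop_blinfun S + bop_blinfun T"
  by (rule blinfun_eqI) (simp add: bop_apply_def[symmetric] bop_apply_simps blinfun.add_left)

lemma bop_blinfun_zero: "bop_blinfun (0 :: 'a bop) = 0"
  by (rule blinfun_eqI) (simp add: bop_apply_def[symmetric] bop_apply_simps)

instance
proof
  fix S T U :: "'a bop" and r s :: real and c d :: complex
  show "S + T + U = S + (T + U)" "S + T = T + S" "0 + S = S" "- S + S = 0" "S - T = S + - T"
    "r *\<^sub>R (S + T) = r *\<^sub>R S + r *\<^sub>R T" "(r + s) *\<^sub>R S = r *\<^sub>R S + s *\<^sub>R S"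
    "r *\<^sub>R s *\<^sub>R S = (r * s) *\<^sub>R S" "1 *\<^sub>R S = S"
    by (auto intro!: bop_eqI simp: bop_apply_simps scaleR_add_right scaleR_add_left)
  show "c *\<^sub>C (S + T) = c *\<^sub>C S + c *\<^sub>C T" "(c + d) *\<^sub>C S = c *\<^sub>C S + d *\<^sub>C S"
    "c *\<^sub>C d *\<^sub>C S = (c * d) *\<^sub>C S" "complex_of_real r *\<^sub>C S = r *\<^sub>R S"
    by (auto intro!: bop_eqI
        simp: bop_apply_simps scaleC_add_right scaleC_add_left scaleC_scaleC scaleC_of_real)
  show "S * T * U = S * (T * U)" "(S + T) * U = S * U + T * U" "S * (T + U) = S * T + S * U"
    "r *\<^sub>R S * T = r *\<^sub>R (S * T)" "S * r *\<^sub>R T = r *\<^sub>R (S * T)"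
    by (auto intro!: bop_eqI simp: bop_apply_simps bop_apply_add bop_apply_scaleR)
  show "dist S T = norm (S - T)" by (rule dist_bop_def)
  show "sgn S = inverse (norm S) *\<^sub>R S" by (rule sgn_bop_def)
  show "(uniformity :: ('a bop \<times> 'a bop) filter) = (INF e\<in>{0 <..}. principal {(x, y). dist x y < e})"
    by (rule uniformity_bop_def)
  show "open V \<longleftrightarrow> (\<forall>x\<in>V. \<forall>\<^sub>F (x', y) in uniformity. x' = x \<longrightarrow> y \<in> V)" for V :: "'a bop set"
    by (rule open_bop_def)
  show "norm S = 0 \<longleftrightarrow> S = 0"
    by (metis bop_blinfun_inject bop_blinfun_zero norm_bop_def norm_eq_zero)
  show "norm (S + T) \<le> norm S + norm T"
    by (simp add: norm_bop_def bop_blinfun_plus norm_triangle_ineq)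
  show "norm (r *\<^sub>R S) = \<bar>r\<bar> * norm S"
    by (simp add: norm_bop_def bop_blinfun_scaleR)
  have le: "norm (c *\<^sub>C S) \<le> norm c * norm S" for c :: complex and S :: "'a bop"
  proof (rule bop_norm_bound)
    show "0 \<le> norm c * norm S" by (simp add: bop_norm_nonneg)
    fix x :: 'a
    show "norm ((c *\<^sub>C S) \<cdot> x) \<le> norm c * norm S * norm x"
      using bop_norm_apply[of S x]
      by (simp add: bop_apply_simps norm_scaleC mult_left_mono mult.assoc)
  qed
  show "norm (c *\<^sub>C S) = norm c * norm S"
  proof (cases "c = 0")
    case True
    then have "c *\<^sub>C S = 0" by (intro bop_eqI) (simp add: bop_apply_simps)
    then show ?thesis using True by (simp add: norm_bop_def bop_blinfun_zero)
  next
    case False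
    have "inverse c *\<^sub>C (c *\<^sub>C S) = S"
      by (rule bop_eqI) (simp add: bop_apply_simps scaleC_scaleC False)
    then have "norm S \<le> norm (inverse c) * norm (c *\<^sub>C S)" using le[of "inverse c" "c *\<^sub>C S"] by simp
    then have "norm c * norm S \<le> norm (c *\<^sub>C S)"
      using False by (simp add: norm_inverse norm_divide field_simps)
    with le show ?thesis by (simp add: order_antisym)
  qed
qed

end

instantiation bop :: (complex_hilbert_space) "{cstar_algebra, monoid_mult}"
begin

definition "one_bop = bop_of (\<lambda>x::'a. x)"

definition star_bop :: "'a bop \<Rightarrow> 'a bop" where
  "star_bop T = (THE S. \<forall>x y. cinner (S \<cdot> x) y = cinner x (T \<cdot> y))"

lemma bop_one_apply: "1 \<cdot> x = (x::'a)"
  unfolding one_bop_def by (rule bop_of_apply) (auto simp: bounded_linear_ident)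

lemma bop_star: "cinner (star T \<cdot> x) y = cinner x (T \<cdot> (y::'a))"
proof -
  have "\<exists>!S. \<forall>x y. cinner (S \<cdot> x) y = cinner x (T \<cdot> y)"
    using bop_adjoint_ex[of T] by (metis bop_eqI cinner_eqI)
  from theI'[OF this] show ?thesis unfolding star_bop_def by blast
qed

lemma bop_starI: "(\<And>x y. cinner (S \<cdot> x) y = cinner x (T \<cdot> (y::'a))) \<Longrightarrow> star T = S"
  by (metis bop_eqI bop_star cinner_eqI)

lemma bop_star_right: "cinner (T \<cdot> x) y = cinner x (star T \<cdot> (y::'a))"
  by (metis bop_star cinner_commute)

instance
proof
  fix S T :: "'a bop" and c :: complex
  show "1 * T = T" "T * 1 = T" by (auto intro!: bop_eqI simp: bop_times_apply bop_one_apply)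
  show "c *\<^sub>C S * T = c *\<^sub>C (S * T)" "S * c *\<^sub>C T = c *\<^sub>C (S * T)"
    by (auto intro!: bop_eqI simp: bop_apply_simps bop_apply_scaleC)
  show "star (S + T) = star S + star T" "star (c *\<^sub>C S) = cnj c *\<^sub>C star S"
    "star (S * T) = star T * star S"
    by (auto intro!: bop_starI simp: bop_apply_simps cinner_add_left cinner_add_right
        cinner_scaleC_left cinner_scaleC_right bop_star)
  show ss: "star (star S) = S" for S :: "'a bop"
    by (rule bop_starI) (simp add: bop_star_right)
  show mult: "norm (S * T) \<le> norm S * norm T" for S T :: "'a bop"
  proof (rule bop_norm_bound)
    fix x
    have "norm (S \<cdot> (T \<cdot> x)) \<le> norm S * norm (T \<cdot> x)" by (rule bop_norm_apply)
    also have "\<dots> \<le> norm S * (norm T * norm x)" by (simp add: bop_norm_apply mult_left_mono)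
    finally show "norm ((S * T) \<cdot> x) \<le> norm S * norm T * norm x"
      by (simp add: bop_times_apply mult.assoc)
  qed simp
  have sq: "(norm T)\<^sup>2 \<le> norm (star T * T)" for T :: "'a bop"
  proof -
    have "norm T \<le> sqrt (norm (star T * T))"
    proof (rule bop_norm_bound)
      fix x
      have "(norm (T \<cdot> x))\<^sup>2 = norm (cinner (T \<cdot> x) (T \<cdot> x))" by (simp add: cinner_norm norm_power)
      also have "\<dots> = norm (cinner x ((star T * T) \<cdot> x))" by (simp add: bop_star_right bop_times_apply)
      also have "\<dots> \<le> norm x * (norm (star T * T) * norm x)"
        by (rule order_trans[OF cinner_cauchy_schwarz]) (simp add: bop_norm_apply mult_left_mono)
      finally have "(norm (T \<cdot> x))\<^sup>2 \<le> (sqrt (norm (star T * T)) * norm x)\<^sup>2"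
        by (simp add: power_mult_distrib power2_eq_square algebra_simps)
      then show "norm (T \<cdot> x) \<le> sqrt (norm (star T * T)) * norm x"
        by (rule power2_le_imp_le) simp
    qed simp
    then have "(norm T)\<^sup>2 \<le> (sqrt (norm (star T * T)))\<^sup>2" by (rule power_mono) simp
    then show ?thesis by simp
  qed
  have le: "norm T \<le> norm (star T)" for T :: "'a bop"
  proof (cases "T = 0")
    case False
    have "norm T * norm T \<le> norm (star T) * norm T"
      using sq[of T] mult[of "star T" T] by (simp add: power2_eq_square)
    then show ?thesis using False by simp
  qed simp
  have "norm (star S * S) \<le> norm S * norm S"
    using mult[of "star S" S] le[of "star S"] by (simp add: ss) (meson mult_right_mono norm_ge_zero order_trans)
  then show "norm (star S * S) = (norm S)\<^sup>2"
    using sq[of S] by (simp add: power2_eq_square)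
next
  fix X :: "nat \<Rightarrow> 'a bop"
  assume "Cauchy X"
  then have "Cauchy (\<lambda>n. bop_blinfun (X n))"
    by (simp add: Cauchy_def dist_norm bop_blinfun_minus[symmetric] norm_bop_def)
  then obtain L where L: "(\<lambda>n. bop_blinfun (X n)) \<longlonglongrightarrow> L"
    using Cauchy_convergent_iff convergent_def by blast
  have "blinfun_apply L (c *\<^sub>C x) = c *\<^sub>C blinfun_apply L x" for c x
  proof (rule LIMSEQ_unique)
    show "(\<lambda>n. X n \<cdot> (c *\<^sub>C x)) \<longlonglongrightarrow> blinfun_apply L (c *\<^sub>C x)"
      unfolding bop_apply_def by (intro blinfun.tendsto L tendsto_const)
    have "(\<lambda>n. X n \<cdot> x) \<longlonglongrightarrow> blinfun_apply L x"
      unfolding bop_apply_def by (intro blinfun.tendsto L tendsto_const)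
    then show "(\<lambda>n. X n \<cdot> (c *\<^sub>C x)) \<longlonglongrightarrow> c *\<^sub>C blinfun_apply L x"
      unfolding bop_apply_scaleC by (rule tendsto_scaleC)
  qed
  then have "bop_blinfun (Abs_bop L) = L" by (simp add: Abs_bop_inverse)
  then have "X \<longlonglongrightarrow> Abs_bop L"
    using L by (simp add: LIMSEQ_def dist_norm norm_bop_def bop_blinfun_minus)
  then show "convergent X" by (auto simp: convergent_def)
qed

end


section \<open>The multiplier algebra\<close>

text \<open>Elements of \<open>M(A)\<close> are double centralizers: pairs \<open>(L, R)\<close> of left and right multiplications,
  with norm \<open>\<parallel>L\<parallel> = \<parallel>R\<parallel>\<close>.\<close>

typedef (overloaded) ('a::cstar_algebra) multiplier =
  "{(L :: 'a \<Rightarrow>\<^sub>L 'a, R :: 'a \<Rightarrow>\<^sub>L 'a).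
     (\<forall>c a. blinfun_apply L (c *\<^sub>C a) = c *\<^sub>C blinfun_apply L a) \<and>
     (\<forall>c a. blinfun_apply R (c *\<^sub>C a) = c *\<^sub>C blinfun_apply R a) \<and>
     (\<forall>a b. blinfun_apply L (a * b) = blinfun_apply L a * b) \<and>
     (\<forall>a b. blinfun_apply R (a * b) = a * blinfun_apply R b) \<and>
     (\<forall>a b. blinfun_apply R a * b = a * blinfun_apply L b)}"
  morphisms multiplier_pair Abs_multiplier
  by (rule exI[of _ "(0, 0)"]) simp

definition lmul :: "'a::cstar_algebra multiplier \<Rightarrow> 'a \<Rightarrow> 'a" where
  "lmul m a = blinfun_apply (fst (multiplier_pair m)) a"

definition rmul :: "'a::cstar_algebra \<Rightarrow> 'a multiplier \<Rightarrow> 'a" where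
  "rmul a m = blinfun_apply (snd (multiplier_pair m)) a"

definition multiplier :: "('a::cstar_algebra \<Rightarrow> 'a) \<Rightarrow> ('a \<Rightarrow> 'a) \<Rightarrow> 'a multiplier" where
  "multiplier L R = Abs_multiplier (Blinfun L, Blinfun R)"

lemma multiplier_props:
  fixes m :: "'a::cstar_algebra multiplier"
  shows lmul_scaleC: "lmul m (c *\<^sub>C a) = c *\<^sub>C lmul m a"
    and rmul_scaleC: "rmul (c *\<^sub>C a) m = c *\<^sub>C rmul a m"
    and lmul_mult: "lmul m (a * b) = lmul m a * b"
    and rmul_mult: "rmul (a * b) m = a * rmul b m"
    and rmul_lmul: "rmul a m * b = a * lmul m b"
  using multiplier_pair[of m] by (auto simp: lmul_def rmul_def split: prod.splits)

lemma bounded_linear_lmul: "bounded_linear (lmul m)"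
  unfolding lmul_def by (rule blinfun.bounded_linear_right)

lemma bounded_linear_rmul: "bounded_linear (\<lambda>a. rmul a m)"
  unfolding rmul_def by (rule blinfun.bounded_linear_right)

lemma multiplier_eqI:
  assumes "\<And>a. lmul m a = lmul n a"
  shows "m = n"
proof -
  have "rmul a m = rmul a n" for a
    by (rule cstar_eqI_right) (simp add: rmul_lmul assms)
  then have "multiplier_pair m = multiplier_pair n"
    using assms by (auto intro!: prod_eqI blinfun_eqI simp: lmul_def rmul_def)
  then show ?thesis by (simp add: multiplier_pair_inject)
qed

lemma multiplier_apply:
  fixes L R :: "'a::cstar_algebra \<Rightarrow> 'a"
  assumes L: "bounded_linear L" and R: "bounded_linear R" and c: "\<And>a b. R a * b = a * L b"
  shows lmul_multiplier: "lmul (multiplier L R) a = L a"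
    and rmul_multiplier: "rmul a (multiplier L R) = R a"
proof -
  have "L (z *\<^sub>C x) = z *\<^sub>C L x" for z x
    by (rule cstar_eqI_left) (simp add: c[symmetric] scaleC_mult_right)
  moreover have "R (z *\<^sub>C x) = z *\<^sub>C R x" for z x
    by (rule cstar_eqI_right) (simp add: c scaleC_mult_left)
  moreover have "L (x * y) = L x * y" for x y
    by (rule cstar_eqI_left) (metis c mult.assoc)
  moreover have "R (x * y) = x * R y" for x y
    by (rule cstar_eqI_right) (metis c mult.assoc)
  ultimately have "multiplier_pair (multiplier L R) = (Blinfun L, Blinfun R)"
    unfolding multiplier_def
    by (intro Abs_multiplier_inverse) (simp add: bounded_linear_Blinfun_apply L R c)
  then show "lmul (multiplier L R) a = L a" "rmul a (multiplier L R) = R a"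
    by (simp_all add: lmul_def rmul_def bounded_linear_Blinfun_apply L R)
qed

lemma lmul_add: "lmul m (a + b) = lmul m a + lmul m b"
  by (rule linear_simps(1)[OF bounded_linear_lmul])

lemma lmul_diff: "lmul m (a - b) = lmul m a - lmul m b"
  by (rule linear_simps(2)[OF bounded_linear_lmul])

lemma lmul_scaleR: "lmul m (r *\<^sub>R a) = r *\<^sub>R lmul m a"
  by (rule linear_simps(5)[OF bounded_linear_lmul])

lemma rmul_add: "rmul (a + b) m = rmul a m + rmul b m"
  by (rule linear_simps(1)[OF bounded_linear_rmul])

lemma rmul_scaleR: "rmul (r *\<^sub>R a) m = r *\<^sub>R rmul a m"
  by (rule linear_simps(5)[OF bounded_linear_rmul])

definition mult_of :: "'a::cstar_algebra \<Rightarrow> 'a multiplier" where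
  "mult_of a = multiplier (\<lambda>b. a * b) (\<lambda>b. b * a)"

lemma mult_of_apply: "lmul (mult_of a) b = a * b" "rmul b (mult_of a) = b * a"
  unfolding mult_of_def
  by (auto intro!: lmul_multiplier rmul_multiplier bounded_linear_mult_left bounded_linear_mult_right
      simp: mult.assoc)

instantiation multiplier :: (cstar_algebra) "{complex_normed_vector, real_algebra}"
begin

definition "norm_multiplier (m :: 'a multiplier) = onorm (lmul m)"
definition "minus_multiplier m n =
  multiplier (\<lambda>a. lmul m a - lmul n a) (\<lambda>a. rmul a m - rmul a n :: 'a)"
definition "uminus_multiplier m = multiplier (\<lambda>a. - lmul m a) (\<lambda>a. - rmul a m :: 'a)"
definition "zero_multiplier = multiplier (\<lambda>a. 0) (\<lambda>a. 0 :: 'a)"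
definition "plus_multiplier m n =
  multiplier (\<lambda>a. lmul m a + lmul n a) (\<lambda>a. rmul a m + rmul a n :: 'a)"
definition "scaleR_multiplier r m = multiplier (\<lambda>a. r *\<^sub>R lmul m a) (\<lambda>a. r *\<^sub>R rmul a m :: 'a)"
definition "scaleC_multiplier c m = multiplier (\<lambda>a. c *\<^sub>C lmul m a) (\<lambda>a. c *\<^sub>C rmul a m :: 'a)"
definition "times_multiplier m n =
  multiplier (\<lambda>a. lmul m (lmul n a)) (\<lambda>a. rmul (rmul a m) n :: 'a)"
definition "dist_multiplier m n = norm (m - n :: 'a multiplier)"
definition [code del]:
  "(uniformity :: ('a multiplier \<times> 'a multiplier) filter) =
    (INF e\<in>{0 <..}. principal {(x, y). dist x y < e})"
definition [code del]:
  "open_multiplier (S :: 'a multiplier set) \<longleftrightarrow> (\<forall>x\<in>S. \<forall>\<^sub>F (x', y) in uniformity. x' = x \<longrightarrow> y \<in> S)"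
definition "sgn_multiplier m = inverse (norm m) *\<^sub>R (m :: 'a multiplier)"

lemma lmul_minus_left: "lmul (m - n) (a::'a) = lmul m a - lmul n a"
  and rmul_minus_right: "rmul (a::'a) (m - n) = rmul a m - rmul a n"
  unfolding minus_multiplier_def
  by (auto intro!: lmul_multiplier rmul_multiplier bounded_linear_sub bounded_linear_lmul
      bounded_linear_rmul simp: rmul_lmul left_diff_distrib right_diff_distrib)

lemma lmul_uminus_left: "lmul (- m) (a::'a) = - lmul m a"
  and rmul_uminus_right: "rmul (a::'a) (- m) = - rmul a m"
  unfolding uminus_multiplier_def
  by (auto intro!: lmul_multiplier rmul_multiplier bounded_linear_minus bounded_linear_lmul
      bounded_linear_rmul simp: rmul_lmul algebra_simps)

lemma lmul_zero_left: "lmul 0 (a::'a) = 0"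
  and rmul_zero_right: "rmul (a::'a) 0 = 0"
  unfolding zero_multiplier_def
  by (auto intro!: lmul_multiplier rmul_multiplier)

lemma lmul_plus_left: "lmul (m + n) (a::'a) = lmul m a + lmul n a"
  and rmul_plus_right: "rmul (a::'a) (m + n) = rmul a m + rmul a n"
  unfolding plus_multiplier_def
  by (auto intro!: lmul_multiplier rmul_multiplier bounded_linear_add bounded_linear_lmul
      bounded_linear_rmul simp: rmul_lmul algebra_simps)

lemma lmul_scaleR_left: "lmul (r *\<^sub>R m) (a::'a) = r *\<^sub>R lmul m a"
  and rmul_scaleR_right: "rmul (a::'a) (r *\<^sub>R m) = r *\<^sub>R rmul a m"
  unfolding scaleR_multiplier_def
  by (auto intro!: lmul_multiplier rmul_multiplier bounded_linear_const_scaleR bounded_linear_lmul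
      bounded_linear_rmul simp: rmul_lmul)

lemma lmul_scaleC_left: "lmul (c *\<^sub>C m) (a::'a) = c *\<^sub>C lmul m a"
  and rmul_scaleC_right: "rmul (a::'a) (c *\<^sub>C m) = c *\<^sub>C rmul a m"
  unfolding scaleC_multiplier_def
  by (auto intro!: lmul_multiplier rmul_multiplier
      bounded_linear_compose[OF bounded_linear_scaleC bounded_linear_lmul]
      bounded_linear_compose[OF bounded_linear_scaleC bounded_linear_rmul]
      simp: rmul_lmul scaleC_mult_left scaleC_mult_right)

lemma lmul_times_left: "lmul (m * n) (a::'a) = lmul m (lmul n a)"
  and rmul_times_right: "rmul (a::'a) (m * n) = rmul (rmul a m) n"
  unfolding times_multiplier_def
  by (auto intro!: lmul_multiplier rmul_multiplier
      bounded_linear_compose[OF bounded_linear_lmul bounded_linear_lmul]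
      bounded_linear_compose[OF bounded_linear_rmul bounded_linear_rmul]
      simp: rmul_lmul)

lemmas lmul_simps = lmul_minus_left lmul_uminus_left lmul_zero_left lmul_plus_left
  lmul_scaleR_left lmul_scaleC_left lmul_times_left

lemmas rmul_simps = rmul_minus_right rmul_uminus_right rmul_zero_right rmul_plus_right
  rmul_scaleR_right rmul_scaleC_right rmul_times_right

lemma norm_lmul: "norm (lmul m a) \<le> norm m * norm (a::'a)"
  unfolding norm_multiplier_def by (rule onorm[OF bounded_linear_lmul])

lemma norm_multiplier_bound:
  "0 \<le> b \<Longrightarrow> (\<And>a::'a. norm (lmul m a) \<le> b * norm a) \<Longrightarrow> norm m \<le> b"
  unfolding norm_multiplier_def by (rule onorm_bound)

lemma norm_multiplier_nonneg: "0 \<le> norm (m :: 'a multiplier)"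
  unfolding norm_multiplier_def by (rule onorm_pos_le[OF bounded_linear_lmul])

instance
proof
  fix S T U :: "'a multiplier" and r s :: real and c d :: complex
  show "S + T + U = S + (T + U)" "S + T = T + S" "0 + S = S" "- S + S = 0" "S - T = S + - T"
    "r *\<^sub>R (S + T) = r *\<^sub>R S + r *\<^sub>R T" "(r + s) *\<^sub>R S = r *\<^sub>R S + s *\<^sub>R S"
    "r *\<^sub>R s *\<^sub>R S = (r * s) *\<^sub>R S" "1 *\<^sub>R S = S"
    by (auto intro!: multiplier_eqI simp: lmul_simps scaleR_add_right scaleR_add_left)
  show "c *\<^sub>C (S + T) = c *\<^sub>C S + c *\<^sub>C T" "(c + d) *\<^sub>C S = c *\<^sub>C S + d *\<^sub>C S"
    "c *\<^sub>C d *\<^sub>C S = (c * d) *\<^sub>C S" "complex_of_real r *\<^sub>C S = r *\<^sub>R S"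
    by (auto intro!: multiplier_eqI
        simp: lmul_simps scaleC_add_right scaleC_add_left scaleC_scaleC scaleC_of_real)
  show "S * T * U = S * (T * U)" "(S + T) * U = S * U + T * U" "S * (T + U) = S * T + S * U"
    "r *\<^sub>R S * T = r *\<^sub>R (S * T)" "S * r *\<^sub>R T = r *\<^sub>R (S * T)"
    by (auto intro!: multiplier_eqI simp: lmul_simps lmul_add lmul_scaleR)
  show "dist S T = norm (S - T)" by (rule dist_multiplier_def)
  show "sgn S = inverse (norm S) *\<^sub>R S" by (rule sgn_multiplier_def)
  show "(uniformity :: ('a multiplier \<times> 'a multiplier) filter) =
      (INF e\<in>{0 <..}. principal {(x, y). dist x y < e})"
    by (rule uniformity_multiplier_def)
  show "open V \<longleftrightarrow> (\<forall>x\<in>V. \<forall>\<^sub>F (x', y) in uniformity. x' = x \<longrightarrow> y \<in> V)"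
    for V :: "'a multiplier set"
    by (rule open_multiplier_def)
  show "norm S = 0 \<longleftrightarrow> S = 0"
    unfolding norm_multiplier_def onorm_eq_0[OF bounded_linear_lmul]
    by (auto intro!: multiplier_eqI simp: lmul_simps)
  show "norm (S + T) \<le> norm S + norm T"
  proof (rule norm_multiplier_bound)
    show "0 \<le> norm S + norm T" by (simp add: norm_multiplier_nonneg)
    fix a :: 'a
    have "norm (lmul S a + lmul T a) \<le> norm S * norm a + norm T * norm a"
      by (rule norm_triangle_le) (intro add_mono norm_lmul)
    then show "norm (lmul (S + T) a) \<le> (norm S + norm T) * norm a"
      by (simp add: lmul_simps algebra_simps)
  qed
  have le: "norm (c *\<^sub>C S) \<le> norm c * norm S" for c :: complex and S :: "'a multiplier"
  proof (rule norm_multiplier_bound)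
    show "0 \<le> norm c * norm S" by (simp add: norm_multiplier_nonneg)
    fix x :: 'a
    show "norm (lmul (c *\<^sub>C S) x) \<le> norm c * norm S * norm x"
      using norm_lmul[of S x]
      by (simp add: lmul_simps norm_scaleC mult_left_mono mult.assoc)
  qed
  show nC: "norm (c *\<^sub>C S) = norm c * norm S" for c :: complex
  proof (cases "c = 0")
    case True
    have "norm (c *\<^sub>C S) \<le> 0" using le[of c S] True by simp
    then show ?thesis using True norm_multiplier_nonneg[of "c *\<^sub>C S"] by simp
  next
    case False
    have "inverse c *\<^sub>C (c *\<^sub>C S) = S"
      by (rule multiplier_eqI) (simp add: lmul_simps scaleC_scaleC False)
    then have "norm S \<le> norm (inverse c) * norm (c *\<^sub>C S)" using le[of "inverse c" "c *\<^sub>C S"] by simp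
    then have "norm c * norm S \<le> norm (c *\<^sub>C S)"
      using False by (simp add: norm_inverse norm_divide field_simps)
    with le show ?thesis by (simp add: order_antisym)
  qed
  have "complex_of_real r *\<^sub>C S = r *\<^sub>R S"
    by (rule multiplier_eqI) (simp add: lmul_simps scaleC_of_real)
  then show "norm (r *\<^sub>R S) = \<bar>r\<bar> * norm S" using nC[of "complex_of_real r"] by simp
qed

end

lemma norm_rmul: "norm (rmul a m) \<le> norm m * norm (a::'a::cstar_algebra)"
proof (cases "rmul a m = 0")
  case False
  have "(norm (rmul a m))\<^sup>2 = norm (rmul a m * star (rmul a m))"
    by (metis norm_star norm_star_mult star_star)
  also have "\<dots> = norm (a * lmul m (star (rmul a m)))" by (simp add: rmul_lmul)
  also have "\<dots> \<le> norm a * (norm m * norm (rmul a m))"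
    by (rule order_trans[OF norm_mult_ineq])
      (metis mult_left_mono norm_ge_zero norm_lmul norm_star)
  finally have "norm (rmul a m) * norm (rmul a m) \<le> norm (rmul a m) * (norm m * norm a)"
    by (simp add: power2_eq_square algebra_simps)
  then show ?thesis using False by simp
qed simp

instantiation multiplier :: (cstar_algebra) "{cstar_algebra, monoid_mult}"
begin

definition "one_multiplier = multiplier (\<lambda>a. a) (\<lambda>a. a :: 'a)"
definition "star_multiplier m = multiplier (\<lambda>a. star (rmul (star a) m)) (\<lambda>a. star (lmul m (star a)) :: 'a)"

lemma lmul_one: "lmul 1 (a::'a) = a" and rmul_one: "rmul (a::'a) 1 = a"
  unfolding one_multiplier_def
  by (auto intro!: lmul_multiplier rmul_multiplier bounded_linear_ident)

lemma lmul_star: "lmul (star m) (a::'a) = star (rmul (star a) m)"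
  and rmul_star: "rmul (a::'a) (star m) = star (lmul m (star a))"
proof -
  have 1: "bounded_linear (\<lambda>a. star (rmul (star a) m))" "bounded_linear (\<lambda>a. star (lmul m (star a)))"
    by (intro bounded_linear_compose[OF bounded_linear_star]
        bounded_linear_compose[OF bounded_linear_rmul bounded_linear_star]
        bounded_linear_compose[OF bounded_linear_lmul bounded_linear_star])+
  have 2: "star (lmul m (star a)) * b = a * star (rmul (star b) m)" for a b
    by (metis rmul_lmul star_mult star_star)
  show "lmul (star m) a = star (rmul (star a) m)" "rmul a (star m) = star (lmul m (star a))"
    unfolding star_multiplier_def
    by (rule lmul_multiplier[OF 1 2], rule rmul_multiplier[OF 1 2])
qed

instance
proof
  fix S T :: "'a multiplier" and c :: complex
  show "1 * T = T" "T * 1 = T" by (auto intro!: multiplier_eqI simp: lmul_simps lmul_one)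
  show "c *\<^sub>C S * T = c *\<^sub>C (S * T)" "S * c *\<^sub>C T = c *\<^sub>C (S * T)"
    by (auto intro!: multiplier_eqI simp: lmul_simps lmul_scaleC)
  show "star (S + T) = star S + star T" "star (c *\<^sub>C S) = cnj c *\<^sub>C star S"
    "star (S * T) = star T * star S"
    by (auto intro!: multiplier_eqI simp: lmul_simps lmul_star rmul_simps star_add star_scaleC star_star)
  show "star (star S) = S"
    by (auto intro!: multiplier_eqI simp: lmul_simps lmul_star rmul_star star_star)
  show mult: "norm (S * T) \<le> norm S * norm T" for S T :: "'a multiplier"
  proof (rule norm_multiplier_bound)
    fix x
    have "norm (lmul S (lmul T x)) \<le> norm S * norm (lmul T x)" by (rule norm_lmul)
    also have "\<dots> \<le> norm S * (norm T * norm x)" by (simp add: norm_lmul mult_left_mono)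
    finally show "norm (lmul (S * T) x) \<le> norm S * norm T * norm x"
      by (simp add: lmul_simps mult.assoc)
  qed simp
  have sq: "(norm T)\<^sup>2 \<le> norm (star T * T)" for T :: "'a multiplier"
  proof -
    have "norm T \<le> sqrt (norm (star T * T))"
    proof (rule norm_multiplier_bound)
      fix x
      have "star x * lmul (star T * T) x = star (lmul T x) * lmul T x"
        by (metis lmul_times_left rmul_lmul rmul_star star_star)
      then have "(norm (lmul T x))\<^sup>2 = norm (star x * lmul (star T * T) x)"
        by (simp add: norm_star_mult)
      also have "\<dots> \<le> norm x * (norm (star T * T) * norm x)"
        by (rule order_trans[OF norm_mult_ineq]) (simp add: norm_star norm_lmul mult_left_mono)
      finally have "(norm (lmul T x))\<^sup>2 \<le> (sqrt (norm (star T * T)) * norm x)\<^sup>2"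
        by (simp add: power_mult_distrib power2_eq_square algebra_simps)
      then show "norm (lmul T x) \<le> sqrt (norm (star T * T)) * norm x"
        by (rule power2_le_imp_le) simp
    qed simp
    then have "(norm T)\<^sup>2 \<le> (sqrt (norm (star T * T)))\<^sup>2" by (rule power_mono) simp
    then show ?thesis by simp
  qed
  have "norm (star S) \<le> norm S"
    by (rule norm_multiplier_bound) (simp_all add: lmul_star norm_star, metis norm_rmul norm_star)
  then have "norm (star S * S) \<le> norm S * norm S"
    using mult[of "star S" S] by (meson mult_right_mono norm_ge_zero order_trans)
  then show "norm (star S * S) = (norm S)\<^sup>2"
    using sq[of S] by (simp add: power2_eq_square)
next
  fix X :: "nat \<Rightarrow> 'a multiplier"
  assume X: "Cauchy X"
  define L where "L n = fst (multiplier_pair (X n))" for n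
  define R where "R n = snd (multiplier_pair (X n))" for n
  have nL: "norm (L p - L n) \<le> norm (X p - X n)" for p n
    by (rule norm_blinfun_bound)
      (simp_all add: L_def blinfun.diff_left lmul_def[symmetric] lmul_minus_left[symmetric] norm_lmul)
  have nR: "norm (R p - R n) \<le> norm (X p - X n)" for p n
    by (rule norm_blinfun_bound)
      (simp_all add: R_def blinfun.diff_left rmul_def[symmetric] rmul_minus_right[symmetric] norm_rmul)
  have "Cauchy L" "Cauchy R"
    using X unfolding Cauchy_def dist_norm by (meson nL nR le_less_trans)+
  then obtain L' R' where L': "L \<longlonglongrightarrow> L'" and R': "R \<longlonglongrightarrow> R'"
    by (meson Cauchy_convergent convergent_def)
  have La: "(\<lambda>n. lmul (X n) a) \<longlonglongrightarrow> blinfun_apply L' a" for a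
    using blinfun.tendsto[OF L' tendsto_const[of a]] by (simp add: L_def lmul_def)
  have Ra: "(\<lambda>n. rmul a (X n)) \<longlonglongrightarrow> blinfun_apply R' a" for a
    using blinfun.tendsto[OF R' tendsto_const[of a]] by (simp add: R_def rmul_def)
  have RL: "blinfun_apply R' a * b = a * blinfun_apply L' b" for a b
  proof (rule LIMSEQ_unique)
    show "(\<lambda>n. rmul a (X n) * b) \<longlonglongrightarrow> blinfun_apply R' a * b"
      by (intro tendsto_intros Ra)
    show "(\<lambda>n. rmul a (X n) * b) \<longlonglongrightarrow> a * blinfun_apply L' b"
      unfolding rmul_lmul by (intro tendsto_intros La)
  qed
  define m where "m = multiplier (blinfun_apply L') (blinfun_apply R')"
  have m: "lmul m a = blinfun_apply L' a" for a
    unfolding m_def using RL by (intro lmul_multiplier blinfun.bounded_linear_right)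
  have "norm (X n - m) \<le> norm (L n - L')" for n
  proof (rule norm_multiplier_bound)
    fix a
    have "lmul (X n - m) a = blinfun_apply (L n - L') a"
      by (simp add: lmul_minus_left m blinfun.diff_left) (simp add: L_def lmul_def)
    then show "norm (lmul (X n - m) a) \<le> norm (L n - L') * norm a"
      by (simp add: norm_blinfun)
  qed simp
  then have "X \<longlonglongrightarrow> m"
    using L' unfolding LIMSEQ_def dist_norm by (meson le_less_trans)
  then show "convergent X" by (auto simp: convergent_def)
qed

end

definition strict_topology :: "'a::cstar_algebra multiplier topology" where
  "strict_topology = topology_generated_by
     ({{n. norm (lmul (n - m) a) < e} |m a e. e > 0} \<union> {{n. norm (rmul a (n - m)) < e} |m a e. e > 0})"

definition strict_lim :: "'i filter \<Rightarrow> ('i \<Rightarrow> 'a::cstar_algebra multiplier) \<Rightarrow> 'a multiplier" where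
  "strict_lim F f = (THE m. limitin strict_topology f m F)"

definition strict_extension ::
    "('a::cstar_algebra \<Rightarrow> 'a) \<Rightarrow> ('a multiplier \<Rightarrow> 'a multiplier) \<Rightarrow> bool" where
  "strict_extension f g \<longleftrightarrow> star_hom g \<and> continuous_map strict_topology strict_topology g \<and>
     (\<forall>a. g (mult_of a) = mult_of (f a))"

definition extendible :: "('a::cstar_algebra \<Rightarrow> 'a) \<Rightarrow> bool" where
  "extendible f \<longleftrightarrow> (\<exists>g. strict_extension f g)"

definition strict_ext :: "('a::cstar_algebra \<Rightarrow> 'a) \<Rightarrow> 'a multiplier \<Rightarrow> 'a multiplier" where
  "strict_ext f = (THE g. strict_extension f g)"

text \<open>The real span below is the complex span, as the set is closed under complex scalars
  (likewise for \<open>nondegenerate_rep\<close>).\<close>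

definition nondegenerate_hom :: "('a::cstar_algebra \<Rightarrow> 'b::cstar_algebra) \<Rightarrow> bool" where
  "nondegenerate_hom f \<longleftrightarrow> star_hom f \<and> closure (span {f a * b |a b. True}) = UNIV"

definition nondegenerate_rep :: "('a::cstar_algebra \<Rightarrow> 'h::complex_hilbert_space bop) \<Rightarrow> bool" where
  "nondegenerate_rep \<pi> \<longleftrightarrow> star_hom \<pi> \<and> closure (span {\<pi> a \<cdot> h |a h. True}) = UNIV"

text \<open>The extension to \<open>M(A)\<close> of a homomorphism \<open>f\<close> into a unital C*-algebra. It is uniquely determined
  if \<open>f\<close> is a nondegenerate representation on a Hilbert space, or if \<open>f\<close> is \<open>mult_of \<circ> j\<close> for a
  nondegenerate homomorphism \<open>j\<close> into another C*-algebra.\<close>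

definition mult_ext ::
    "('a::cstar_algebra \<Rightarrow> 'b::{cstar_algebra, monoid_mult}) \<Rightarrow> 'a multiplier \<Rightarrow> 'b" where
  "mult_ext f = (THE g. star_hom g \<and> (\<forall>a. g (mult_of a) = f a))"


section \<open>Twisted semigroup dynamical systems and their crossed products\<close>

definition twisted_system ::
    "('p::{monoid_mult, countable} \<Rightarrow> 'a::cstar_algebra \<Rightarrow> 'a) \<Rightarrow> ('p \<Rightarrow> 'p \<Rightarrow> complex) \<Rightarrow> bool" where
  "twisted_system \<beta> \<omega> \<longleftrightarrow>
     (\<forall>s. star_hom (\<beta> s) \<and> extendible (\<beta> s)) \<and>
     (\<forall>s t. \<beta> s \<circ> \<beta> t = \<beta> (s * t)) \<and> \<beta> 1 = id \<and>
     (\<forall>s t. norm (\<omega> s t) = 1) \<and> \<omega> 1 1 = 1 \<and>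
     (\<forall>r s t. \<omega> r s * \<omega> (r * s) t = \<omega> r (s * t) * \<omega> s t)"

definition omega_rep ::
    "('p::monoid_mult \<Rightarrow> 'p \<Rightarrow> complex) \<Rightarrow> ('p \<Rightarrow> 'b::cstar_algebra) \<Rightarrow> bool" where
  "omega_rep \<omega> V \<longleftrightarrow> (\<forall>s t. V s * V t = \<omega> s t *\<^sub>C V (s * t))"

definition isometry :: "'b::{cstar_algebra, monoid_mult} \<Rightarrow> bool" where
  "isometry v \<longleftrightarrow> star v * v = 1"

definition partial_isometry :: "'b::cstar_algebra \<Rightarrow> bool" where
  "partial_isometry v \<longleftrightarrow> v * star v * v = v"

definition covariant_rep ::
    "('p::{monoid_mult, countable} \<Rightarrow> 'a::cstar_algebra \<Rightarrow> 'a) \<Rightarrow> ('p \<Rightarrow> 'p \<Rightarrow> complex) \<Rightarrow>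
     ('a \<Rightarrow> 'h::complex_hilbert_space bop) \<Rightarrow> ('p \<Rightarrow> 'h bop) \<Rightarrow> bool" where
  "covariant_rep \<beta> \<omega> \<pi> V \<longleftrightarrow> nondegenerate_rep \<pi> \<and> omega_rep \<omega> V \<and> (\<forall>s. isometry (V s)) \<and>
     (\<forall>s a. \<pi> (\<beta> s a) = V s * \<pi> a * star (V s))"

definition toeplitz_covariant_rep ::
    "('p::{monoid_mult, countable} \<Rightarrow> 'a::cstar_algebra \<Rightarrow> 'a) \<Rightarrow> ('p \<Rightarrow> 'p \<Rightarrow> complex) \<Rightarrow>
     ('a \<Rightarrow> 'h::complex_hilbert_space bop) \<Rightarrow> ('p \<Rightarrow> 'h bop) \<Rightarrow> bool" where
  "toeplitz_covariant_rep \<beta> \<omega> \<pi> V \<longleftrightarrow>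
     nondegenerate_rep \<pi> \<and> omega_rep \<omega> V \<and> (\<forall>s. partial_isometry (V s)) \<and>
     (\<forall>s a. \<pi> (\<beta> s a) = V s * \<pi> a * star (V s)) \<and>
     (\<forall>s a. star (V s) * V s * \<pi> a = \<pi> a * star (V s) * V s)"

text \<open>\<open>universal_triple \<C> j\<^sub>A j\<^sub>P\<close> says that \<open>(B, j\<^sub>A, j\<^sub>P)\<close> satisfies the axioms of a crossed product for the
  class \<open>\<C>\<close> of pairs \<open>(\<pi>, V)\<close>. The C*-algebra \<open>B\<close> is the whole type \<open>'b\<close>, and \<open>\<C>\<close> consists of pairs acting
  on the Hilbert space \<open>'h\<close>, so that quantification over all Hilbert spaces is obtained by
  leaving \<open>'h\<close> a type variable of the theorem. The product \<open>j\<^sub>A(a)j\<^sub>P(s)\<close>, which lies in \<open>B\<close>, is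
  \<open>rmul (j\<^sub>A a) (j\<^sub>P s)\<close>.\<close>

definition universal_triple ::
    "(('a::cstar_algebra \<Rightarrow> 'h::complex_hilbert_space bop) \<Rightarrow> ('p \<Rightarrow> 'h bop) \<Rightarrow> bool) \<Rightarrow>
     ('a \<Rightarrow> 'b::cstar_algebra) \<Rightarrow> ('p \<Rightarrow> 'b multiplier) \<Rightarrow> bool" where
  "universal_triple \<C> jA jP \<longleftrightarrow> nondegenerate_hom jA \<and>
     (\<forall>\<sigma>. nondegenerate_rep \<sigma> \<longrightarrow> \<C> (\<sigma> \<circ> jA) (mult_ext \<sigma> \<circ> jP)) \<and>
     (\<forall>\<pi> V. \<C> \<pi> V \<longrightarrow> (\<exists>\<rho>. star_hom \<rho> \<and> \<rho> \<circ> jA = \<pi> \<and> mult_ext \<rho> \<circ> jP = V)) \<and>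
     cstar_generated {rmul (jA a) (jP s) |a s. True} = UNIV"

definition crossed_product ::
    "'h::complex_hilbert_space itself \<Rightarrow> ('p::{monoid_mult, countable} \<Rightarrow> 'a::cstar_algebra \<Rightarrow> 'a) \<Rightarrow>
     ('p \<Rightarrow> 'p \<Rightarrow> complex) \<Rightarrow> ('a \<Rightarrow> 'b::cstar_algebra) \<Rightarrow> ('p \<Rightarrow> 'b multiplier) \<Rightarrow> bool" where
  "crossed_product (_ :: 'h itself) \<beta> \<omega> jA jP \<longleftrightarrow>
     universal_triple (covariant_rep \<beta> \<omega> :: ('a \<Rightarrow> 'h bop) \<Rightarrow> _) jA jP"

definition toeplitz_crossed_product ::
    "'h::complex_hilbert_space itself \<Rightarrow> ('p::{monoid_mult, countable} \<Rightarrow> 'a::cstar_algebra \<Rightarrow> 'a) \<Rightarrow>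
     ('p \<Rightarrow> 'p \<Rightarrow> complex) \<Rightarrow> ('a \<Rightarrow> 'b::cstar_algebra) \<Rightarrow> ('p \<Rightarrow> 'b multiplier) \<Rightarrow> bool" where
  "toeplitz_crossed_product (_ :: 'h itself) \<beta> \<omega> jA jP \<longleftrightarrow>
     universal_triple (toeplitz_covariant_rep \<beta> \<omega> :: ('a \<Rightarrow> 'h bop) \<Rightarrow> _) jA jP"

definition canonically_isomorphic ::
    "('a::cstar_algebra \<Rightarrow> 'b::cstar_algebra) \<Rightarrow> ('p \<Rightarrow> 'b multiplier) \<Rightarrow>
     ('a \<Rightarrow> 'c::cstar_algebra) \<Rightarrow> ('p \<Rightarrow> 'c multiplier) \<Rightarrow> bool" where
  "canonically_isomorphic jA jP kA kP \<longleftrightarrow>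
     (\<exists>\<theta>. star_hom \<theta> \<and> bij \<theta> \<and> \<theta> \<circ> jA = kA \<and> mult_ext (mult_of \<circ> \<theta>) \<circ> jP = kP)"

text \<open>By the Gelfand-Naimark theorem every C*-algebra has a faithful, equivalently isometric,
  nondegenerate representation on some Hilbert space. Comparing two algebras by means of the
  universal properties of crossed products at \<open>'h\<close> requires that both be representable on \<open>'h\<close>.\<close>

definition faithfully_representable ::
    "'h::complex_hilbert_space itself \<Rightarrow> 'b::cstar_algebra itself \<Rightarrow> bool" where
  "faithfully_representable (_ :: 'h itself) (_ :: 'b itself) \<longleftrightarrow>
     (\<exists>\<sigma> :: 'b \<Rightarrow> 'h bop. nondegenerate_rep \<sigma> \<and> (\<forall>b. norm (\<sigma> b) = norm b))"


section \<open>Product systems of Hilbert bimodules\<close>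

text \<open>A Hilbert bimodule over the C*-algebra \<open>'a\<close>; its elements form a subset of \<open>'x\<close>.\<close>

record ('x, 'a) bimodule =
  bcarrier :: "'x set"
  badd :: "'x \<Rightarrow> 'x \<Rightarrow> 'x"
  bzero :: 'x
  bscale :: "complex \<Rightarrow> 'x \<Rightarrow> 'x"
  ract :: "'x \<Rightarrow> 'a \<Rightarrow> 'x"
  binner :: "'x \<Rightarrow> 'x \<Rightarrow> 'a"
  lact :: "'a \<Rightarrow> 'x \<Rightarrow> 'x"

definition bnorm :: "('x, 'a::cstar_algebra) bimodule \<Rightarrow> 'x \<Rightarrow> real" where
  "bnorm E x = sqrt (norm (binner E x x))"

definition bminus :: "('x, 'a::cstar_algebra) bimodule \<Rightarrow> 'x \<Rightarrow> 'x \<Rightarrow> 'x" where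
  "bminus E x y = badd E x (bscale E (- 1) y)"

text \<open>The left action is by adjointable operators, the adjoint of the action of \<open>a\<close> being the
  action of \<open>star a\<close>.\<close>

definition hilbert_bimodule :: "('x, 'a::cstar_algebra) bimodule \<Rightarrow> bool" where
  "hilbert_bimodule E \<longleftrightarrow> (let C = bcarrier E in
     bzero E \<in> C \<and>
     (\<forall>x\<in>C. \<forall>y\<in>C. badd E x y \<in> C \<and> badd E x y = badd E y x) \<and>
     (\<forall>x\<in>C. \<forall>y\<in>C. \<forall>z\<in>C. badd E (badd E x y) z = badd E x (badd E y z)) \<and>
     (\<forall>x\<in>C. badd E x (bzero E) = x \<and> bminus E x x = bzero E) \<and>
     (\<forall>c. \<forall>x\<in>C. bscale E c x \<in> C) \<and>
     (\<forall>c. \<forall>x\<in>C. \<forall>y\<in>C. bscale E c (badd E x y) = badd E (bscale E c x) (bscale E c y)) \<and>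
     (\<forall>c d. \<forall>x\<in>C. bscale E (c + d) x = badd E (bscale E c x) (bscale E d x) \<and>
        bscale E c (bscale E d x) = bscale E (c * d) x) \<and>
     (\<forall>x\<in>C. bscale E 1 x = x) \<and>
     (\<forall>x\<in>C. \<forall>a. ract E x a \<in> C) \<and>
     (\<forall>x\<in>C. \<forall>y\<in>C. \<forall>a. ract E (badd E x y) a = badd E (ract E x a) (ract E y a)) \<and>
     (\<forall>x\<in>C. \<forall>a b. ract E x (a + b) = badd E (ract E x a) (ract E x b) \<and>
        ract E (ract E x a) b = ract E x (a * b)) \<and>
     (\<forall>c. \<forall>x\<in>C. \<forall>a. ract E (bscale E c x) a = bscale E c (ract E x a) \<and>
        ract E x (c *\<^sub>C a) = bscale E c (ract E x a)) \<and>
     (\<forall>x\<in>C. \<forall>y\<in>C. \<forall>z\<in>C. binner E x (badd E y z) = binner E x y + binner E x z) \<and>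
     (\<forall>c. \<forall>x\<in>C. \<forall>y\<in>C. binner E x (bscale E c y) = c *\<^sub>C binner E x y) \<and>
     (\<forall>x\<in>C. \<forall>y\<in>C. \<forall>a. binner E x (ract E y a) = binner E x y * a) \<and>
     (\<forall>x\<in>C. \<forall>y\<in>C. star (binner E x y) = binner E y x) \<and>
     (\<forall>x\<in>C. (\<exists>b. binner E x x = star b * b) \<and> (binner E x x = 0 \<longrightarrow> x = bzero E)) \<and>
     (\<forall>x. (\<forall>n. x n \<in> C) \<and> (\<forall>e>0. \<exists>N. \<forall>m\<ge>N. \<forall>n\<ge>N. bnorm E (bminus E (x m) (x n)) < e) \<longrightarrow>
        (\<exists>y\<in>C. (\<lambda>n. bnorm E (bminus E (x n) y)) \<longlonglongrightarrow> 0)) \<and>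
     (\<forall>a. \<forall>x\<in>C. lact E a x \<in> C) \<and>
     (\<forall>a. \<forall>x\<in>C. \<forall>y\<in>C. binner E (lact E a x) y = binner E x (lact E (star a) y)) \<and>
     (\<forall>a b. \<forall>x\<in>C. lact E (a + b) x = badd E (lact E a x) (lact E b x) \<and>
        lact E (a * b) x = lact E a (lact E b x)) \<and>
     (\<forall>c a. \<forall>x\<in>C. lact E (c *\<^sub>C a) x = bscale E c (lact E a x)))"

text \<open>Operators on a bimodule are functions that are \<open>undefined\<close> off the carrier.\<close>

definition is_adjoint :: "('x, 'a::cstar_algebra) bimodule \<Rightarrow> ('x \<Rightarrow> 'x) \<Rightarrow> ('x \<Rightarrow> 'x) \<Rightarrow> bool" where
  "is_adjoint E T S \<longleftrightarrow> (\<forall>x\<in>bcarrier E. \<forall>y\<in>bcarrier E. binner E (T x) y = binner E x (S y))"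

definition adjointable :: "('x, 'a::cstar_algebra) bimodule \<Rightarrow> ('x \<Rightarrow> 'x) set" where
  "adjointable E = {T \<in> bcarrier E \<rightarrow>\<^sub>E bcarrier E. \<exists>S \<in> bcarrier E \<rightarrow>\<^sub>E bcarrier E. is_adjoint E T S}"

definition op_add :: "('x, 'a::cstar_algebra) bimodule \<Rightarrow> ('x \<Rightarrow> 'x) \<Rightarrow> ('x \<Rightarrow> 'x) \<Rightarrow> 'x \<Rightarrow> 'x" where
  "op_add E T S = (\<lambda>z\<in>bcarrier E. badd E (T z) (S z))"

definition op_scale :: "('x, 'a::cstar_algebra) bimodule \<Rightarrow> complex \<Rightarrow> ('x \<Rightarrow> 'x) \<Rightarrow> 'x \<Rightarrow> 'x" where
  "op_scale E c T = (\<lambda>z\<in>bcarrier E. bscale E c (T z))"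

definition rank_one :: "('x, 'a::cstar_algebra) bimodule \<Rightarrow> 'x \<Rightarrow> 'x \<Rightarrow> 'x \<Rightarrow> 'x" where
  "rank_one E x y = (\<lambda>z\<in>bcarrier E. ract E x (binner E y z))"

definition left_op :: "('x, 'a::cstar_algebra) bimodule \<Rightarrow> 'a \<Rightarrow> 'x \<Rightarrow> 'x" where
  "left_op E a = (\<lambda>z\<in>bcarrier E. lact E a z)"

text \<open>The span of the operators \<open>\<Theta>\<^sub>x\<^sub>,\<^sub>y = rank_one E x y\<close>; note \<open>c\<Theta>\<^sub>x\<^sub>,\<^sub>y = \<Theta>\<^sub>c\<^sub>x\<^sub>,\<^sub>y\<close>.\<close>

inductive_set finite_rank :: "('x, 'a::cstar_algebra) bimodule \<Rightarrow> ('x \<Rightarrow> 'x) set"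
  for E :: "('x, 'a) bimodule" where
  zero: "(\<lambda>z\<in>bcarrier E. bzero E) \<in> finite_rank E"
| add: "T \<in> finite_rank E \<Longrightarrow> x \<in> bcarrier E \<Longrightarrow> y \<in> bcarrier E \<Longrightarrow>
    op_add E T (rank_one E x y) \<in> finite_rank E"

definition compacts :: "('x, 'a::cstar_algebra) bimodule \<Rightarrow> ('x \<Rightarrow> 'x) set" where
  "compacts E = {T \<in> adjointable E. \<forall>e>0. \<exists>S\<in>finite_rank E. \<forall>z\<in>bcarrier E.
     bnorm E (bminus E (T z) (S z)) \<le> e * bnorm E z}"

text \<open>For \<open>\<psi>\<close> the restriction of a Toeplitz representation to a fibre \<open>E = X\<^sub>s\<close>, this is \<open>\<psi>\<^bsup>(s)\<^esup>\<close>,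
  extended by \<open>undefined\<close> off the compact operators.\<close>

definition compacts_hom ::
    "('x, 'a::cstar_algebra) bimodule \<Rightarrow> ('x \<Rightarrow> 'b::cstar_algebra) \<Rightarrow> ('x \<Rightarrow> 'x) \<Rightarrow> 'b" where
  "compacts_hom E \<psi> = (THE \<kappa>. \<kappa> \<in> extensional (compacts E) \<and>
     (\<forall>T\<in>compacts E. \<forall>S\<in>compacts E. \<kappa> (op_add E T S) = \<kappa> T + \<kappa> S \<and>
        \<kappa> (compose (bcarrier E) T S) = \<kappa> T * \<kappa> S \<and> (is_adjoint E T S \<longrightarrow> \<kappa> S = star (\<kappa> T))) \<and>
     (\<forall>c. \<forall>T\<in>compacts E. \<kappa> (op_scale E c T) = c *\<^sub>C \<kappa> T) \<and>
     (\<forall>x\<in>bcarrier E. \<forall>y\<in>bcarrier E. \<kappa> (rank_one E x y) = \<psi> x * star (\<psi> y)))"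

text \<open>\<open>unit_fibre\<close> is the identification of \<open>'a\<close> with the fibre over the identity.\<close>

record ('q, 'x, 'a) prod_sys =
  fibre :: "'q \<Rightarrow> ('x, 'a) bimodule"
  proj :: "'x \<Rightarrow> 'q"
  pmul :: "'x \<Rightarrow> 'x \<Rightarrow> 'x"
  unit_fibre :: "'a \<Rightarrow> 'x"

definition total :: "('q, 'x, 'a) prod_sys \<Rightarrow> 'x set" where
  "total X = (\<Union>s. bcarrier (fibre X s))"

inductive_set bspan :: "('x, 'a) bimodule \<Rightarrow> 'x set \<Rightarrow> 'x set"
  for E :: "('x, 'a) bimodule" and M :: "'x set" where
  zero: "bzero E \<in> bspan E M"
| add: "x \<in> bspan E M \<Longrightarrow> y \<in> M \<Longrightarrow> badd E x (bscale E c y) \<in> bspan E M"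

text \<open>A map \<open>\<mu> : E \<times> F \<rightarrow> G\<close> extends to a Hilbert bimodule isomorphism of the internal tensor product
  \<open>E \<otimes>\<^sub>A F\<close> onto \<open>G\<close>: the tensor product is the completion of the algebraic one in the inner product
  \<open>\<langle>x \<otimes> y, x' \<otimes> y'\<rangle> = \<langle>y, \<langle>x, x'\<rangle> y'\<rangle>\<close>.\<close>

definition tensor_iso ::
    "('x, 'a::cstar_algebra) bimodule \<Rightarrow> ('x, 'a) bimodule \<Rightarrow> ('x, 'a) bimodule \<Rightarrow>
     ('x \<Rightarrow> 'x \<Rightarrow> 'x) \<Rightarrow> bool" where
  "tensor_iso E F G \<mu> \<longleftrightarrow>
     (\<forall>x\<in>bcarrier E. \<forall>y\<in>bcarrier F. \<mu> x y \<in> bcarrier G) \<and>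
     (\<forall>x\<in>bcarrier E. \<forall>x'\<in>bcarrier E. \<forall>y\<in>bcarrier F. \<mu> (badd E x x') y = badd G (\<mu> x y) (\<mu> x' y)) \<and>
     (\<forall>x\<in>bcarrier E. \<forall>y\<in>bcarrier F. \<forall>y'\<in>bcarrier F. \<mu> x (badd F y y') = badd G (\<mu> x y) (\<mu> x y')) \<and>
     (\<forall>c. \<forall>x\<in>bcarrier E. \<forall>y\<in>bcarrier F.
        \<mu> (bscale E c x) y = bscale G c (\<mu> x y) \<and> \<mu> x (bscale F c y) = bscale G c (\<mu> x y)) \<and>
     (\<forall>a. \<forall>x\<in>bcarrier E. \<forall>y\<in>bcarrier F. \<mu> (ract E x a) y = \<mu> x (lact F a y) \<and>
        \<mu> (lact E a x) y = lact G a (\<mu> x y) \<and> \<mu> x (ract F y a) = ract G (\<mu> x y) a) \<and>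
     (\<forall>x\<in>bcarrier E. \<forall>x'\<in>bcarrier E. \<forall>y\<in>bcarrier F. \<forall>y'\<in>bcarrier F.
        binner G (\<mu> x y) (\<mu> x' y') = binner F y (lact F (binner E x x') y')) \<and>
     (\<forall>z\<in>bcarrier G. \<forall>e>0. \<exists>w\<in>bspan G {\<mu> x y |x y. x \<in> bcarrier E \<and> y \<in> bcarrier F}.
        bnorm G (bminus G z w) < e)"

definition product_system :: "('q::monoid_mult, 'x, 'a::cstar_algebra) prod_sys \<Rightarrow> bool" where
  "product_system X \<longleftrightarrow>
     (\<forall>s. hilbert_bimodule (fibre X s) \<and> (\<forall>x\<in>bcarrier (fibre X s). proj X x = s)) \<and>
     (\<forall>x\<in>total X. \<forall>y\<in>total X. pmul X x y \<in> total X \<and> proj X (pmul X x y) = proj X x * proj X y) \<and>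
     (\<forall>x\<in>total X. \<forall>y\<in>total X. \<forall>z\<in>total X. pmul X (pmul X x y) z = pmul X x (pmul X y z)) \<and>
     (\<forall>s t. s \<noteq> 1 \<and> t \<noteq> 1 \<longrightarrow> tensor_iso (fibre X s) (fibre X t) (fibre X (s * t)) (pmul X)) \<and>
     bij_betw (unit_fibre X) UNIV (bcarrier (fibre X 1)) \<and>
     (\<forall>a b. unit_fibre X (a + b) = badd (fibre X 1) (unit_fibre X a) (unit_fibre X b) \<and>
        binner (fibre X 1) (unit_fibre X a) (unit_fibre X b) = star a * b \<and>
        ract (fibre X 1) (unit_fibre X a) b = unit_fibre X (a * b) \<and>
        lact (fibre X 1) a (unit_fibre X b) = unit_fibre X (a * b)) \<and>
     (\<forall>c a. unit_fibre X (c *\<^sub>C a) = bscale (fibre X 1) c (unit_fibre X a)) \<and>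
     (\<forall>s a. \<forall>x\<in>bcarrier (fibre X s). pmul X (unit_fibre X a) x = lact (fibre X s) a x \<and>
        pmul X x (unit_fibre X a) = ract (fibre X s) x a)"

definition toeplitz_rep ::
    "('q, 'x, 'a::cstar_algebra) prod_sys \<Rightarrow> ('x \<Rightarrow> 'b::cstar_algebra) \<Rightarrow> bool" where
  "toeplitz_rep X \<psi> \<longleftrightarrow>
     (\<forall>s. \<forall>x\<in>bcarrier (fibre X s). \<forall>y\<in>bcarrier (fibre X s).
        \<psi> (badd (fibre X s) x y) = \<psi> x + \<psi> y \<and>
        star (\<psi> x) * \<psi> y = \<psi> (unit_fibre X (binner (fibre X s) x y))) \<and>
     (\<forall>s c. \<forall>x\<in>bcarrier (fibre X s). \<psi> (bscale (fibre X s) c x) = c *\<^sub>C \<psi> x) \<and>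
     star_hom (\<lambda>a. \<psi> (unit_fibre X a)) \<and>
     (\<forall>x\<in>total X. \<forall>y\<in>total X. \<psi> (pmul X x y) = \<psi> x * \<psi> y)"

definition cuntz_pimsner_covariant ::
    "('q, 'x, 'a::cstar_algebra) prod_sys \<Rightarrow> ('x \<Rightarrow> 'b::cstar_algebra) \<Rightarrow> bool" where
  "cuntz_pimsner_covariant X \<psi> \<longleftrightarrow>
     (\<forall>s a. left_op (fibre X s) a \<in> compacts (fibre X s) \<longrightarrow>
        compacts_hom (fibre X s) \<psi> (left_op (fibre X s) a) = \<psi> (unit_fibre X a))"

text \<open>\<open>universal_rep \<R> \<R>' X i\<close>: the map \<open>i\<close> belongs to the class \<open>\<R>\<close> of representations of \<open>X\<close> in the
  C*-algebra \<open>'t\<close>, its range generates \<open>'t\<close>, and each member of the class \<open>\<R>'\<close> of representations in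
  \<open>'c\<close> factors through \<open>i\<close>. In the two instances below, \<open>\<R>\<close> and \<open>\<R>'\<close> are the same class at two types.
  HOL cannot quantify over all C*-algebras \<open>'c\<close> inside a formula. The universal property is used with
  \<open>'c\<close> the algebra of operators on the Hilbert space \<open>'h\<close> at which the crossed product axioms are
  to be verified; as \<open>'h\<close> is arbitrary, a map that is universal for all C*-algebras satisfies this
  hypothesis at every \<open>'h\<close>.\<close>

definition universal_rep ::
    "(('q, 'x, 'a::cstar_algebra) prod_sys \<Rightarrow> ('x \<Rightarrow> 't::cstar_algebra) \<Rightarrow> bool) \<Rightarrow>
     (('q, 'x, 'a) prod_sys \<Rightarrow> ('x \<Rightarrow> 'c::cstar_algebra) \<Rightarrow> bool) \<Rightarrow>
     ('q, 'x, 'a) prod_sys \<Rightarrow> ('x \<Rightarrow> 't) \<Rightarrow> bool" where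
  "universal_rep \<R> \<R>' X i \<longleftrightarrow> \<R> X i \<and> cstar_generated (i ` total X) = UNIV \<and>
     (\<forall>\<psi>. \<R>' X \<psi> \<longrightarrow> (\<exists>\<rho>. star_hom \<rho> \<and> (\<forall>x\<in>total X. \<rho> (i x) = \<psi> x)))"

definition universal_toeplitz_rep ::
    "'c::cstar_algebra itself \<Rightarrow> ('q, 'x, 'a::cstar_algebra) prod_sys \<Rightarrow>
     ('x \<Rightarrow> 't::cstar_algebra) \<Rightarrow> bool" where
  "universal_toeplitz_rep (_ :: 'c itself) X i \<longleftrightarrow>
     universal_rep toeplitz_rep (toeplitz_rep :: _ \<Rightarrow> ('x \<Rightarrow> 'c) \<Rightarrow> bool) X i"

definition universal_cuntz_pimsner_rep ::
    "'c::cstar_algebra itself \<Rightarrow> ('q, 'x, 'a::cstar_algebra) prod_sys \<Rightarrow>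
     ('x \<Rightarrow> 'o::cstar_algebra) \<Rightarrow> bool" where
  "universal_cuntz_pimsner_rep (_ :: 'c itself) X i \<longleftrightarrow>
     universal_rep (\<lambda>X \<psi>. toeplitz_rep X \<psi> \<and> cuntz_pimsner_covariant X \<psi>)
       (\<lambda>X (\<psi> :: 'x \<Rightarrow> 'c). toeplitz_rep X \<psi> \<and> cuntz_pimsner_covariant X \<psi>) X i"

definition canonical_projection ::
    "('q, 'x, 'a) prod_sys \<Rightarrow> ('x \<Rightarrow> 't::cstar_algebra) \<Rightarrow> ('x \<Rightarrow> 'o::cstar_algebra) \<Rightarrow>
     ('t \<Rightarrow> 'o) \<Rightarrow> bool" where
  "canonical_projection X iX kX q \<longleftrightarrow> star_hom q \<and> surj q \<and> (\<forall>x\<in>total X. q (iX x) = kX x)"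


section \<open>The product system of a twisted system\<close>

datatype 'p opp = Opp (unopp: 'p)

instantiation opp :: (monoid_mult) monoid_mult
begin

definition "one_opp = Opp (1 :: 'a)"
definition "times_opp x y = Opp (unopp y * unopp x :: 'a)"

instance
  by standard (simp_all add: one_opp_def times_opp_def mult.assoc)

end

definition twisted_fibre ::
    "('p \<Rightarrow> 'a::cstar_algebra \<Rightarrow> 'a) \<Rightarrow> 'p \<Rightarrow> ('p \<times> 'a, 'a) bimodule" where
  "twisted_fibre \<beta> s =
    \<lparr> bcarrier = {s} \<times> range (lmul (strict_ext (\<beta> s) 1)),
      badd = (\<lambda>x y. (s, snd x + snd y)),
      bzero = (s, 0),
      bscale = (\<lambda>c x. (s, c *\<^sub>C snd x)),
      ract = (\<lambda>x a. (s, snd x * a)),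
      binner = (\<lambda>x y. star (snd x) * snd y),
      lact = (\<lambda>a x. (s, \<beta> s a * snd x)) \<rparr>"

definition twisted_product_system ::
    "('p::{monoid_mult, countable} \<Rightarrow> 'a::cstar_algebra \<Rightarrow> 'a) \<Rightarrow> ('p \<Rightarrow> 'p \<Rightarrow> complex) \<Rightarrow>
     ('p opp, 'p \<times> 'a, 'a) prod_sys" where
  "twisted_product_system \<beta> \<omega> =
    \<lparr> fibre = (\<lambda>s. twisted_fibre \<beta> (unopp s)),
      proj = (\<lambda>x. Opp (fst x)),
      pmul = (\<lambda>(s, x) (t, y). (t * s, cnj (\<omega> t s) *\<^sub>C (\<beta> t x * y))),
      unit_fibre = (\<lambda>a. (1, a)) \<rparr>"

definition canonical_A :: "('p::monoid_mult \<times> 'a \<Rightarrow> 't) \<Rightarrow> 'a \<Rightarrow> 't" where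
  "canonical_A iX a = iX (1, a)"

definition canonical_P ::
    "('p \<Rightarrow> 'a \<Rightarrow> 'a) \<Rightarrow> 'i filter \<Rightarrow> ('i \<Rightarrow> 'a) \<Rightarrow> ('p \<times> 'a \<Rightarrow> 't::cstar_algebra) \<Rightarrow>
     'p \<Rightarrow> 't multiplier" where
  "canonical_P \<beta> F u iX s = strict_lim F (\<lambda>i. mult_of (star (iX (s, \<beta> s (u i)))))"


section \<open>The twisted construction yields a product system\<close>

lemma limitin_strict_iff:
  "limitin strict_topology f l F \<longleftrightarrow>
     (\<forall>a. ((\<lambda>i. lmul (f i) a) \<longlongrightarrow> lmul l a) F \<and> ((\<lambda>i. rmul a (f i)) \<longlongrightarrow> rmul a l) F)"
proof
  assume L: "limitin strict_topology f l F"
  have "eventually (\<lambda>i. dist (lmul (f i) a) (lmul l a) < e) F"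
    "eventually (\<lambda>i. dist (rmul a (f i)) (rmul a l) < e) F" if "e > 0" for a e
  proof -
    have o: "openin strict_topology {n. norm (lmul (n - l) a) < e}"
      "openin strict_topology {n. norm (rmul a (n - l)) < e}"
      unfolding strict_topology_def openin_topology_generated_by_iff
      using that by (blast intro: generate_topology_on.Basis)+
    have "l \<in> {n. norm (lmul (n - l) a) < e}" "l \<in> {n. norm (rmul a (n - l)) < e}"
      using that by (simp_all add: lmul_zero_left rmul_zero_right)
    from limitinD[OF L o(1) this(1)] limitinD[OF L o(2) this(2)]
    show "eventually (\<lambda>i. dist (lmul (f i) a) (lmul l a) < e) F"
      "eventually (\<lambda>i. dist (rmul a (f i)) (rmul a l) < e) F"
      by (simp_all add: dist_norm lmul_minus_left rmul_minus_right)
  qed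
  then show "\<forall>a. ((\<lambda>i. lmul (f i) a) \<longlongrightarrow> lmul l a) F \<and> ((\<lambda>i. rmul a (f i)) \<longlongrightarrow> rmul a l) F"
    by (simp add: tendsto_iff)
next
  assume R: "\<forall>a. ((\<lambda>i. lmul (f i) a) \<longlongrightarrow> lmul l a) F \<and> ((\<lambda>i. rmul a (f i)) \<longlongrightarrow> rmul a l) F"
  let ?B = "{{n. norm (lmul (n - m) a) < e} |m a e. e > 0} \<union>
    {{n. norm (rmul a (n - m)) < e} |(m::'a multiplier) a e. e > 0}"
  have ev: "l \<in> U \<longrightarrow> eventually (\<lambda>i. f i \<in> U) F" if "generate_topology_on ?B U" for U
    using that
  proof induction
    case (Int U V)
    then show ?case by (auto intro: eventually_conj)
  next
    case (UN K)
    show ?case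
    proof
      assume "l \<in> \<Union>K"
      then obtain k where k: "k \<in> K" "l \<in> k" by blast
      then have "eventually (\<lambda>i. f i \<in> k) F" using UN by blast
      then show "eventually (\<lambda>i. f i \<in> \<Union>K) F" by eventually_elim (use k in blast)
    qed
  next
    case (Basis U)
    then consider m a e where "U = {n. norm (lmul (n - m) a) < e}"
      | m a e where "U = {n. norm (rmul a (n - m)) < e}" by blast
    then show ?case
    proof cases
      case 1
      have "((\<lambda>i. norm (lmul (f i - m) a)) \<longlongrightarrow> norm (lmul (l - m) a)) F"
        unfolding lmul_minus_left using R by (intro tendsto_intros) auto
      then show ?thesis using order_tendstoD(2) unfolding 1 by force
    next
      case 2
      have "((\<lambda>i. norm (rmul a (f i - m))) \<longlongrightarrow> norm (rmul a (l - m))) F"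
        unfolding rmul_minus_right using R by (intro tendsto_intros) auto
      then show ?thesis using order_tendstoD(2) unfolding 2 by force
    qed
  qed simp
  have "l \<in> {n. norm (lmul (n - l) 0) < 1}" by (simp add: lmul_zero_left)
  moreover have "{n. norm (lmul (n - l) 0) < 1} \<in> ?B"
    using zero_less_one by blast
  ultimately have "l \<in> topspace strict_topology"
    unfolding strict_topology_def topology_generated_by_topspace by blast
  then show "limitin strict_topology f l F"
    unfolding limitin_def using ev
    by (auto simp: strict_topology_def openin_topology_generated_by_iff)
qed

lemma limitin_strict_unique:
  assumes "limitin strict_topology f l F" "limitin strict_topology f m F" "F \<noteq> bot"
  shows "l = m"
  using assms unfolding limitin_strict_iff by (intro multiplier_eqI) (meson tendsto_unique)

lemma mult_of_inj: "mult_of a = mult_of b \<Longrightarrow> a = b"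
  by (rule cstar_eqI_right) (metis mult_of_apply(1))

lemma mult_mult_of: "m * mult_of a = mult_of (lmul m a)"
  by (rule multiplier_eqI) (simp add: lmul_times_left mult_of_apply lmul_mult)

lemma mult_of_mult: "mult_of a * m = mult_of (rmul a m)"
  by (rule multiplier_eqI) (simp add: lmul_times_left mult_of_apply rmul_lmul)

lemma strict_extension_unique:
  fixes f :: "'a::cstar_algebra \<Rightarrow> 'a" and u :: "'i \<Rightarrow> 'a"
  assumes u: "approximate_identity F u" and g: "strict_extension f g" and h: "strict_extension f h"
  shows "g = h"
proof
  fix m
  have bot: "F \<noteq> bot" and u1: "((\<lambda>i. u i * x) \<longlongrightarrow> x) F" "((\<lambda>i. x * u i) \<longlongrightarrow> x) F" for x
    using u by (auto simp: approximate_identity_def)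
  have lim: "limitin strict_topology (\<lambda>i. mult_of (lmul m (u i))) m F"
    unfolding limitin_strict_iff mult_of_apply
  proof (intro allI conjI)
    fix a
    show "((\<lambda>i. lmul m (u i) * a) \<longlongrightarrow> lmul m a) F"
      unfolding lmul_mult[symmetric] by (rule bounded_linear.tendsto[OF bounded_linear_lmul u1(1)])
    show "((\<lambda>i. a * lmul m (u i)) \<longlongrightarrow> rmul a m) F"
      unfolding rmul_lmul[symmetric] by (rule u1(2))
  qed
  have k: "limitin strict_topology (\<lambda>i. mult_of (f (lmul m (u i)))) (k m) F"
    if "strict_extension f k" for k
  proof -
    have "limitin strict_topology (k \<circ> (\<lambda>i. mult_of (lmul m (u i)))) (k m) F"
      using that lim unfolding strict_extension_def by (blast intro: continuous_map_limit)
    moreover have "k \<circ> (\<lambda>i. mult_of (lmul m (u i))) = (\<lambda>i. mult_of (f (lmul m (u i))))"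
      using that by (auto simp: strict_extension_def)
    ultimately show ?thesis by simp
  qed
  show "g m = h m"
    by (rule limitin_strict_unique[OF k[OF g] k[OF h] bot])
qed

lemma strict_ext:
  fixes f :: "'a::cstar_algebra \<Rightarrow> 'a" and u :: "'i \<Rightarrow> 'a"
  assumes "approximate_identity F u" "extendible f"
  shows "strict_extension f (strict_ext f)"
proof -
  obtain g where g: "strict_extension f g" using assms(2) by (auto simp: extendible_def)
  then show ?thesis
    unfolding strict_ext_def by (rule theI[where P="strict_extension f"]) (rule strict_extension_unique[OF assms(1) _ g])
qed

lemma twisted_fibre_simps [simp]:
  "bcarrier (twisted_fibre \<beta> s) = {s} \<times> range (lmul (strict_ext (\<beta> s) 1))"
  "badd (twisted_fibre \<beta> s) x y = (s, snd x + snd y)"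
  "bzero (twisted_fibre \<beta> s) = (s, 0)"
  "bscale (twisted_fibre \<beta> s) c x = (s, c *\<^sub>C snd x)"
  "ract (twisted_fibre \<beta> s) x a = (s, snd x * a)"
  "binner (twisted_fibre \<beta> s) x y = star (snd x) * snd y"
  "lact (twisted_fibre \<beta> s) a x = (s, \<beta> s a * snd x)"
  "bnorm (twisted_fibre \<beta> s) x = norm (snd x)"
  "bminus (twisted_fibre \<beta> s) x y = (s, snd x - snd y)"
  by (simp_all add: twisted_fibre_def bnorm_def bminus_def norm_star_mult scaleC_minus1)

lemma twisted_product_system_simps [simp]:
  "fibre (twisted_product_system \<beta> \<omega>) q = twisted_fibre \<beta> (unopp q)"
  "proj (twisted_product_system \<beta> \<omega>) x = Opp (fst x)"
  "pmul (twisted_product_system \<beta> \<omega>) x y =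
     (fst y * fst x, cnj (\<omega> (fst y) (fst x)) *\<^sub>C (\<beta> (fst y) (snd x) * snd y))"
  "unit_fibre (twisted_product_system \<beta> \<omega>) a = (1, a)"
  by (simp_all add: twisted_product_system_def split: prod.splits)

context
  fixes \<beta> :: "'p::{monoid_mult, countable} \<Rightarrow> 'a::cstar_algebra \<Rightarrow> 'a"
    and \<omega> :: "'p \<Rightarrow> 'p \<Rightarrow> complex" and F :: "'i filter" and u :: "'i \<Rightarrow> 'a"
  assumes tw: "twisted_system \<beta> \<omega>" and u: "approximate_identity F u"
begin

private lemma beta:
  "\<beta> s (x + y) = \<beta> s x + \<beta> s y" "\<beta> s (c *\<^sub>C x) = c *\<^sub>C \<beta> s x"
  "\<beta> s (x * y) = \<beta> s x * \<beta> s y" "\<beta> s (star x) = star (\<beta> s x)"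
  "\<beta> s (\<beta> t x) = \<beta> (s * t) x" "\<beta> 1 x = x"
  using tw by (auto simp: twisted_system_def star_hom_def fun_eq_iff)

private definition "g s = strict_ext (\<beta> s)"

private lemma g: "strict_extension (\<beta> s) (g s)"
  unfolding g_def using tw by (intro strict_ext[OF u]) (simp add: twisted_system_def)

private lemma g_mult: "g s (m * n) = g s m * g s n" and g_star: "g s (star m) = star (g s m)"
  and g_mult_of: "g s (mult_of a) = mult_of (\<beta> s a)"
  using g[of s] by (auto simp: strict_extension_def star_hom_def)

private lemma g_comp: "g (s * t) m = g s (g t m)"
proof -
  have "strict_extension (\<beta> (s * t)) (g s \<circ> g t)"
    using g[of s] g[of t] unfolding strict_extension_def star_hom_def
    by (auto intro: continuous_map_compose simp: beta)
  then show ?thesis using fun_cong[OF strict_extension_unique[OF u g]] by fastforce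
qed

private lemma g_one: "g 1 m = m"
proof -
  have "strict_extension (\<beta> 1) id"
    by (auto simp: strict_extension_def star_hom_def beta)
  then show ?thesis using fun_cong[OF strict_extension_unique[OF u g]] by fastforce
qed

private definition "p s = g s 1"

private lemma p_idem: "lmul (p s) (lmul (p s) x) = lmul (p s) x"
proof -
  have "p s * p s = p s" by (simp add: p_def g_mult[symmetric])
  then show ?thesis by (metis lmul_times_left)
qed

private lemma range_p: "x \<in> range (lmul (p s)) \<longleftrightarrow> lmul (p s) x = x"
proof
  assume "lmul (p s) x = x"
  then show "x \<in> range (lmul (p s))" using rangeI[of "lmul (p s)" x] by simp
qed (auto simp: p_idem)

private lemma star_one: "star 1 = (1 :: 'a multiplier)"
  by (rule multiplier_eqI) (simp add: lmul_star rmul_one lmul_one star_star)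

private lemma p_star: "star (p s) = p s"
  by (simp add: p_def g_star[symmetric] star_one)

private lemma p_beta: "lmul (p s) (\<beta> s a) = \<beta> s a"
proof (rule mult_of_inj)
  show "mult_of (lmul (p s) (\<beta> s a)) = mult_of (\<beta> s a)"
    by (simp add: mult_mult_of[symmetric] g_mult_of[symmetric] p_def g_mult[symmetric])
qed

private lemma beta_p: "rmul (\<beta> s a) (p s) = \<beta> s a"
proof (rule mult_of_inj)
  show "mult_of (rmul (\<beta> s a) (p s)) = mult_of (\<beta> s a)"
    by (simp add: mult_of_mult[symmetric] g_mult_of[symmetric] p_def g_mult[symmetric])
qed

private lemma beta_mult_p: "\<beta> s a * lmul (p s) x = \<beta> s a * x"
  by (metis beta_p rmul_lmul)

private lemma p_beta_mult: "lmul (p s) (\<beta> s a * x) = \<beta> s a * x"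
  by (simp add: lmul_mult p_beta)

private lemma p_mult: "lmul (p (s * t)) (\<beta> s x) = \<beta> s (lmul (p t) x)"
proof (rule mult_of_inj)
  show "mult_of (lmul (p (s * t)) (\<beta> s x)) = mult_of (\<beta> s (lmul (p t) x))"
    by (simp add: mult_mult_of[symmetric] g_mult_of[symmetric] p_def g_comp g_mult[symmetric])
qed

private lemma p_one: "lmul (p 1) x = x"
  by (simp add: p_def g_one lmul_one)

private lemma p_limit: "((\<lambda>i. \<beta> s (u i) * x) \<longlongrightarrow> lmul (p s) x) F"
proof -
  have "limitin strict_topology (\<lambda>i. mult_of (u i)) 1 F"
    using u by (simp add: limitin_strict_iff mult_of_apply lmul_one rmul_one approximate_identity_def)
  then have "limitin strict_topology (g s \<circ> (\<lambda>i. mult_of (u i))) (g s 1) F"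
    using g[of s] unfolding strict_extension_def by (blast intro: continuous_map_limit)
  then show ?thesis by (auto simp: limitin_strict_iff g_mult_of mult_of_apply p_def)
qed

private lemma omega:
  "norm (\<omega> s t) = 1" "\<omega> r s * \<omega> (r * s) t = \<omega> r (s * t) * \<omega> s t" "\<omega> s 1 = 1" "\<omega> 1 s = 1"
  "cnj (\<omega> s t) * \<omega> s t = 1" "\<omega> s t * cnj (\<omega> s t) = 1"
proof -
  have n: "norm (\<omega> s t) = 1" for s t using tw by (simp add: twisted_system_def)
  then have nz: "\<omega> s t \<noteq> 0" for s t by (metis norm_zero zero_neq_one)
  have c: "\<omega> r s * \<omega> (r * s) t = \<omega> r (s * t) * \<omega> s t" and e: "\<omega> 1 1 = 1" for r s t
    using tw by (auto simp: twisted_system_def)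
  show "norm (\<omega> s t) = 1" by (rule n)
  show "\<omega> r s * \<omega> (r * s) t = \<omega> r (s * t) * \<omega> s t" by (rule c)
  show "\<omega> s 1 = 1" using c[of s 1 1] nz[of s 1] e by simp
  show "\<omega> 1 s = 1" using c[of 1 1 s] nz[of 1 s] e by simp
  show "\<omega> s t * cnj (\<omega> s t) = 1" using n[of s t] complex_norm_square[of "\<omega> s t"] by simp
  then show "cnj (\<omega> s t) * \<omega> s t = 1" by (simp add: mult.commute)
qed

private lemma mem: "x \<in> bcarrier (twisted_fibre \<beta> s) \<longleftrightarrow> fst x = s \<and> lmul (p s) (snd x) = snd x"
  unfolding twisted_fibre_simps mem_Times_iff range_p[unfolded p_def g_def] p_def g_def by simp

private lemma fibre_bimodule: "hilbert_bimodule (twisted_fibre \<beta> s)"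
proof -
  have complete: "\<exists>y. lmul (p s) y = y \<and> (\<lambda>n. norm (snd (x n) - y)) \<longlonglongrightarrow> 0"
    if x: "(\<forall>n. fst (x n) = s \<and> lmul (p s) (snd (x n)) = snd (x n)) \<and>
      (\<forall>e>0. \<exists>N. \<forall>m\<ge>N. \<forall>n\<ge>N. norm (snd (x m) - snd (x n)) < e)" for x :: "nat \<Rightarrow> 'p \<times> 'a"
  proof -
    have "Cauchy (\<lambda>n. snd (x n))" using x by (simp add: Cauchy_def dist_norm)
    then obtain y where y: "(\<lambda>n. snd (x n)) \<longlonglongrightarrow> y"
      by (meson Cauchy_convergent convergent_def)
    then have "(\<lambda>n. lmul (p s) (snd (x n))) \<longlonglongrightarrow> lmul (p s) y"
      by (rule bounded_linear.tendsto[OF bounded_linear_lmul])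
    then have "(\<lambda>n. snd (x n)) \<longlonglongrightarrow> lmul (p s) y" using x by simp
    then have "lmul (p s) y = y" using y by (rule LIMSEQ_unique)
    moreover have "(\<lambda>n. norm (snd (x n) - y)) \<longlonglongrightarrow> 0"
      using y by (simp add: LIM_zero tendsto_norm_zero)
    ultimately show ?thesis by blast
  qed
  have carr: "bcarrier (twisted_fibre \<beta> s) = {x. fst x = s \<and> lmul (p s) (snd x) = snd x}"
    using mem by blast
  have zero: "lmul (p s) 0 = 0" by (rule linear_simps(3)[OF bounded_linear_lmul])
  have pos: "\<exists>b. star x * x = star b * b" "star x * x = 0 \<longleftrightarrow> x = 0" for x :: 'a
    by (blast, metis mult_zero_right star_mult_eq_0)
  show ?thesis
    unfolding hilbert_bimodule_def Let_def carr
    by (simp del: twisted_fibre_simps(1) add: p_beta p_beta_mult lmul_add lmul_scaleC lmul_mult zero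
        beta distrib_left distrib_right mult.assoc add.assoc scaleC_add_right scaleC_add_left
        scaleC_scaleC scaleC_mult_left scaleC_mult_right star_mult star_star pos)
      (use complete in blast)
qed

private lemma fibre_tensor:
  "tensor_iso (twisted_fibre \<beta> s) (twisted_fibre \<beta> t) (twisted_fibre \<beta> (t * s))
     (pmul (twisted_product_system \<beta> \<omega>))"
proof -
  have carr: "bcarrier (twisted_fibre \<beta> s) = {x. fst x = s \<and> lmul (p s) (snd x) = snd x}" for s
    using mem by blast
  have closed: "lmul (p (t * s)) (\<beta> t x * y) = \<beta> t x * y" if "lmul (p s) x = x" for x y
    by (simp add: lmul_mult p_mult that)
  have dense: "\<exists>w\<in>bspan (twisted_fibre \<beta> (t * s)) {pmul (twisted_product_system \<beta> \<omega>) x y |x y.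
        (fst x = s \<and> lmul (p s) (snd x) = snd x) \<and> fst y = t \<and> lmul (p t) (snd y) = snd y}.
      norm (snd z - snd w) < e"
    if z: "fst z = t * s" "lmul (p (t * s)) (snd z) = snd z" and e: "e > 0" for z and e :: real
  proof -
    let ?M = "{pmul (twisted_product_system \<beta> \<omega>) x y |x y.
        (fst x = s \<and> lmul (p s) (snd x) = snd x) \<and> fst y = t \<and> lmul (p t) (snd y) = snd y}"
    have "F \<noteq> bot" using u by (simp add: approximate_identity_def)
    moreover have "eventually (\<lambda>i. dist (\<beta> (t * s) (u i) * snd z) (snd z) < e) F"
      using p_limit[of "t * s" "snd z"] z(2) e by (simp add: tendsto_iff)
    ultimately obtain i where i: "dist (\<beta> (t * s) (u i) * snd z) (snd z) < e"
      using eventually_happens by blast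
    define x where "x = (s, \<beta> s (u i))"
    define y where "y = (t, \<omega> t s *\<^sub>C lmul (p t) (snd z))"
    define v where "v = pmul (twisted_product_system \<beta> \<omega>) x y"
    have v: "v = (t * s, \<beta> (t * s) (u i) * snd z)"
      by (simp add: v_def x_def y_def scaleC_mult_right scaleC_scaleC omega beta)
        (metis beta(5) beta_mult_p)
    have "v \<in> ?M"
      unfolding v_def by (rule CollectI, intro exI[of _ x] exI[of _ y])
        (simp add: x_def y_def p_beta p_idem lmul_scaleC)
    then have "badd (twisted_fibre \<beta> (t * s)) (bzero (twisted_fibre \<beta> (t * s)))
        (bscale (twisted_fibre \<beta> (t * s)) 1 v) \<in> bspan (twisted_fibre \<beta> (t * s)) ?M"
      by (intro bspan.intros)
    then have "v \<in> bspan (twisted_fibre \<beta> (t * s)) ?M" by (simp add: v)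
    then show ?thesis using i by (intro bexI[of _ v]) (auto simp: v dist_norm norm_minus_commute)
  qed
  show ?thesis
    unfolding tensor_iso_def carr
    using dense
    by (simp del: twisted_fibre_simps(1) twisted_product_system_simps(3))
      (auto simp: closed lmul_scaleC beta scaleC_add_right scaleC_mult_left scaleC_mult_right
        scaleC_scaleC star_scaleC star_mult omega algebra_simps)
qed

lemma product_system_twisted: "product_system (twisted_product_system \<beta> \<omega>)"
proof -
  let ?X = "twisted_product_system \<beta> \<omega>"
  have tot: "total ?X = {x. lmul (p (fst x)) (snd x) = snd x}"
  proof -
    have "x \<in> total ?X \<longleftrightarrow> lmul (p (fst x)) (snd x) = snd x" for x
    proof -
      have "x \<in> total ?X \<longleftrightarrow> (\<exists>q. x \<in> bcarrier (twisted_fibre \<beta> (unopp q)))"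
        by (simp add: total_def del: twisted_fibre_simps(1))
      also have "\<dots> \<longleftrightarrow> lmul (p (fst x)) (snd x) = snd x"
        unfolding mem by (metis opp.sel)
      finally show ?thesis .
    qed
    then show ?thesis by blast
  qed
  have assoc: "pmul ?X (pmul ?X x y) z = pmul ?X x (pmul ?X y z)" for x y z
  proof -
    obtain s a t b r c where xyz: "x = (s, a)" "y = (t, b)" "z = (r, c)"
      by (meson surj_pair)
    have "cnj (\<omega> r (t * s)) * cnj (\<omega> t s) = cnj (\<omega> (r * t) s) * cnj (\<omega> r t)"
      using omega(2)[of r t s] by (metis complex_cnj_mult mult.commute)
    then show ?thesis
      by (simp add: xyz beta scaleC_mult_left scaleC_mult_right scaleC_scaleC mult.assoc)
  qed
  have closed: "lmul (p (t * s)) (\<beta> t x * y) = \<beta> t x * y" if "lmul (p s) x = x" for s t x y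
    by (simp add: lmul_mult p_mult that)
  have bij: "bij_betw (unit_fibre ?X) UNIV (bcarrier (fibre ?X 1))"
    unfolding bij_betw_def
    by (auto simp: inj_on_def image_def one_opp_def mem p_one simp del: twisted_fibre_simps(1))
  show ?thesis
    unfolding product_system_def tot
    using fibre_bimodule fibre_tensor bij
    by (auto simp: mem assoc closed lmul_scaleC times_opp_def one_opp_def beta omega
        simp del: twisted_fibre_simps(1) twisted_product_system_simps(3))
      (auto simp: mem assoc closed lmul_scaleC times_opp_def one_opp_def beta omega
        simp del: twisted_fibre_simps(1))
qed

end

end

theory Submission
  imports Defs
begin

text \<open>
  For a generating Toeplitz representation \<open>\<psi>\<close> of the product system, the strict limit \<open>j\<^sub>P(s)\<close> satisfies
  \<open>\<psi>(s, x) = j\<^sub>P(s)\<^sup>* j\<^sub>A(x)\<close>, and all relations of a Toeplitz covariant pair can be checked on the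
  elements \<open>j\<^sub>A(a)\<close>, whose products with the algebra are dense. Conversely a Toeplitz covariant pair \<open>(\<pi>, V)\<close>
  gives the Toeplitz representation \<open>(s, x) \<mapsto> V\<^sub>s\<^sup>* \<pi>(x)\<close>, because \<open>V\<^sub>s V\<^sub>s\<^sup>*\<close> is the image of
  the projection \<open>\<beta>\<^sub>s(1)\<close>. The left action of \<open>a\<close> on the fibre \<open>X\<^sub>s\<close> is the compact operator of left
  multiplication by \<open>\<beta>\<^sub>s(a)\<close>, which \<open>\<psi>\<^bsup>(s)\<^esup>\<close> sends to
  \<open>j\<^sub>P(s)\<^sup>* j\<^sub>A(\<beta>\<^sub>s(a)) j\<^sub>P(s) = j\<^sub>A(a) j\<^sub>P(s)\<^sup>* j\<^sub>P(s)\<close>; hence Cuntz-Pimsner covariance says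
  exactly that each \<open>j\<^sub>P(s)\<close> is an isometry.
\<close>

section \<open>Homomorphisms of C*-algebras are contractive\<close>

text \<open>\<open>strict_lim\<close>, \<open>mult_ext\<close> and \<open>compacts_hom\<close> are
  definite descriptions, so each has to be pinned down by an existence and a uniqueness argument
  before it can be computed with. The limits \<open>j\<^sub>P(s)\<close> and the extension of a
  representation to multipliers come from one principle: a uniformly bounded net of operators that
  converges on a total set converges everywhere. The bounds rest on contractivity of star
  homomorphisms, obtained here from a fixed point argument in place of spectral theory. For
  \<open>compacts_hom\<close>, uniqueness needs contractivity even for maps that are multiplicative
  only on a corner of the algebra. The algebras have no unit; since \<open>j\<^sub>A\<close> is
  nondegenerate, the image of the given approximate identity serves in the target algebra as well.
  The relations are derived once, for an arbitrary Toeplitz representation whose range generates,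
  and used for both the Toeplitz and the Cuntz-Pimsner algebra.\<close>

lemma star_homD:
  assumes "star_hom f"
  shows "f (x + y) = f x + f y" "f (c *\<^sub>C x) = c *\<^sub>C f x" "f (x * y) = f x * f y"
    "f (star x) = star (f x)"
  using assms by (auto simp: star_hom_def)

lemma star_hom_diff: "star_hom f \<Longrightarrow> f (x - y) = f x - f y"
  by (metis add_diff_cancel_right' diff_add_cancel star_homD(1))

lemma star_hom_zero: "star_hom f \<Longrightarrow> f 0 = 0"
  by (metis scaleC_zero_left star_homD(2))

lemma star_hom_scaleR: "star_hom f \<Longrightarrow> f (r *\<^sub>R x) = r *\<^sub>R f x"
  by (metis scaleC_of_real star_homD(2))

lemma star_hom_comp: "star_hom f \<Longrightarrow> star_hom g \<Longrightarrow> star_hom (f \<circ> g)"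
  by (simp add: star_hom_def)

lemma mult_of_times: "mult_of (a * b) = mult_of a * mult_of b"
  by (rule multiplier_eqI) (simp add: mult_of_apply lmul_simps mult.assoc)

lemma mult_of_star: "mult_of (star a) = star (mult_of a)"
  by (rule multiplier_eqI) (simp add: mult_of_apply lmul_star star_mult star_star)

lemma star_one: "star 1 = (1 :: 'a::{cstar_algebra, monoid_mult})"
  by (metis mult.right_neutral star_mult star_star)

lemma norm_one_le: "norm (1 :: 'a::{cstar_algebra, monoid_mult}) \<le> 1"
proof -
  have "norm (1::'a) = (norm (1::'a))\<^sup>2"
    using norm_star_mult[of "1::'a"] by (simp add: star_one)
  then show ?thesis
    by (metis mult_cancel_left2 norm_ge_zero order.refl power2_eq_square zero_le_one)
qed

lemma norm_mult_of: "norm (mult_of a) = norm (a::'a::cstar_algebra)"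
proof (rule order_antisym)
  show "norm (mult_of a) \<le> norm a"
    by (rule norm_multiplier_bound) (auto simp: mult_of_apply norm_mult_ineq)
  show "norm a \<le> norm (mult_of a)"
  proof (cases "a = 0")
    case False
    have "norm a * norm a = norm (lmul (mult_of a) (star a))"
      by (metis mult_of_apply(1) norm_star norm_star_mult power2_eq_square star_star)
    also have "\<dots> \<le> norm (mult_of a) * norm a"
      using norm_lmul[of "mult_of a" "star a"] by (simp add: norm_star)
    finally show ?thesis using False by simp
  qed simp
qed

text \<open>In the unitization, \<open>1 - w\<close> is a square root of \<open>1 - x\<^sup>2\<close>.\<close>

lemma square_root_complement:
  fixes x :: "'a::cstar_algebra"
  assumes S: "cstar_subalgebra S" and xS: "x \<in> S" and sa: "star x = x" and x1: "norm x < 1"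
  obtains w where "w \<in> S" "star w = w" "x * w = w * x" "w + w - w * w = x * x"
proof -
  \<comment> \<open>The radius \<open>r\<close> is the smaller root of
    \<open>t = ((norm x)\<^sup>2 + t\<^sup>2) / 2\<close>, so \<open>h\<close> maps elements of norm
    at most \<open>r\<close> to such elements; \<open>r < 1\<close> is also the contraction
    constant.\<close>
  define s where "s = sqrt (1 - (norm x)\<^sup>2)"
  define r where "r = 1 - s"
  have n1: "(norm x)\<^sup>2 < 1" using x1 by (simp add: power_less_one_iff)
  then have "s\<^sup>2 = 1 - (norm x)\<^sup>2" by (simp add: s_def)
  then have sq: "(norm x)\<^sup>2 = 1 - s * s" by (simp add: power2_eq_square)
  have r: "0 \<le> r" "r < 1"
    using n1 by (simp_all add: r_def s_def)
  have rr: "((norm x)\<^sup>2 + r * r) / 2 = r"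
    unfolding sq by (simp add: r_def field_simps)
  \<comment> \<open>A fixed point of \<open>h\<close> is exactly a solution of
    \<open>w + w - w * w = x * x\<close>. Self-adjointness and commutation with \<open>x\<close> are
    built into the complete set, so that the fixed point inherits them.\<close>
  define N where "N = {w \<in> S. star w = w \<and> x * w = w * x \<and> norm w \<le> r}"
  define h where "h w = (1/2) *\<^sub>R (x * x + w * w)" for w
  have Sp: "closed S" "0 \<in> S" "\<And>a b. a \<in> S \<Longrightarrow> b \<in> S \<Longrightarrow> a + b \<in> S \<and> a * b \<in> S"
    "\<And>c a. a \<in> S \<Longrightarrow> c *\<^sub>C a \<in> S"
    using S by (auto simp: cstar_subalgebra_def)
  have SR: "a \<in> S \<Longrightarrow> t *\<^sub>R a \<in> S" for t a by (metis Sp(4) scaleC_of_real)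
  have "closed N"
  proof -
    have "N = S \<inter> {w. star w = w} \<inter> {w. x * w = w * x} \<inter> {w. norm w \<le> r}" by (auto simp: N_def)
    moreover have "closed {w::'a. star w = w}"
      by (intro closed_Collect_eq continuous_intros linear_continuous_on bounded_linear_star)
    moreover have "closed {w. x * w = w * x}"
      by (intro closed_Collect_eq continuous_intros)
    moreover have "closed {w::'a. norm w \<le> r}"
      by (intro closed_Collect_le continuous_intros)
    ultimately show ?thesis using Sp(1) by auto
  qed
  then have "complete N" by (simp add: complete_eq_closed)
  moreover have "N \<noteq> {}" using Sp(2) r by (auto simp: N_def intro!: exI[of _ 0])
  moreover have "h ` N \<subseteq> N"
  proof clarify
    fix w assume w: "w \<in> N"
    have "norm (h w) \<le> (norm (x * x) + norm (w * w)) / 2"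
      using norm_triangle_ineq[of "x*x" "w*w"] by (simp add: h_def)
    also have "\<dots> \<le> ((norm x)\<^sup>2 + r * r) / 2"
    proof -
      have "norm (x * x) \<le> (norm x)\<^sup>2" by (simp add: norm_mult_ineq power2_eq_square)
      moreover have "norm (w * w) \<le> r * r"
        by (rule order_trans[OF norm_mult_ineq]) (use w r in \<open>simp add: N_def mult_mono\<close>)
      ultimately show ?thesis by simp
    qed
    finally have "norm (h w) \<le> r" using rr by simp
    moreover have "x * (w * w) = w * w * x" using w unfolding N_def by (simp add: mult.assoc) (metis mult.assoc)
    ultimately show "h w \<in> N"
      using w xS sa unfolding N_def h_def
      by (auto simp: Sp SR star_scaleR star_add star_mult algebra_simps)
  qed
  moreover have "\<forall>v\<in>N. \<forall>w\<in>N. dist (h v) (h w) \<le> r * dist v w"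
  proof (intro ballI)
    fix v w assume vw: "v \<in> N" "w \<in> N"
    have "h v - h w = (1/2) *\<^sub>R (v * (v - w) + (v - w) * w)"
      by (simp add: h_def algebra_simps)
    then have "norm (h v - h w) \<le> (norm (v * (v - w)) + norm ((v - w) * w)) / 2"
      using norm_triangle_ineq[of "v * (v - w)" "(v - w) * w"] by simp
    also have "\<dots> \<le> (r * norm (v - w) + norm (v - w) * r) / 2"
    proof -
      have "norm (v * (v - w)) \<le> r * norm (v - w)"
        by (rule order_trans[OF norm_mult_ineq]) (use vw in \<open>simp add: N_def mult_right_mono\<close>)
      moreover have "norm ((v - w) * w) \<le> norm (v - w) * r"
        by (rule order_trans[OF norm_mult_ineq]) (use vw in \<open>simp add: N_def mult_left_mono\<close>)
      ultimately show ?thesis by (intro divide_right_mono add_mono) auto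
    qed
    finally show "dist (h v) (h w) \<le> r * dist v w" by (simp add: dist_norm)
  qed
  ultimately have "\<exists>!w\<in>N. h w = w" using r by (intro Banach_fix) auto
  then obtain w where w: "w \<in> N" "h w = w" by blast
  have "w + w = 2 *\<^sub>R h w" by (simp add: w(2) scaleR_2)
  then have "w + w - w * w = x * x" by (simp add: h_def)
  with w that show thesis by (auto simp: N_def)
qed

text \<open>A self-adjoint \<open>y\<close> of norm below 1 is sent to the real part of a multiplier
  \<open>z\<close> with \<open>star z * z = 1\<close>, hence to norm at most 1; scaling and the
  C*-identity for \<open>star x * x\<close> do the rest. Compatibility is assumed on
  \<open>S\<close> only, because the maps on a corner met below are not homomorphisms of the whole
  algebra.\<close>

lemma star_hom_on_contractive:
  fixes f :: "'a::cstar_algebra \<Rightarrow> 'b::cstar_algebra"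
  assumes S: "cstar_subalgebra S"
    and add: "\<And>x y. x \<in> S \<Longrightarrow> y \<in> S \<Longrightarrow> f (x + y) = f x + f y"
    and scale: "\<And>c x. x \<in> S \<Longrightarrow> f (c *\<^sub>C x) = c *\<^sub>C f x"
    and mult: "\<And>x y. x \<in> S \<Longrightarrow> y \<in> S \<Longrightarrow> f (x * y) = f x * f y"
    and star: "\<And>x. x \<in> S \<Longrightarrow> f (star x) = star (f x)"
    and x: "x \<in> S"
  shows "norm (f x) \<le> norm x"
proof -
  have Sp: "\<And>a b. a \<in> S \<Longrightarrow> b \<in> S \<Longrightarrow> a + b \<in> S \<and> a * b \<in> S"
    "\<And>c a. a \<in> S \<Longrightarrow> c *\<^sub>C a \<in> S" "\<And>a. a \<in> S \<Longrightarrow> star a \<in> S"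
    using S by (auto simp: cstar_subalgebra_def)
  have unit_ball: "norm (f y) \<le> 1" if y: "y \<in> S" "star y = y" "norm y < 1" for y
  proof -
    obtain w where w: "w \<in> S" "star w = w" "y * w = w * y" "w + w - w * w = y * y"
      using square_root_complement[OF S y] by blast
    have fw: "f w + f w - f w * f w = f y * f y"
      by (metis w(1,4) y(1) add mult Sp(1) add_diff_cancel_right' diff_add_cancel)
    have comm: "f y * f w = f w * f y" by (metis mult w(1,3) y(1))
    have sa: "star (f y) = f y" "star (f w) = f w" by (metis star w(1,2) y(1,2))+
    \<comment> \<open>\<open>z\<close> is unitary, since \<open>(1 - f w)\<^sup>2 = 1 - (f y)\<^sup>2\<close>, and \<open>f y\<close> is its real part.\<close>
    define z where "z = mult_of (f y) + \<i> *\<^sub>C (1 - mult_of (f w))"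
    have sz: "star z = mult_of (f y) - \<i> *\<^sub>C (1 - mult_of (f w))"
      by (simp add: z_def star_add star_scaleC star_diff star_one mult_of_star[symmetric] sa
          scaleC_minus1[symmetric] scaleC_scaleC)
    have "star z * z = 1"
    proof (rule multiplier_eqI)
      fix b
      have "lmul (star z * z) b = f y * f y * b + (b - f w * b - (f w * b - f w * (f w * b)))
          + \<i> *\<^sub>C (f y * b - f y * (f w * b)) - \<i> *\<^sub>C (f y * b - f w * (f y * b))"
        unfolding sz
        unfolding z_def
        by (simp add: lmul_simps lmul_one mult_of_apply lmul_add lmul_diff lmul_scaleC scaleC_scaleC
            scaleC_add_right scaleC_diff_right scaleC_minus1 algebra_simps)
      also have "f w * (f y * b) = f y * (f w * b)" by (metis comm mult.assoc)
      also have "f y * f y * b = f w * b + f w * b - f w * (f w * b)"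
        by (simp add: fw[symmetric] algebra_simps)
      finally show "lmul (star z * z) b = lmul 1 b" by (simp add: lmul_one)
    qed
    then have "(norm z)\<^sup>2 \<le> 1" by (metis norm_one_le norm_star_mult)
    then have z1: "norm z \<le> 1" by (simp add: abs_square_le_1)
    have "2 *\<^sub>R mult_of (f y) = z + star z" by (simp add: z_def[symmetric] sz scaleR_2) (simp add: z_def)
    then have "2 * norm (f y) = norm (z + star z)" by (metis norm_mult_of norm_scaleR abs_numeral)
    also have "\<dots> \<le> 2" using norm_triangle_ineq[of z "star z"] z1 by (simp add: norm_star)
    finally show ?thesis by simp
  qed
  have sa_le: "norm (f y) \<le> norm y" if y: "y \<in> S" "star y = y" for y
  proof (rule field_le_epsilon)
    fix e :: real assume e: "e > 0"
    \<comment> \<open>Dividing by a number strictly above \<open>norm y\<close> lands in the open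
      unit ball that the root construction requires, also for \<open>y = 0\<close>.\<close>
    define t where "t = norm y + e"
    have t: "t > 0" "norm y < t" using e by (auto simp: t_def intro: add_nonneg_pos)
    define y' where "y' = complex_of_real (1 / t) *\<^sub>C y"
    have "norm (f y') \<le> 1"
      by (rule unit_ball) (use t y in \<open>auto simp: y'_def Sp star_scaleC norm_scaleC norm_divide\<close>)
    then have "norm (f y) \<le> t"
      using t y by (simp add: y'_def scale norm_scaleC norm_divide field_simps)
    then show "norm (f y) \<le> norm y + e" by (simp add: t_def)
  qed
  have "(norm (f x))\<^sup>2 = norm (f (star x * x))" using x by (simp add: mult star Sp norm_star_mult)
  also have "\<dots> \<le> norm (star x * x)" using x by (intro sa_le) (auto simp: Sp star_mult star_star)
  finally show ?thesis by (simp add: norm_star_mult)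
qed

lemma star_hom_contractive: "star_hom f \<Longrightarrow> norm (f x) \<le> norm x"
  by (rule star_hom_on_contractive[where S=UNIV])
    (auto simp: star_homD cstar_subalgebra_def)

lemma star_hom_bounded_linear: "star_hom f \<Longrightarrow> bounded_linear f"
  by (rule bounded_linear_intro[where K=1]) (auto simp: star_homD star_hom_scaleR star_hom_contractive)

text \<open>The uniform bound carries convergence from the span to its closure. The limit at
  \<open>x\<close> is built from a sequence of approximants, so completeness is used for sequences
  only although \<open>F\<close> is an arbitrary filter.\<close>

lemma bounded_limit_operator:
  fixes T :: "'i \<Rightarrow> 'a::real_normed_vector \<Rightarrow> 'b::banach"
  assumes F: "F \<noteq> bot" and lin: "\<And>i. bounded_linear (T i)"
    and bound: "\<And>i x. norm (T i x) \<le> K * norm x"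
    and S: "\<And>x. x \<in> S \<Longrightarrow> \<exists>l. ((\<lambda>i. T i x) \<longlongrightarrow> l) F" and dense: "closure (span S) = UNIV"
  shows "\<exists>L. bounded_linear L \<and> (\<forall>x. ((\<lambda>i. T i x) \<longlongrightarrow> L x) F)"
proof -
  have span: "\<exists>l. ((\<lambda>i. T i x) \<longlongrightarrow> l) F" if "x \<in> span S" for x
    using that
  proof (induction rule: span_induct_alt)
    case base
    then show ?case by (auto simp: linear_simps(3)[OF lin] intro: exI[of _ 0])
  next
    case (step c x y)
    then obtain l l' where "((\<lambda>i. T i x) \<longlongrightarrow> l) F" "((\<lambda>i. T i y) \<longlongrightarrow> l') F" using S by blast
    then have "((\<lambda>i. T i (c *\<^sub>R x + y)) \<longlongrightarrow> c *\<^sub>R l + l') F"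
      unfolding linear_simps(1)[OF lin] linear_simps(5)[OF lin] by (intro tendsto_intros)
    then show ?case by blast
  qed
  have K: "K \<ge> 0 \<or> (\<forall>x::'a. x = 0)"
  proof (rule disjCI)
    assume "\<not> (\<forall>x::'a. x = 0)"
    then obtain x :: 'a where "x \<noteq> 0" by blast
    moreover have "0 \<le> K * norm x" using bound[of undefined x] norm_ge_zero order_trans by blast
    ultimately show "K \<ge> 0" by (simp add: zero_le_mult_iff)
  qed
  have lim: "\<exists>l. ((\<lambda>i. T i x) \<longlongrightarrow> l) F" for x
  proof -
    have "x \<in> closure (span S)" using dense by simp
    then obtain X where X: "\<And>n. X n \<in> span S" "X \<longlonglongrightarrow> x" by (auto simp: closure_sequential)
    have "\<forall>n. \<exists>l. ((\<lambda>i. T i (X n)) \<longlongrightarrow> l) F" using span[OF X(1)] by blast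
    from choice[OF this] obtain L where L: "\<And>n. ((\<lambda>i. T i (X n)) \<longlongrightarrow> L n) F" by blast
    have LL: "norm (L n - L m) \<le> K * norm (X n - X m)" for n m
    proof (rule tendsto_upperbound[OF _ _ F])
      show "((\<lambda>i. norm (T i (X n) - T i (X m))) \<longlongrightarrow> norm (L n - L m)) F" by (intro tendsto_intros L)
      show "\<forall>\<^sub>F i in F. norm (T i (X n) - T i (X m)) \<le> K * norm (X n - X m)"
        by (simp add: linear_simps(2)[OF lin, symmetric] bound)
    qed
    have "Cauchy L"
    proof (rule CauchyI)
      fix e :: real assume e: "e > 0"
      define d where "d = e / (\<bar>K\<bar> + 1)"
      have d: "d > 0" "\<bar>K\<bar> * d < e" using e by (auto simp: d_def field_simps)
      obtain M where M: "\<And>m n. m \<ge> M \<Longrightarrow> n \<ge> M \<Longrightarrow> norm (X m - X n) < d"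
        using CauchyD[OF LIMSEQ_imp_Cauchy[OF X(2)] d(1)] by blast
      have "norm (L m - L n) < e" if "m \<ge> M" "n \<ge> M" for m n
      proof -
        have "norm (L m - L n) \<le> K * norm (X m - X n)" by (rule LL)
        also have "\<dots> \<le> \<bar>K\<bar> * d"
          using M[OF that] by (intro mult_mono) auto
        finally show ?thesis using d by simp
      qed
      then show "\<exists>M. \<forall>m\<ge>M. \<forall>n\<ge>M. norm (L m - L n) < e" by blast
    qed
    then obtain l where l: "L \<longlonglongrightarrow> l" using Cauchy_convergent_iff convergent_def by blast
    have "((\<lambda>i. T i x) \<longlongrightarrow> l) F"
    proof (rule tendstoI)
      fix e :: real assume e: "e > 0"
      \<comment> \<open>The error splits into \<open>\<bar>K\<bar> * d\<close> for replacing
        \<open>x\<close> by \<open>X n\<close> under \<open>T i\<close>, \<open>d\<close> for the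
        net at \<open>X n\<close>, and \<open>d\<close> for the distance from \<open>L n\<close> to
        \<open>l\<close>.\<close>
      define d where "d = e / (\<bar>K\<bar> + 2)"
      have "\<bar>K\<bar> + 2 > 0" by linarith
      then have "d > 0" "(\<bar>K\<bar> + 2) * d = e" using e by (simp_all add: d_def)
      then have d: "d > 0" "\<bar>K\<bar> * d + d + d = e" by (simp_all add: algebra_simps)
      have "\<forall>\<^sub>F n in sequentially. dist (X n) x < d \<and> dist (L n) l < d"
        using tendstoD[OF X(2) d(1)] tendstoD[OF l d(1)] by (rule eventually_conj)
      from eventually_happens'[OF sequentially_bot this]
      obtain n where n: "dist (X n) x < d" "dist (L n) l < d" by blast
      have "\<forall>\<^sub>F i in F. dist (T i (X n)) (L n) < d" using L[of n] d(1) by (simp add: tendsto_iff)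
      then show "\<forall>\<^sub>F i in F. dist (T i x) l < e"
      proof eventually_elim
        case (elim i)
        have "dist (T i x) (T i (X n)) \<le> K * norm (x - X n)"
          by (simp add: dist_norm linear_simps(2)[OF lin, symmetric] bound)
        also have "\<dots> \<le> \<bar>K\<bar> * d"
          using n(1) by (intro mult_mono) (auto simp: dist_norm norm_minus_commute)
        finally have "dist (T i x) (T i (X n)) \<le> \<bar>K\<bar> * d" .
        then show ?case
          using elim n(2) d(2) dist_triangle[of "T i x" l "T i (X n)"]
            dist_triangle[of "T i (X n)" l "L n"] by linarith
      qed
    qed
    then show ?thesis by blast
  qed
  then have "\<forall>x. \<exists>l. ((\<lambda>i. T i x) \<longlongrightarrow> l) F" by blast
  from choice[OF this] obtain L where L: "\<And>x. ((\<lambda>i. T i x) \<longlongrightarrow> L x) F" by blast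
  have "bounded_linear L"
  proof (rule bounded_linear_intro[where K=K])
    show "L (x + y) = L x + L y" for x y
    proof (rule tendsto_unique[OF F L])
      show "((\<lambda>i. T i (x + y)) \<longlongrightarrow> L x + L y) F"
        unfolding linear_simps(1)[OF lin] by (intro tendsto_intros L)
    qed
    show "L (r *\<^sub>R x) = r *\<^sub>R L x" for r x
    proof (rule tendsto_unique[OF F L])
      show "((\<lambda>i. T i (r *\<^sub>R x)) \<longlongrightarrow> r *\<^sub>R L x) F"
        unfolding linear_simps(5)[OF lin] by (intro tendsto_intros L)
    qed
    show "norm (L x) \<le> norm x * K" for x
      by (rule tendsto_upperbound[OF tendsto_norm[OF L] _ F]) (simp add: bound mult.commute)
  qed
  with L show ?thesis by blast
qed

section \<open>Extension of homomorphisms to multiplier algebras\<close>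

lemma dense_eqI:
  fixes f g :: "'a::real_normed_vector \<Rightarrow> 'b::real_normed_vector"
  assumes "bounded_linear f" "bounded_linear g" "closure (span S) = UNIV"
    and "\<And>x. x \<in> S \<Longrightarrow> f x = g x"
  shows "f x = g x"
proof -
  interpret f: bounded_linear f by fact
  interpret g: bounded_linear g by fact
  have "f y = g y" if "y \<in> span S" for y
    using that by (induction rule: span_induct_alt) (auto simp: f.zero g.zero f.add g.add f.scaleR g.scaleR assms(4))
  moreover have "closed {x. f x = g x}"
    by (intro closed_Collect_eq linear_continuous_on assms(1,2))
  ultimately have "closure (span S) \<subseteq> {x. f x = g x}" by (intro closure_minimal) auto
  then show ?thesis using assms(3) by auto
qed

lemma bounded_linear_bop_apply: "bounded_linear (\<lambda>T. T \<cdot> x)"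
  by (rule bounded_linear_intro[where K="norm x"]) (simp_all add: bop_apply_simps bop_norm_apply)

lemma tendsto_bop_apply: "(f \<longlongrightarrow> T) F \<Longrightarrow> ((\<lambda>i. f i \<cdot> x) \<longlongrightarrow> T \<cdot> x) F"
  by (rule bounded_linear.tendsto[OF bounded_linear_bop_apply])

lemma nondegenerate_rep_eqI:
  assumes "nondegenerate_rep \<pi>" "\<And>a. S * \<pi> a = T * \<pi> a"
  shows "S = T"
proof (rule bop_eqI)
  show "S \<cdot> x = T \<cdot> x" for x
    by (rule dense_eqI[OF bop_bounded_linear bop_bounded_linear])
      (use assms in \<open>auto simp: nondegenerate_rep_def bop_times_apply[symmetric]\<close>)
qed

lemma nondegenerate_hom_eqI_left:
  assumes "nondegenerate_hom j" "\<And>a. lmul m (j a) = lmul n (j a)"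
  shows "m = n"
proof (rule multiplier_eqI)
  show "lmul m x = lmul n x" for x
    by (rule dense_eqI[OF bounded_linear_lmul bounded_linear_lmul])
      (use assms in \<open>auto simp: nondegenerate_hom_def lmul_mult\<close>)
qed

lemma nondegenerate_hom_eqI_right:
  assumes j: "nondegenerate_hom j" and eq: "\<And>a. rmul (j a) m = rmul (j a) n"
  shows "m = n"
proof -
  have "star m = star n"
  proof (rule nondegenerate_hom_eqI_left[OF j])
    show "lmul (star m) (j a) = lmul (star n) (j a)" for a
      using j eq[of "star a"] by (simp add: lmul_star nondegenerate_hom_def star_homD)
  qed
  then show ?thesis by (metis star_star)
qed

lemma approximate_identityD:
  assumes "approximate_identity F u"
  shows "F \<noteq> bot" "norm (u i) \<le> 1" "star (u i) = u i"
    "((\<lambda>i. u i * x) \<longlongrightarrow> x) F" "((\<lambda>i. x * u i) \<longlongrightarrow> x) F"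
proof -
  show "F \<noteq> bot" "norm (u i) \<le> 1" "((\<lambda>i. u i * x) \<longlongrightarrow> x) F" "((\<lambda>i. x * u i) \<longlongrightarrow> x) F"
    using assms by (auto simp: approximate_identity_def)
  show "star (u i) = u i"
    using assms unfolding approximate_identity_def by (metis star_mult star_star)
qed

text \<open>On vectors \<open>\<sigma> a \<cdot> h\<close> this is norm convergence of
  \<open>e i * a\<close>; contractivity of \<open>\<sigma>\<close> bounds the net uniformly and
  carries the limit to all vectors.\<close>

lemma approximate_unit_rep:
  assumes \<sigma>: "nondegenerate_rep \<sigma>" and e: "approximate_identity F e"
  shows "((\<lambda>i. \<sigma> (e i) \<cdot> h) \<longlongrightarrow> h) F"
proof -
  have hom: "star_hom \<sigma>" using \<sigma> by (simp add: nondegenerate_rep_def)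
  have lim: "((\<lambda>i. \<sigma> (e i) \<cdot> (\<sigma> a \<cdot> h)) \<longlongrightarrow> \<sigma> a \<cdot> h) F" for a h
  proof -
    have "((\<lambda>i. \<sigma> (e i * a)) \<longlongrightarrow> \<sigma> a) F"
      by (rule bounded_linear.tendsto[OF star_hom_bounded_linear[OF hom] approximate_identityD(4)[OF e]])
    then have "((\<lambda>i. \<sigma> (e i * a) \<cdot> h) \<longlongrightarrow> \<sigma> a \<cdot> h) F" by (rule tendsto_bop_apply)
    then show ?thesis by (simp add: star_homD[OF hom] bop_times_apply)
  qed
  have bd: "norm (\<sigma> (e i) \<cdot> x) \<le> 1 * norm x" for i x
    by (rule order_trans[OF bop_norm_apply])
      (use star_hom_contractive[OF hom, of "e i"] approximate_identityD(2)[OF e, of i] in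
        \<open>intro mult_right_mono order_trans[OF star_hom_contractive[OF hom]]\<close>, auto)
  obtain L where L: "bounded_linear L" "\<And>x. ((\<lambda>i. \<sigma> (e i) \<cdot> x) \<longlongrightarrow> L x) F"
    using bounded_limit_operator[of F "\<lambda>i x. \<sigma> (e i) \<cdot> x" 1 "{\<sigma> a \<cdot> h |a h. True}",
        OF approximate_identityD(1)[OF e] bop_bounded_linear bd] lim \<sigma>
    by (auto simp: nondegenerate_rep_def)
  have "L x = x" for x
  proof (rule dense_eqI[OF L(1) bounded_linear_ident])
    show "closure (span {\<sigma> a \<cdot> h |a h. True}) = UNIV" using \<sigma> by (simp add: nondegenerate_rep_def)
    fix x assume "x \<in> {\<sigma> a \<cdot> h |a h. True}"
    then show "L x = x"
      using tendsto_unique[OF approximate_identityD(1)[OF e] L(2) lim] by blast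
  qed
  with L(2)[of h] show ?thesis by simp
qed

text \<open>Any extension \<open>g\<close> satisfies
  \<open>g m * \<sigma> b = \<sigma> (lmul m b)\<close>, which by nondegeneracy determines it; this
  is the uniqueness in the description \<open>mult_ext\<close>. For existence, \<open>g m\<close> is
  the strong limit of \<open>\<sigma> (lmul m (e i))\<close>.\<close>

lemma mult_ext_rep:
  fixes \<sigma> :: "'b::cstar_algebra \<Rightarrow> 'h::complex_hilbert_space bop" and e :: "'i \<Rightarrow> 'b"
  assumes \<sigma>: "nondegenerate_rep \<sigma>" and e: "approximate_identity F e"
  shows star_hom_mult_ext_rep: "star_hom (mult_ext \<sigma>)"
    and mult_ext_rep_mult_of: "mult_ext \<sigma> (mult_of b) = \<sigma> b"
    and mult_ext_rep_lmul: "mult_ext \<sigma> m * \<sigma> b = \<sigma> (lmul m b)"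
    and mult_ext_rep_rmul: "\<sigma> b * mult_ext \<sigma> m = \<sigma> (rmul b m)"
    and mult_ext_rep_one: "mult_ext \<sigma> 1 = 1"
proof -
  have hom: "star_hom \<sigma>" and dense: "closure (span {\<sigma> a \<cdot> h |a h. True}) = UNIV"
    using \<sigma> by (auto simp: nondegenerate_rep_def)
  have F: "F \<noteq> bot" by (rule approximate_identityD(1)[OF e])
  have "\<exists>T. \<forall>b. T * \<sigma> b = \<sigma> (lmul m b)" for m
  proof -
    have lim: "((\<lambda>i. \<sigma> (lmul m (e i)) \<cdot> (\<sigma> b \<cdot> h)) \<longlongrightarrow> \<sigma> (lmul m b) \<cdot> h) F" for b h
    proof -
      have "((\<lambda>i. \<sigma> (lmul m (e i * b))) \<longlongrightarrow> \<sigma> (lmul m b)) F"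
        by (intro bounded_linear.tendsto[OF star_hom_bounded_linear[OF hom]]
            bounded_linear.tendsto[OF bounded_linear_lmul] approximate_identityD(4)[OF e])
      then have "((\<lambda>i. \<sigma> (lmul m (e i * b)) \<cdot> h) \<longlongrightarrow> \<sigma> (lmul m b) \<cdot> h) F" by (rule tendsto_bop_apply)
      then show ?thesis by (simp add: lmul_mult star_homD[OF hom] bop_times_apply)
    qed
    have bd: "norm (\<sigma> (lmul m (e i)) \<cdot> x) \<le> norm m * norm x" for i x
    proof -
      have "norm (\<sigma> (lmul m (e i))) \<le> norm (lmul m (e i))" by (rule star_hom_contractive[OF hom])
      also have "\<dots> \<le> norm m * norm (e i)" by (rule norm_lmul)
      also have "\<dots> \<le> norm m * 1" by (intro mult_left_mono approximate_identityD(2)[OF e]) simp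
      finally have "norm (\<sigma> (lmul m (e i))) \<le> norm m" by simp
      then show ?thesis
        by (rule order_trans[OF bop_norm_apply mult_right_mono]) simp
    qed
    obtain L where L: "bounded_linear L" "\<And>x. ((\<lambda>i. \<sigma> (lmul m (e i)) \<cdot> x) \<longlongrightarrow> L x) F"
      using bounded_limit_operator[of F "\<lambda>i x. \<sigma> (lmul m (e i)) \<cdot> x" "norm m" "{\<sigma> a \<cdot> h |a h. True}",
          OF F bop_bounded_linear bd _ dense] lim
      by blast
    have "L (c *\<^sub>C x) = c *\<^sub>C L x" for c x
    proof (rule tendsto_unique[OF F L(2)])
      show "((\<lambda>i. \<sigma> (lmul m (e i)) \<cdot> (c *\<^sub>C x)) \<longlongrightarrow> c *\<^sub>C L x) F"
        unfolding bop_apply_scaleC by (rule tendsto_scaleC[OF L(2)])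
    qed
    then obtain T where T: "\<And>x. T \<cdot> x = L x" using bop_ex[OF L(1)] by blast
    have "T * \<sigma> b = \<sigma> (lmul m b)" for b
      by (rule bop_eqI) (use tendsto_unique[OF F L(2) lim] in \<open>simp add: bop_times_apply T\<close>)
    then show ?thesis by blast
  qed
  then have "\<forall>m. \<exists>T. \<forall>b. T * \<sigma> b = \<sigma> (lmul m b)" by blast
  from choice[OF this] obtain g where g: "\<And>m b. g m * \<sigma> b = \<sigma> (lmul m b)" by blast
  note eqI = nondegenerate_rep_eqI[OF \<sigma>]
  have g_times: "g (m * n) = g m * g n" for m n
    by (rule eqI) (simp add: g lmul_simps mult.assoc)
  have g_mult_of: "g (mult_of a) = \<sigma> a" for a
    by (rule eqI) (simp add: g mult_of_apply star_homD[OF hom])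
  have g_star: "g (star m) = star (g m)" for m
  proof (rule eqI)
    fix b
    \<comment> \<open>The adjoint of \<open>g m\<close> is known only after multiplication by
      \<open>\<sigma> c\<close> on the left; a further adjoint turns this into multiplication on the
      right, where \<open>eqI\<close> applies.\<close>
    have "\<sigma> c * (g (star m) * \<sigma> b) = \<sigma> c * (star (g m) * \<sigma> b)" for c
    proof -
      have "\<sigma> c * star (g m) = star (g m * \<sigma> (star c))"
        by (simp add: star_mult star_homD[OF hom] star_star)
      also have "\<dots> = \<sigma> (rmul c (star m))" by (simp add: g star_homD(4)[OF hom, symmetric] rmul_star)
      finally have "\<sigma> c * star (g m) * \<sigma> b = \<sigma> (c * lmul (star m) b)"
        by (simp add: star_homD(3)[OF hom, symmetric] rmul_lmul)
      then show ?thesis by (simp add: g star_homD[OF hom] mult.assoc)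
    qed
    then have "star (g (star m) * \<sigma> b) * \<sigma> (star c) = star (star (g m) * \<sigma> b) * \<sigma> (star c)" for c
      by (metis star_homD(4)[OF hom] star_mult)
    then have "star (g (star m) * \<sigma> b) * \<sigma> c = star (star (g m) * \<sigma> b) * \<sigma> c" for c
      by (metis star_star)
    then have "star (g (star m) * \<sigma> b) = star (star (g m) * \<sigma> b)" by (rule eqI)
    then show "g (star m) * \<sigma> b = star (g m) * \<sigma> b" by (metis star_star)
  qed
  have "g (m + n) = g m + g n" "g (c *\<^sub>C m) = c *\<^sub>C g m" for m n c
    by (rule eqI, simp add: g lmul_simps star_homD[OF hom] distrib_right scaleC_mult_left)+
  then have "star_hom g" by (simp add: star_hom_def g_times g_star)
  then have "star_hom g \<and> (\<forall>a. g (mult_of a) = \<sigma> a)" by (simp add: g_mult_of)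
  moreover have "g' = g" if "star_hom g' \<and> (\<forall>a. g' (mult_of a) = \<sigma> a)" for g'
  proof (rule ext, rule eqI)
    have g': "star_hom g'" "\<And>a. g' (mult_of a) = \<sigma> a" using that by auto
    fix m a
    have "g' m * \<sigma> a = g' (m * mult_of a)" by (simp add: star_homD[OF g'(1)] g'(2))
    then show "g' m * \<sigma> a = g m * \<sigma> a" by (simp add: mult_mult_of g'(2) g)
  qed
  ultimately have ext: "mult_ext \<sigma> = g"
    unfolding mult_ext_def by (rule the_equality)
  show "star_hom (mult_ext \<sigma>)" "mult_ext \<sigma> (mult_of b) = \<sigma> b" "mult_ext \<sigma> m * \<sigma> b = \<sigma> (lmul m b)"
    unfolding ext by (rule \<open>star_hom g\<close> g_mult_of g)+
  show "\<sigma> b * mult_ext \<sigma> m = \<sigma> (rmul b m)"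
    unfolding ext by (metis g_mult_of g_times mult_of_mult)
  show "mult_ext \<sigma> 1 = 1" unfolding ext by (rule eqI) (simp add: g lmul_one)
qed

text \<open>A multiplier descends along \<open>\<theta>\<close> once it preserves the kernel. This
  follows from an estimate of \<open>\<theta> (lmul m b)\<close> by the norm of
  \<open>\<theta> b\<close>, since \<open>\<theta> (lmul m (e i * b))\<close> splits as
  \<open>\<theta> (lmul m (e i)) * \<theta> b\<close>.\<close>

lemma mult_ext_surj_rmul:
  fixes \<theta> :: "'b::cstar_algebra \<Rightarrow> 'c::cstar_algebra" and e :: "'i \<Rightarrow> 'b"
  assumes hom: "star_hom \<theta>" and surj: "surj \<theta>" and e: "approximate_identity F e"
  shows "rmul (\<theta> b) (mult_ext (mult_of \<circ> \<theta>) m) = \<theta> (rmul b m)"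
proof -
  have F: "F \<noteq> bot" by (rule approximate_identityD(1)[OF e])
  have lim: "((\<lambda>i. \<theta> (f (e i * b))) \<longlongrightarrow> \<theta> (f b)) F" if "bounded_linear f" for f b
    by (intro bounded_linear.tendsto[OF star_hom_bounded_linear[OF hom]]
        bounded_linear.tendsto[OF that] approximate_identityD(4)[OF e])
  have le: "norm (\<theta> (lmul m b)) \<le> norm m * norm (\<theta> b)" for m b
  proof (rule tendsto_upperbound[OF tendsto_norm[OF lim[OF bounded_linear_lmul]] _ F], rule always_eventually, rule allI)
    fix i
    have "norm (\<theta> (lmul m (e i * b))) \<le> norm (\<theta> (lmul m (e i))) * norm (\<theta> b)"
      by (simp add: lmul_mult star_homD[OF hom] norm_mult_ineq)
    also have "\<dots> \<le> norm m * norm (\<theta> b)"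
    proof (rule mult_right_mono)
      have "norm (\<theta> (lmul m (e i))) \<le> norm (lmul m (e i))" by (rule star_hom_contractive[OF hom])
      also have "\<dots> \<le> norm m * norm (e i)" by (rule norm_lmul)
      also have "\<dots> \<le> norm m * 1" by (intro mult_left_mono approximate_identityD(2)[OF e]) simp
      finally show "norm (\<theta> (lmul m (e i))) \<le> norm m" by simp
    qed simp
    finally show "norm (\<theta> (lmul m (e i * b))) \<le> norm m * norm (\<theta> b)" .
  qed
  \<comment> \<open>An arbitrary preimage is chosen; the estimate \<open>le\<close>, applied to the
    difference of two preimages, shows independence of the choice.\<close>
  define L where "L m c = \<theta> (lmul m (inv \<theta> c))" for m c
  have inv: "\<theta> (inv \<theta> c) = c" for c by (rule surj_f_inv_f[OF surj])
  have L: "L m (\<theta> b) = \<theta> (lmul m b)" for m b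
  proof -
    have "norm (\<theta> (lmul m (inv \<theta> (\<theta> b) - b))) \<le> norm m * norm (\<theta> (inv \<theta> (\<theta> b) - b))" by (rule le)
    then have "\<theta> (lmul m (inv \<theta> (\<theta> b) - b)) = 0" by (simp add: star_hom_diff[OF hom] inv)
    then show ?thesis by (simp add: L_def lmul_diff star_hom_diff[OF hom])
  qed
  have cases: "(\<And>b. P (\<theta> b)) \<Longrightarrow> P c" for P and c by (metis inv)
  have L_lin: "bounded_linear (L m)" for m
  proof (rule bounded_linear_intro[where K="norm m"])
    show "L m (x + y) = L m x + L m y" for x y
      by (rule cases[of _ x], rule cases[of _ y])
        (simp add: star_homD(1)[OF hom, symmetric] L lmul_add)
    show "L m (r *\<^sub>R x) = r *\<^sub>R L m x" for r x
      by (rule cases[of _ x]) (simp add: star_hom_scaleR[OF hom, symmetric] L lmul_scaleR)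
    show "norm (L m x) \<le> norm x * norm m" for x
      by (rule cases[of _ x]) (simp add: L le mult.commute)
  qed
  define R where "R m c = star (L (star m) (star c))" for m c
  have R: "R m (\<theta> b) = \<theta> (rmul b m)" for m b
    by (simp add: R_def star_homD(4)[OF hom, symmetric] L lmul_star star_star)
  have R_lin: "bounded_linear (R m)" for m
    unfolding R_def
    by (intro bounded_linear_compose[OF bounded_linear_star]
        bounded_linear_compose[OF L_lin bounded_linear_star])
  have LR: "R m a * b = a * L m b" for m a b
    by (rule cases[of _ a], rule cases[of _ b])
      (simp add: L R star_homD(3)[OF hom, symmetric] rmul_lmul)
  define g where "g m = multiplier (L m) (R m)" for m
  have lg: "lmul (g m) (\<theta> b) = \<theta> (lmul m b)" for m b
    using lmul_multiplier[OF L_lin R_lin LR] by (simp add: g_def L)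
  have rg: "rmul (\<theta> b) (g m) = \<theta> (rmul b m)" for m b
    using rmul_multiplier[OF L_lin R_lin LR] by (simp add: g_def R)
  have eqI: "m = n" if "\<And>b. lmul m (\<theta> b) = lmul n (\<theta> b)" for m n
    by (rule multiplier_eqI) (metis inv that)
  have g_mult_of: "g (mult_of b) = mult_of (\<theta> b)" for b
    by (rule eqI) (simp add: lg mult_of_apply star_homD[OF hom])
  have rg_star: "rmul (star (\<theta> b)) (g m) = \<theta> (rmul (star b) m)" for m b
    by (metis rg star_homD(4)[OF hom])
  have "star_hom g"
    unfolding star_hom_def
    by (auto intro!: eqI simp: lg rg_star lmul_simps lmul_star star_homD[OF hom])
  then have "star_hom g \<and> (\<forall>a. g (mult_of a) = (mult_of \<circ> \<theta>) a)" by (simp add: g_mult_of)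
  moreover have "g' = g" if "star_hom g' \<and> (\<forall>a. g' (mult_of a) = (mult_of \<circ> \<theta>) a)" for g'
  proof (rule ext, rule eqI)
    have g': "star_hom g'" "\<And>a. g' (mult_of a) = (mult_of \<circ> \<theta>) a" using that by auto
    fix m b
    have "mult_of (lmul (g' m) (\<theta> b)) = g' (m * mult_of b)"
      by (simp add: star_homD[OF g'(1)] g'(2) mult_mult_of[symmetric])
    also have "\<dots> = mult_of (\<theta> (lmul m b))" by (simp add: mult_mult_of g'(2))
    finally show "lmul (g' m) (\<theta> b) = lmul (g m) (\<theta> b)" by (metis mult_of_inj lg)
  qed
  ultimately have ext: "mult_ext (mult_of \<circ> \<theta>) = g"
    unfolding mult_ext_def by (rule the_equality)
  show "rmul (\<theta> b) (mult_ext (mult_of \<circ> \<theta>) m) = \<theta> (rmul b m)"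
    unfolding ext by (rule rg)
qed

lemma star_hom_eq_on_generators:
  assumes f: "star_hom f" and g: "star_hom g" and gen: "cstar_generated S = UNIV"
    and eq: "\<And>x. x \<in> S \<Longrightarrow> f x = g x"
  shows "f = g"
proof -
  have "closed {x. f x = g x}"
    by (intro closed_Collect_eq linear_continuous_on star_hom_bounded_linear f g)
  then have "cstar_subalgebra {x. f x = g x}"
    unfolding cstar_subalgebra_def
    by (auto simp: star_homD[OF f] star_homD[OF g] star_hom_zero[OF f] star_hom_zero[OF g])
  then have "cstar_generated S \<subseteq> {x. f x = g x}"
    unfolding cstar_generated_def by (intro hull_minimal) (use eq in auto)
  then show ?thesis using gen by auto
qed

text \<open>This supplies the approximate identity of the target algebra that the lemmas on
  \<open>mult_ext\<close> ask for. Convergence on the left is uniform boundedness plus density; the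
  right side follows by adjoints, as \<open>u i\<close> is self-adjoint.\<close>

lemma approximate_identity_image:
  assumes j: "nondegenerate_hom j" and u: "approximate_identity F u"
  shows "approximate_identity F (j \<circ> u)"
proof -
  have hom: "star_hom j" and dense: "closure (span {j a * b |a b. True}) = UNIV"
    using j by (auto simp: nondegenerate_hom_def)
  have F: "F \<noteq> bot" by (rule approximate_identityD(1)[OF u])
  have lim: "((\<lambda>i. j (u i) * (j a * b)) \<longlongrightarrow> j a * b) F" for a b
  proof -
    have "((\<lambda>i. j (u i * a) * b) \<longlongrightarrow> j a * b) F"
      by (intro tendsto_intros bounded_linear.tendsto[OF star_hom_bounded_linear[OF hom]]
          approximate_identityD(4)[OF u])
    then show ?thesis by (simp add: star_homD[OF hom] mult.assoc)
  qed
  have n1: "norm (j (u i)) \<le> 1" for i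
    using star_hom_contractive[OF hom] approximate_identityD(2)[OF u] order_trans by blast
  have bd: "norm (j (u i) * x) \<le> 1 * norm x" for i x
    by (rule order_trans[OF norm_mult_ineq mult_right_mono[OF n1]]) simp
  obtain L where L: "bounded_linear L" "\<And>x. ((\<lambda>i. j (u i) * x) \<longlongrightarrow> L x) F"
    using bounded_limit_operator[of F "\<lambda>i x. j (u i) * x" 1 "{j a * b |a b. True}",
        OF F bounded_linear_mult_right bd _ dense] lim by blast
  have "L x = x" for x
  proof (rule dense_eqI[OF L(1) bounded_linear_ident dense])
    fix x assume "x \<in> {j a * b |a b. True}"
    then show "L x = x" using tendsto_unique[OF F L(2) lim] by blast
  qed
  with L(2) have l: "((\<lambda>i. j (u i) * x) \<longlongrightarrow> x) F" for x by simp
  have "((\<lambda>i. star (j (u i) * star x)) \<longlongrightarrow> star (star x)) F" for x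
    by (rule bounded_linear.tendsto[OF bounded_linear_star l])
  then have r: "((\<lambda>i. x * j (u i)) \<longlongrightarrow> x) F" for x
    by (simp add: star_mult star_star star_homD(4)[OF hom, symmetric] approximate_identityD(3)[OF u])
  have "\<exists>b. j (u i) = star b * b" for i
  proof -
    obtain b where "u i = star b * b" using u unfolding approximate_identity_def by blast
    then have "j (u i) = star (j b) * j b" by (simp add: star_homD[OF hom])
    then show ?thesis by blast
  qed
  with F n1 l r show ?thesis by (simp add: approximate_identity_def)
qed

section \<open>Fibres of the twisted product system\<close>

locale twisted_dynamics =
  fixes \<beta> :: "'p::{monoid_mult, countable} \<Rightarrow> 'a::cstar_algebra \<Rightarrow> 'a"
    and \<omega> :: "'p \<Rightarrow> 'p \<Rightarrow> complex" and F :: "'i filter" and u :: "'i \<Rightarrow> 'a"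
  assumes tw: "twisted_system \<beta> \<omega>" and u: "approximate_identity F u"
begin

abbreviation "X \<equiv> twisted_product_system \<beta> \<omega>"

declare twisted_fibre_simps(1) [simp del]

definition p :: "'p \<Rightarrow> 'a multiplier" where
  "p s = strict_ext (\<beta> s) 1"

lemma hom_beta: "star_hom (\<beta> s)"
  and beta_beta: "\<beta> s (\<beta> t x) = \<beta> (s * t) x" and beta_one: "\<beta> 1 x = x"
  using tw by (auto simp: twisted_system_def fun_eq_iff)

lemmas beta = star_homD[OF hom_beta]

lemma cnj_omega: "cnj (\<omega> s t) * \<omega> s t = 1" "\<omega> s t * cnj (\<omega> s t) = 1"
proof -
  have "norm (\<omega> s t) = 1" using tw by (simp add: twisted_system_def)
  then show "\<omega> s t * cnj (\<omega> s t) = 1" using complex_norm_square[of "\<omega> s t"] by simp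
  then show "cnj (\<omega> s t) * \<omega> s t = 1" by (simp add: mult.commute)
qed

lemma omega_one: "\<omega> 1 s = 1" "\<omega> s 1 = 1"
proof -
  have c: "\<omega> r s * \<omega> (r * s) t = \<omega> r (s * t) * \<omega> s t" "\<omega> 1 1 = 1" for r s t
    using tw by (auto simp: twisted_system_def)
  have nz: "\<omega> s t \<noteq> 0" for s t using cnj_omega(1)[of s t] by auto
  show "\<omega> s 1 = 1" using c(1)[of s 1 1] nz[of s 1] c(2) by simp
  show "\<omega> 1 s = 1" using c(1)[of 1 1 s] nz[of 1 s] c(2) by simp
qed

lemma strict: "strict_extension (\<beta> s) (strict_ext (\<beta> s))"
  using tw by (intro strict_ext[OF u]) (simp add: twisted_system_def)

lemma p_mult_p: "p s * p s = p s" and star_p: "star (p s) = p s"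
proof -
  have h: "star_hom (strict_ext (\<beta> s))" using strict[of s] by (simp add: strict_extension_def)
  show "p s * p s = p s" "star (p s) = p s"
    unfolding p_def by (metis star_homD(3,4)[OF h] mult.left_neutral star_one)+
qed

lemma p_idem [simp]: "lmul (p s) (lmul (p s) x) = lmul (p s) x"
  by (metis lmul_times_left p_mult_p)

lemma rmul_p: "rmul x (p s) = star (lmul (p s) (star x))"
  by (metis rmul_star star_p)

text \<open>Strict continuity moves the limit of \<open>u i\<close> to 1 through the extended
  endomorphism. The facts \<open>p_beta\<close>, \<open>p_one\<close>, \<open>p_beta_p\<close> and
  \<open>norm_p\<close> are read off from this limit rather than from the extension itself.\<close>

lemma p_limit: "((\<lambda>i. \<beta> s (u i) * x) \<longlongrightarrow> lmul (p s) x) F"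
proof -
  have "limitin strict_topology (\<lambda>i. mult_of (u i)) 1 F"
    using approximate_identityD(4,5)[OF u]
    by (simp add: limitin_strict_iff mult_of_apply lmul_one rmul_one)
  then have "limitin strict_topology (strict_ext (\<beta> s) \<circ> (\<lambda>i. mult_of (u i))) (strict_ext (\<beta> s) 1) F"
    using strict[of s] unfolding strict_extension_def by (blast intro: continuous_map_limit)
  moreover have "strict_ext (\<beta> s) (mult_of a) = mult_of (\<beta> s a)" for a
    using strict[of s] by (simp add: strict_extension_def)
  ultimately show ?thesis
    by (simp add: limitin_strict_iff mult_of_apply p_def comp_def)
qed

lemmas F = approximate_identityD(1)[OF u]

lemma lim_beta: "(f \<longlongrightarrow> x) F \<Longrightarrow> ((\<lambda>i. \<beta> s (f i)) \<longlongrightarrow> \<beta> s x) F"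
  by (rule bounded_linear.tendsto[OF star_hom_bounded_linear[OF hom_beta]])

lemma p_beta [simp]: "lmul (p s) (\<beta> s a) = \<beta> s a"
proof (rule tendsto_unique[OF F p_limit])
  show "((\<lambda>i. \<beta> s (u i) * \<beta> s a) \<longlongrightarrow> \<beta> s a) F"
    unfolding beta(3)[symmetric] by (intro lim_beta approximate_identityD(4)[OF u])
qed

lemma beta_p [simp]: "\<beta> s a * lmul (p s) x = \<beta> s a * x"
proof -
  have "\<beta> s a * lmul (p s) x = rmul (\<beta> s a) (p s) * x" by (simp add: rmul_lmul)
  then show ?thesis by (simp add: rmul_p beta(4)[symmetric] star_star)
qed

lemma p_one [simp]: "lmul (p 1) x = x"
  by (rule tendsto_unique[OF F p_limit]) (simp add: beta_one approximate_identityD(4)[OF u])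

lemma p_beta_p: "lmul (p (t * s)) (\<beta> t x) = \<beta> t (lmul (p s) x)"
proof (rule tendsto_unique[OF F p_limit])
  show "((\<lambda>i. \<beta> (t * s) (u i) * \<beta> t x) \<longlongrightarrow> \<beta> t (lmul (p s) x)) F"
    unfolding beta_beta[symmetric] beta(3)[symmetric] by (intro lim_beta p_limit)
qed

lemma norm_p: "norm (lmul (p s) x) \<le> norm x"
proof (rule tendsto_upperbound[OF tendsto_norm[OF p_limit] _ F], rule always_eventually, rule allI)
  fix i
  have "norm (\<beta> s (u i)) \<le> 1"
    using star_hom_contractive[OF hom_beta] approximate_identityD(2)[OF u] order_trans by blast
  then show "norm (\<beta> s (u i) * x) \<le> norm x"
    by (metis mult_left_le_one_le norm_ge_zero norm_mult_ineq order_trans)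
qed

lemma mem_fibre: "z \<in> bcarrier (twisted_fibre \<beta> s) \<longleftrightarrow> fst z = s \<and> lmul (p s) (snd z) = snd z"
  unfolding twisted_fibre_simps mem_Times_iff p_def[symmetric]
  by (metis p_idem rangeE rangeI singleton_iff)

lemma mem_total: "z \<in> total X \<longleftrightarrow> lmul (p (fst z)) (snd z) = snd z"
  by (simp add: total_def mem_fibre) (metis opp.sel)

text \<open>Coordinates for the fibres: an element over \<open>s\<close> is a pair
  \<open>(s, x)\<close> with \<open>lmul (p s) x = x\<close>. Quantifiers over the opposite
  semigroup become quantifiers over the original one, so the reversed order survives only in the
  product \<open>t * s\<close>.\<close>

lemma toeplitz_rep_iff:
  "toeplitz_rep X \<psi> \<longleftrightarrow>
     (\<forall>s x y. lmul (p s) x = x \<and> lmul (p s) y = y \<longrightarrow>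
        \<psi> (s, x + y) = \<psi> (s, x) + \<psi> (s, y) \<and> star (\<psi> (s, x)) * \<psi> (s, y) = \<psi> (1, star x * y)) \<and>
     (\<forall>s c x. lmul (p s) x = x \<longrightarrow> \<psi> (s, c *\<^sub>C x) = c *\<^sub>C \<psi> (s, x)) \<and>
     star_hom (\<lambda>a. \<psi> (1, a)) \<and>
     (\<forall>s x t y. lmul (p s) x = x \<and> lmul (p t) y = y \<longrightarrow>
        \<psi> (t * s, cnj (\<omega> t s) *\<^sub>C (\<beta> t x * y)) = \<psi> (s, x) * \<psi> (t, y))"
proof -
  have opp_all: "(\<forall>q. Q (unopp q)) \<longleftrightarrow> (\<forall>s. Q s)" for Q :: "'p \<Rightarrow> bool"
    by (metis opp.sel)
  have ball_fibre: "(\<forall>z\<in>bcarrier (twisted_fibre \<beta> s). Q z) \<longleftrightarrow>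
      (\<forall>x. lmul (p s) x = x \<longrightarrow> Q (s, x))" for s Q
    by (force simp: mem_fibre)
  have ball_total: "(\<forall>z\<in>total X. Q z) \<longleftrightarrow> (\<forall>s x. lmul (p s) x = x \<longrightarrow> Q (s, x))" for Q
    by (force simp: mem_total)
  show ?thesis
    unfolding toeplitz_rep_def twisted_product_system_simps ball_total opp_all
      opp_all[of "\<lambda>s. \<forall>x\<in>bcarrier (twisted_fibre \<beta> s). \<forall>y\<in>bcarrier (twisted_fibre \<beta> s).
        \<psi> (badd (twisted_fibre \<beta> s) x y) = \<psi> x + \<psi> y \<and>
        star (\<psi> x) * \<psi> y = \<psi> (1, binner (twisted_fibre \<beta> s) x y)"]
      opp_all[of "\<lambda>s. \<forall>c. \<forall>x\<in>bcarrier (twisted_fibre \<beta> s).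
        \<psi> (bscale (twisted_fibre \<beta> s) c x) = c *\<^sub>C \<psi> x"]
    unfolding ball_fibre
    unfolding twisted_fibre_simps(2-7) fst_conv snd_conv
    by meson
qed

text \<open>The compact operators on \<open>X\<^sub>s\<close> are the left multiplications by the corner \<open>pAp\<close>.\<close>

definition corner :: "'p \<Rightarrow> 'a set" where
  "corner s = {d. lmul (p s) d = d \<and> rmul d (p s) = d}"

definition corner_op :: "'p \<Rightarrow> 'a \<Rightarrow> 'p \<times> 'a \<Rightarrow> 'p \<times> 'a" where
  "corner_op s d = (\<lambda>z\<in>bcarrier (twisted_fibre \<beta> s). (s, d * snd z))"

lemma corner_subalgebra: "cstar_subalgebra (corner s)"
proof -
  have "corner s = {d. lmul (p s) d = d} \<inter> {d. rmul d (p s) = d}" by (auto simp: corner_def)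
  moreover have "closed {d. lmul (p s) d = d}"
    by (intro closed_Collect_eq linear_continuous_on bounded_linear_lmul continuous_intros)
  moreover have "closed {d. rmul d (p s) = d}"
    by (intro closed_Collect_eq linear_continuous_on bounded_linear_rmul continuous_intros)
  ultimately have "closed (corner s)" by (simp add: closed_Int)
  moreover have "lmul (p s) (star x) = star x \<and> rmul (star x) (p s) = star x" if "x \<in> corner s" for x
    using that by (metis (mono_tags, lifting) corner_def mem_Collect_eq rmul_p star_star)
  ultimately show ?thesis
    unfolding cstar_subalgebra_def
    by (auto simp: corner_def lmul_add rmul_add lmul_scaleC rmul_scaleC lmul_mult rmul_mult
        linear_simps(3)[OF bounded_linear_lmul] linear_simps(3)[OF bounded_linear_rmul])
qed

lemma corner_closed:
  "d \<in> corner s \<Longrightarrow> e \<in> corner s \<Longrightarrow> d + e \<in> corner s"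
  "d \<in> corner s \<Longrightarrow> e \<in> corner s \<Longrightarrow> d * e \<in> corner s"
  "d \<in> corner s \<Longrightarrow> c *\<^sub>C d \<in> corner s" "d \<in> corner s \<Longrightarrow> star d \<in> corner s" "0 \<in> corner s"
  using corner_subalgebra[of s] by (auto simp: cstar_subalgebra_def)

lemma corner_p: "d \<in> corner s \<Longrightarrow> lmul (p s) d = d" "d \<in> corner s \<Longrightarrow> d * lmul (p s) x = d * x"
  by (auto simp: corner_def) (metis rmul_lmul)

lemma beta_corner: "\<beta> s a \<in> corner s"
  by (simp add: corner_def rmul_p beta(4)[symmetric] star_star)

lemma mult_star_corner: "lmul (p s) x = x \<Longrightarrow> lmul (p s) y = y \<Longrightarrow> x * star y \<in> corner s"
  by (simp add: corner_def lmul_mult rmul_mult rmul_p star_star star_mult)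

lemma corner_op_apply:
  "z \<in> bcarrier (twisted_fibre \<beta> s) \<Longrightarrow> corner_op s d z = (s, d * snd z)"
  by (simp add: corner_op_def)

text \<open>For \<open>d\<close> in the corner, \<open>d * lmul (p s) x = d * x\<close>, so the
  action on the fibre already determines left multiplication on the whole algebra.\<close>

lemma corner_op_inj:
  assumes "d \<in> corner s" "e \<in> corner s" "corner_op s d = corner_op s e"
  shows "d = e"
proof (rule cstar_eqI_right)
  fix x
  have z: "(s, lmul (p s) x) \<in> bcarrier (twisted_fibre \<beta> s)" by (simp add: mem_fibre)
  have "d * lmul (p s) x = e * lmul (p s) x"
    using fun_cong[OF assms(3), of "(s, lmul (p s) x)"] by (simp add: corner_op_apply[OF z])
  then show "d * x = e * x" using assms by (simp add: corner_p)
qed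

lemma corner_op_closed:
  "d \<in> corner s \<Longrightarrow> corner_op s d \<in> bcarrier (twisted_fibre \<beta> s) \<rightarrow>\<^sub>E bcarrier (twisted_fibre \<beta> s)"
  by (auto simp: corner_op_def mem_fibre lmul_mult corner_p PiE_def Pi_def)

text \<open>Each member of this net is the symbol of the single rank one operator given by
  \<open>(s, d)\<close> and \<open>(s, \<beta> s (u i))\<close>. Hence it yields both the density of
  finite rank operators and the uniqueness of \<open>compacts_hom\<close>.\<close>

lemma corner_limit:
  assumes "d \<in> corner s"
  shows "((\<lambda>i. d * star (\<beta> s (u i))) \<longlongrightarrow> d) F"
proof -
  have "((\<lambda>i. star (\<beta> s (u i) * star d)) \<longlongrightarrow> star (lmul (p s) (star d))) F"
    by (intro bounded_linear.tendsto[OF bounded_linear_star] p_limit)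
  then show ?thesis using corner_p(1)[OF corner_closed(4)[OF assms]] by (simp add: star_mult star_star)
qed

lemma rank_one_fibre:
  assumes "lmul (p s) x = x" "lmul (p s) y = y"
  shows "rank_one (twisted_fibre \<beta> s) (s, x) (s, y) = corner_op s (x * star y)"
  by (simp add: rank_one_def corner_op_def mult.assoc)

lemma op_add_corner_op:
  "d \<in> corner s \<Longrightarrow> e \<in> corner s \<Longrightarrow>
     op_add (twisted_fibre \<beta> s) (corner_op s d) (corner_op s e) = corner_op s (d + e)"
  by (auto simp: op_add_def corner_op_def distrib_right)

lemma op_scale_corner_op:
  "op_scale (twisted_fibre \<beta> s) c (corner_op s d) = corner_op s (c *\<^sub>C d)"
  by (auto simp: op_scale_def corner_op_def scaleC_mult_left)

lemma compose_corner_op: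
  "e \<in> corner s \<Longrightarrow>
     compose (bcarrier (twisted_fibre \<beta> s)) (corner_op s d) (corner_op s e) = corner_op s (d * e)"
  using corner_op_closed[of e s]
  by (auto simp: compose_def corner_op_def mult.assoc mem_fibre lmul_mult corner_p fun_eq_iff
     )

text \<open>The description \<open>compacts_hom\<close> speaks of every adjoint pair of compact
  operators; here such pairs are reduced to \<open>d\<close> and \<open>star d\<close>, so that its
  adjoint clause becomes compatibility with \<open>star\<close> on the corner.\<close>

lemma is_adjoint_corner_op:
  assumes d: "d \<in> corner s" and e: "e \<in> corner s"
  shows "is_adjoint (twisted_fibre \<beta> s) (corner_op s d) (corner_op s e) \<longleftrightarrow> e = star d"
proof
  assume "e = star d"
  then show "is_adjoint (twisted_fibre \<beta> s) (corner_op s d) (corner_op s e)"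
    by (auto simp: is_adjoint_def corner_op_apply star_mult mult.assoc)
next
  assume adj: "is_adjoint (twisted_fibre \<beta> s) (corner_op s d) (corner_op s e)"
  have key: "star x * (star d * y) = star x * (e * y)" for x y
  proof -
    have z: "(s, lmul (p s) w) \<in> bcarrier (twisted_fibre \<beta> s)" for w
      by (simp add: mem_fibre)
    have "star (d * lmul (p s) x) * lmul (p s) y = star (lmul (p s) x) * (e * lmul (p s) y)"
      using adj[unfolded is_adjoint_def, rule_format, OF z[of x] z[of y]]
      by (simp add: corner_op_apply z)
    then have "star x * (star d * lmul (p s) y) = rmul (star x) (p s) * (e * y)"
      using d e by (simp add: corner_p star_mult rmul_p star_star mult.assoc)
    then show ?thesis
      using corner_p[OF corner_closed(4)[OF d]] corner_p[OF e] by (simp add: rmul_lmul lmul_mult)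
  qed
  have "star d * y = e * y" for y by (rule cstar_eqI_left) (metis key star_star)
  then show "e = star d" by (metis cstar_eqI_right)
qed

lemma finite_rank_corner:
  assumes "T \<in> finite_rank (twisted_fibre \<beta> s)"
  shows "T \<in> corner_op s ` corner s"
  using assms
proof induction
  case zero
  have "(\<lambda>z\<in>bcarrier (twisted_fibre \<beta> s). bzero (twisted_fibre \<beta> s)) = corner_op s 0"
    by (simp add: corner_op_def)
  then show ?case using corner_closed(5) by blast
next
  case (add T x y)
  then obtain d where d: "d \<in> corner s" "T = corner_op s d" by blast
  have xy: "x = (s, snd x)" "y = (s, snd y)" "lmul (p s) (snd x) = snd x" "lmul (p s) (snd y) = snd y"
    using add.hyps by (auto simp: mem_fibre prod_eq_iff)
  have "rank_one (twisted_fibre \<beta> s) x y = corner_op s (snd x * star (snd y))"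
    using rank_one_fibre[OF xy(3,4)] xy(1,2) by metis
  then have "op_add (twisted_fibre \<beta> s) T (rank_one (twisted_fibre \<beta> s) x y) =
      corner_op s (d + snd x * star (snd y))"
    using d mult_star_corner[OF xy(3,4)] by (simp add: op_add_corner_op)
  then show ?case using d mult_star_corner[OF xy(3,4)] corner_closed(1) by blast
qed

text \<open>As \<open>d * lmul (p s) a = d * a\<close> and \<open>p s\<close> is contractive, a
  bound on the fibre bounds the multiplier \<open>mult_of d\<close>, whose norm is that of
  \<open>d\<close>. Operator approximation can thus be read as norm approximation in the
  corner.\<close>

lemma corner_norm_bound:
  assumes d: "d \<in> corner s" and c: "c \<ge> 0"
    and le: "\<And>x. lmul (p s) x = x \<Longrightarrow> norm (d * x) \<le> c * norm x"
  shows "norm d \<le> c"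
proof -
  have "norm (mult_of d) \<le> c"
  proof (rule norm_multiplier_bound[OF c])
    fix a
    have "norm (d * lmul (p s) a) \<le> c * norm (lmul (p s) a)" by (rule le) simp
    also have "\<dots> \<le> c * norm a" by (intro mult_left_mono norm_p c)
    finally show "norm (lmul (mult_of d) a) \<le> c * norm a"
      using d by (simp add: mult_of_apply corner_p)
  qed
  then show ?thesis by (simp add: norm_mult_of)
qed

text \<open>The symbols of finite rank approximants form a Cauchy sequence by
  \<open>corner_norm_bound\<close>, and the corner is closed. Conversely,
  \<open>corner_limit\<close> approximates \<open>corner_op s d\<close> by single rank one
  operators.\<close>

lemma compacts_fibre: "compacts (twisted_fibre \<beta> s) = corner_op s ` corner s"
proof (intro equalityI subsetI)
  fix T assume T: "T \<in> compacts (twisted_fibre \<beta> s)"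
  then have TE: "T \<in> bcarrier (twisted_fibre \<beta> s) \<rightarrow>\<^sub>E bcarrier (twisted_fibre \<beta> s)"
    by (simp add: compacts_def adjointable_def)
  have approx: "\<exists>S\<in>finite_rank (twisted_fibre \<beta> s). \<forall>z\<in>bcarrier (twisted_fibre \<beta> s).
      norm (snd (T z) - snd (S z)) \<le> e * norm (snd z)" if "e > 0" for e
    using T that by (simp add: compacts_def)
  have "\<exists>d\<in>corner s. \<forall>x. lmul (p s) x = x \<longrightarrow> norm (snd (T (s, x)) - d * x) \<le> e * norm x"
    if e: "e > 0" for e
  proof -
    obtain S where S: "S \<in> finite_rank (twisted_fibre \<beta> s)"
      "\<And>z. z \<in> bcarrier (twisted_fibre \<beta> s) \<Longrightarrow> norm (snd (T z) - snd (S z)) \<le> e * norm (snd z)"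
      using approx[OF e] by blast
    obtain d where d: "d \<in> corner s" "S = corner_op s d" using finite_rank_corner[OF S(1)] by blast
    show ?thesis
    proof (intro bexI[of _ d] allI impI d)
      fix x assume "lmul (p s) x = x"
      then have "(s, x) \<in> bcarrier (twisted_fibre \<beta> s)"
        by (simp add: mem_fibre)
      then show "norm (snd (T (s, x)) - d * x) \<le> e * norm x"
        using S(2)[of "(s, x)"] by (simp add: d(2) corner_op_apply)
    qed
  qed
  then have "\<forall>n. \<exists>d. d \<in> corner s \<and> (\<forall>x. lmul (p s) x = x \<longrightarrow>
      norm (snd (T (s, x)) - d * x) \<le> inverse (real (Suc n)) * norm x)"
    by (metis inverse_positive_iff_positive of_nat_0_less_iff zero_less_Suc)
  from choice[OF this] obtain d where d: "\<And>n. d n \<in> corner s"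
    "\<And>n x. lmul (p s) x = x \<Longrightarrow> norm (snd (T (s, x)) - d n * x) \<le> inverse (real (Suc n)) * norm x"
    by blast
  have diff: "norm (d n - d m) \<le> inverse (real (Suc n)) + inverse (real (Suc m))" for n m
  proof (rule corner_norm_bound)
    have "d n + (-1) *\<^sub>C d m \<in> corner s" by (intro corner_closed d(1))
    then show "d n - d m \<in> corner s" by (simp add: scaleC_minus1)
    fix x assume x: "lmul (p s) x = x"
    have "norm ((d n - d m) * x) = norm ((snd (T (s, x)) - d m * x) - (snd (T (s, x)) - d n * x))"
      by (simp add: algebra_simps)
    also have "\<dots> \<le> norm (snd (T (s, x)) - d m * x) + norm (snd (T (s, x)) - d n * x)"
      by (rule norm_triangle_ineq4)
    also have "\<dots> \<le> inverse (real (Suc m)) * norm x + inverse (real (Suc n)) * norm x"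
      by (intro add_mono d(2) x)
    finally show "norm ((d n - d m) * x) \<le> (inverse (real (Suc n)) + inverse (real (Suc m))) * norm x"
      by (simp add: algebra_simps)
  qed simp
  have "Cauchy d"
  proof (rule CauchyI)
    fix e :: real assume e: "e > 0"
    obtain M where M: "inverse (real (Suc M)) < e / 2" using reals_Archimedean[of "e/2"] e by auto
    have "inverse (real (Suc n)) < e / 2" if "n \<ge> M" for n
      using that M by (smt (verit) le_imp_inverse_le of_nat_0_less_iff of_nat_mono Suc_le_mono zero_less_Suc)
    then have "norm (d m - d n) < e" if "m \<ge> M" "n \<ge> M" for m n
      using diff[of m n] that by (smt (verit) field_sum_of_halves)
    then show "\<exists>M. \<forall>m\<ge>M. \<forall>n\<ge>M. norm (d m - d n) < e" by blast
  qed
  then obtain l where l: "d \<longlonglongrightarrow> l" using Cauchy_convergent_iff convergent_def by blast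
  have lc: "l \<in> corner s"
    using closed_sequentially[of "corner s" d l] corner_subalgebra[of s] d(1) l
    by (simp add: cstar_subalgebra_def)
  have snd_T: "snd (T (s, x)) = l * x" if x: "lmul (p s) x = x" for x
  proof -
    have "(\<lambda>n. norm (snd (T (s, x)) - d n * x)) \<longlonglongrightarrow> 0"
    proof (rule tendsto_sandwich[OF _ _ tendsto_const])
      have "(\<lambda>n. inverse (real (Suc n)) * norm x) \<longlonglongrightarrow> 0 * norm x"
        by (intro tendsto_intros LIMSEQ_inverse_real_of_nat)
      then show "(\<lambda>n. inverse (real (Suc n)) * norm x) \<longlonglongrightarrow> 0" by simp
    qed (use d(2)[OF x] in \<open>simp_all del: of_nat_Suc\<close>)
    moreover have "(\<lambda>n. norm (snd (T (s, x)) - d n * x)) \<longlonglongrightarrow> norm (snd (T (s, x)) - l * x)"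
      by (intro tendsto_intros l)
    ultimately show ?thesis using LIMSEQ_unique by fastforce
  qed
  have "T = corner_op s l"
  proof
    fix z
    show "T z = corner_op s l z"
    proof (cases "z \<in> bcarrier (twisted_fibre \<beta> s)")
      case True
      then have "T z \<in> bcarrier (twisted_fibre \<beta> s)" using TE by blast
      then have "T z = (s, l * snd z)"
        using True snd_T[of "snd z"] by (auto simp: mem_fibre prod_eq_iff) (metis prod.collapse)
      then show ?thesis using corner_op_apply[OF True] by simp
    next
      case False
      then show ?thesis using PiE_arb[OF TE False] by (simp add: corner_op_def)
    qed
  qed
  with lc show "T \<in> corner_op s ` corner s" by blast
next
  fix T assume "T \<in> corner_op s ` corner s"
  then obtain d where d: "d \<in> corner s" and T: "T = corner_op s d" by blast
  have "T \<in> adjointable (twisted_fibre \<beta> s)"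
    unfolding adjointable_def T mem_Collect_eq
    using corner_op_closed[OF d] corner_op_closed[OF corner_closed(4)[OF d]]
      is_adjoint_corner_op[OF d corner_closed(4)[OF d]] by blast
  moreover have "\<exists>S\<in>finite_rank (twisted_fibre \<beta> s). \<forall>z\<in>bcarrier (twisted_fibre \<beta> s).
      norm (snd (T z) - snd (S z)) \<le> e * norm (snd z)" if e: "e > 0" for e
  proof -
    have "\<forall>\<^sub>F i in F. dist (d * star (\<beta> s (u i))) d < e"
      using tendstoD[OF corner_limit[OF d] e] .
    from eventually_happens'[OF F this] obtain i where i: "dist (d * star (\<beta> s (u i))) d < e" by blast
    let ?b = "d * star (\<beta> s (u i))"
    have b: "?b \<in> corner s" by (intro mult_star_corner corner_p(1)[OF d]) simp
    have "op_add (twisted_fibre \<beta> s) (\<lambda>z\<in>bcarrier (twisted_fibre \<beta> s). bzero (twisted_fibre \<beta> s))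
        (rank_one (twisted_fibre \<beta> s) (s, d) (s, \<beta> s (u i))) \<in> finite_rank (twisted_fibre \<beta> s)"
      by (rule finite_rank.add[OF finite_rank.zero])
        (simp_all add: mem_fibre corner_p(1)[OF d])
    moreover have "op_add (twisted_fibre \<beta> s) (\<lambda>z\<in>bcarrier (twisted_fibre \<beta> s). bzero (twisted_fibre \<beta> s))
        (rank_one (twisted_fibre \<beta> s) (s, d) (s, \<beta> s (u i))) = corner_op s ?b"
      unfolding rank_one_fibre[OF corner_p(1)[OF d] p_beta]
      by (auto simp: op_add_def corner_op_def)
    ultimately have fr: "corner_op s ?b \<in> finite_rank (twisted_fibre \<beta> s)" by simp
    have "norm (snd (T z) - snd (corner_op s ?b z)) \<le> e * norm (snd z)"
      if z: "z \<in> bcarrier (twisted_fibre \<beta> s)" for z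
    proof -
      have "norm ((d - ?b) * snd z) \<le> norm (d - ?b) * norm (snd z)" by (rule norm_mult_ineq)
      also have "\<dots> \<le> e * norm (snd z)"
        using i by (intro mult_right_mono) (auto simp: dist_norm norm_minus_commute)
      finally show ?thesis by (simp add: T corner_op_apply[OF z] left_diff_distrib)
    qed
    with fr show ?thesis by blast
  qed
  ultimately show "T \<in> compacts (twisted_fibre \<beta> s)"
    by (simp add: compacts_def)
qed

text \<open>This evaluates the definite description. The assumptions on \<open>k\<close> give
  existence; a competing map has the same values on rank one operators, and contractivity on the
  corner extends the agreement to all compact operators.\<close>

lemma compacts_hom_corner:
  fixes k :: "'a \<Rightarrow> 'b::cstar_algebra"
  assumes add: "\<And>d e. d \<in> corner s \<Longrightarrow> e \<in> corner s \<Longrightarrow> k (d + e) = k d + k e"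
    and scale: "\<And>c d. d \<in> corner s \<Longrightarrow> k (c *\<^sub>C d) = c *\<^sub>C k d"
    and mult: "\<And>d e. d \<in> corner s \<Longrightarrow> e \<in> corner s \<Longrightarrow> k (d * e) = k d * k e"
    and star: "\<And>d. d \<in> corner s \<Longrightarrow> k (star d) = star (k d)"
    and rank_one: "\<And>x y. lmul (p s) x = x \<Longrightarrow> lmul (p s) y = y \<Longrightarrow>
      k (x * star y) = \<psi> (s, x) * star (\<psi> (s, y))"
    and d: "d \<in> corner s"
  shows "compacts_hom (twisted_fibre \<beta> s) \<psi> (corner_op s d) = k d"
proof -
  let ?E = "twisted_fibre \<beta> s" and ?T = "corner_op s"
  let ?R = "\<lambda>\<kappa>. \<kappa> \<in> extensional (compacts ?E) \<and>
     (\<forall>T\<in>compacts ?E. \<forall>S\<in>compacts ?E. \<kappa> (op_add ?E T S) = \<kappa> T + \<kappa> S \<and>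
        \<kappa> (compose (bcarrier ?E) T S) = \<kappa> T * \<kappa> S \<and> (is_adjoint ?E T S \<longrightarrow> \<kappa> S = star (\<kappa> T))) \<and>
     (\<forall>c. \<forall>T\<in>compacts ?E. \<kappa> (op_scale ?E c T) = c *\<^sub>C \<kappa> T) \<and>
     (\<forall>x\<in>bcarrier ?E. \<forall>y\<in>bcarrier ?E. \<kappa> (rank_one ?E x y) = \<psi> x * star (\<psi> y))"
  \<comment> \<open>\<open>k\<close> is transported along the injective map
    \<open>corner_op s\<close>; the restriction gives the value \<open>undefined\<close> off the
    compact operators that the description demands.\<close>
  define \<kappa> where "\<kappa> = (\<lambda>T\<in>?T ` corner s. k (the_inv_into (corner s) ?T T))"
  have inj: "inj_on ?T (corner s)" by (rule inj_onI) (rule corner_op_inj)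
  have \<kappa>: "\<kappa> (?T d) = k d" if "d \<in> corner s" for d
    using that by (simp add: \<kappa>_def the_inv_into_f_f[OF inj])
  have fibreE: "\<exists>x. z = (s, x) \<and> lmul (p s) x = x" if "z \<in> bcarrier ?E" for z
    using that by (auto simp: mem_fibre prod_eq_iff)
  have "?R \<kappa>"
    unfolding compacts_fibre ball_simps(9)
  proof (intro conjI ballI allI)
    show "\<kappa> \<in> extensional (?T ` corner s)" by (simp add: \<kappa>_def)
  next
    fix x y assume "x \<in> bcarrier ?E" "y \<in> bcarrier ?E"
    then obtain a b where "x = (s, a)" "lmul (p s) a = a" "y = (s, b)" "lmul (p s) b = b"
      using fibreE by meson
    then show "\<kappa> (rank_one ?E x y) = \<psi> x * star (\<psi> y)"
      by (simp add: rank_one_fibre \<kappa> mult_star_corner rank_one)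
  qed (auto simp: op_add_corner_op compose_corner_op op_scale_corner_op is_adjoint_corner_op
      corner_closed \<kappa> add mult star scale)
  moreover have "\<kappa>' = \<kappa>" if R: "?R \<kappa>'" for \<kappa>'
  proof -
    have ops: "\<kappa>' (?T (d + e)) = \<kappa>' (?T d) + \<kappa>' (?T e)" "\<kappa>' (?T (d * e)) = \<kappa>' (?T d) * \<kappa>' (?T e)"
      "\<kappa>' (?T (star d)) = star (\<kappa>' (?T d))" "\<kappa>' (?T (c *\<^sub>C d)) = c *\<^sub>C \<kappa>' (?T d)"
      if "d \<in> corner s" "e \<in> corner s" for c d e
      using R that unfolding compacts_fibre ball_simps(9)
      by (metis op_add_corner_op, metis compose_corner_op,
          metis is_adjoint_corner_op corner_closed(4), metis op_scale_corner_op)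
    have R1: "\<kappa>' (?T (x * star y)) = \<psi> (s, x) * star (\<psi> (s, y))"
      if "lmul (p s) x = x" "lmul (p s) y = y" for x y
    proof -
      have "(s, x) \<in> bcarrier ?E" "(s, y) \<in> bcarrier ?E"
        using that by (simp_all add: mem_fibre)
      then show ?thesis using R rank_one_fibre[OF that] by metis
    qed
    \<comment> \<open>Used for \<open>k\<close> and for the competing map: both are continuous along
      the net of \<open>corner_limit\<close>, and the rank one condition prescribes both on its
      members.\<close>
    have lim: "((\<lambda>i. f (d * star (\<beta> s (u i)))) \<longlongrightarrow> f d) F"
      if d: "d \<in> corner s" and f: "\<And>d e. d \<in> corner s \<Longrightarrow> e \<in> corner s \<Longrightarrow> f (d + e) = f d + f e"
        "\<And>d e. d \<in> corner s \<Longrightarrow> e \<in> corner s \<Longrightarrow> f (d * e) = f d * f e"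
        "\<And>d. d \<in> corner s \<Longrightarrow> f (star d) = star (f d)"
        "\<And>c d. d \<in> corner s \<Longrightarrow> f (c *\<^sub>C d) = c *\<^sub>C f d" for f :: "'a \<Rightarrow> 'b" and d
    proof -
      have b: "d * star (\<beta> s (u i)) \<in> corner s" for i
        by (intro mult_star_corner corner_p(1)[OF d]) simp
      have bd: "norm (f (d * star (\<beta> s (u i))) - f d) \<le> norm (d * star (\<beta> s (u i)) - d)" for i
      proof -
        have e: "d * star (\<beta> s (u i)) - d = d * star (\<beta> s (u i)) + (-1) *\<^sub>C d"
          by (simp add: scaleC_minus1)
        have "f (d * star (\<beta> s (u i)) - d) = f (d * star (\<beta> s (u i))) - f d"
          unfolding e using b d by (simp add: f corner_closed) (simp add: scaleC_minus1)
        moreover have "d * star (\<beta> s (u i)) - d \<in> corner s"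
          unfolding e using b d by (simp add: corner_closed)
        then have "norm (f (d * star (\<beta> s (u i)) - d)) \<le> norm (d * star (\<beta> s (u i)) - d)"
          by (rule star_hom_on_contractive[OF corner_subalgebra f(1,4,2,3), rotated -1])
        ultimately show ?thesis by simp
      qed
      have "((\<lambda>i. norm (d * star (\<beta> s (u i)) - d)) \<longlongrightarrow> 0) F"
        by (intro tendsto_norm_zero LIM_zero corner_limit d)
      then have "((\<lambda>i. f (d * star (\<beta> s (u i))) - f d) \<longlongrightarrow> 0) F"
        by (rule tendsto_norm_zero_cancel[OF tendsto_sandwich[OF _ _ tendsto_const], rotated 2])
          (simp_all add: bd)
      then show ?thesis by (rule LIM_zero_cancel)
    qed
    have eq: "\<kappa>' (?T d) = k d" if d: "d \<in> corner s" for d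
    proof (rule tendsto_unique[OF F])
      show "((\<lambda>i. k (d * star (\<beta> s (u i)))) \<longlongrightarrow> k d) F"
        using d by (intro lim add mult star scale)
      have "((\<lambda>i. \<kappa>' (?T (d * star (\<beta> s (u i))))) \<longlongrightarrow> \<kappa>' (?T d)) F"
        using d by (intro lim[where f="\<lambda>d. \<kappa>' (?T d)"] ops)
      then show "((\<lambda>i. k (d * star (\<beta> s (u i)))) \<longlongrightarrow> \<kappa>' (?T d)) F"
        by (simp add: R1 rank_one corner_p(1)[OF d])
    qed
    show "\<kappa>' = \<kappa>"
    proof
      fix T
      show "\<kappa>' T = \<kappa> T"
      proof (cases "T \<in> ?T ` corner s")
        case True
        then show ?thesis using eq \<kappa> by auto
      next
        case False
        then show ?thesis
          using R unfolding compacts_fibre by (simp add: extensional_def \<kappa>_def)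
      qed
    qed
  qed
  ultimately have "compacts_hom ?E \<psi> = \<kappa>" unfolding compacts_hom_def by (rule the_equality)
  then show ?thesis using \<kappa>[OF d] by simp
qed

lemma left_op_fibre: "left_op (twisted_fibre \<beta> s) a = corner_op s (\<beta> s a)"
  by (simp add: left_op_def corner_op_def)

lemma left_op_compact: "left_op (twisted_fibre \<beta> s) a \<in> compacts (twisted_fibre \<beta> s)"
  unfolding compacts_fibre left_op_fibre using beta_corner by blast

text \<open>Every left action is compact, so the guard in the covariance condition drops
  out.\<close>

lemma cuntz_pimsner_covariant_iff:
  "cuntz_pimsner_covariant X \<psi> \<longleftrightarrow>
     (\<forall>s a. compacts_hom (twisted_fibre \<beta> s) \<psi> (corner_op s (\<beta> s a)) = \<psi> (1, a))"
  unfolding cuntz_pimsner_covariant_def twisted_product_system_simps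
  using left_op_compact by (simp add: left_op_fibre) (metis opp.sel)

end

section \<open>Toeplitz representations and covariant pairs\<close>

lemma closure_span_add:
  fixes G :: "'a::real_normed_vector set"
  assumes "x \<in> closure (span G)" "y \<in> closure (span G)"
  shows "x + y \<in> closure (span G)"
proof -
  obtain f g where "\<And>n. f n \<in> span G" "f \<longlonglongrightarrow> x" "\<And>n. g n \<in> span G" "g \<longlonglongrightarrow> y"
    using assms unfolding closure_sequential by blast
  then show ?thesis
    unfolding closure_sequential
    by (intro exI[of _ "\<lambda>n. f n + g n"] conjI allI span_add tendsto_add)
qed

lemma closure_span_image:
  assumes f: "bounded_linear f" and sub: "f ` G \<subseteq> G" and x: "x \<in> closure (span G)"
  shows "f x \<in> closure (span G)"
proof -
  have "f ` span G = span (f ` G)"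
    using f by (simp add: bounded_linear.linear linear_span_image)
  also have "\<dots> \<subseteq> span G" using sub by (rule span_mono)
  finally have "closure (f ` span G) \<subseteq> closure (span G)" by (rule closure_mono)
  then show ?thesis using closure_bounded_linear_image_subset[OF f, of "span G"] x by blast
qed

lemma subspace_closure_span:
  fixes G :: "'a::real_normed_vector set"
  shows "subspace (closure (span G))"
  unfolding subspace_def
proof (intro conjI ballI allI)
  show "0 \<in> closure (span G)" by (meson closure_subset span_zero subsetD)
  show "c *\<^sub>R x \<in> closure (span G)" if "x \<in> closure (span G)" for c x
  proof -
    have "(*\<^sub>R) c ` span G \<subseteq> span G" by (auto intro: span_scale)
    then show ?thesis
      using closure_span_image[OF bounded_linear_scaleR_right, of c "span G" x] that
      by (simp add: span_span)
  qed
qed (rule closure_span_add)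

text \<open>For fixed \<open>h\<close>, the map sending \<open>b\<close> to
  \<open>\<sigma> b \<cdot> h\<close> is bounded and linear. It takes the dense span of the products
  \<open>j a * b\<close> into the span of the vectors \<open>\<sigma> (j a) \<cdot> k\<close>, so
  every \<open>\<sigma> b \<cdot> h\<close> lies in the closure of the latter.\<close>

lemma nondegenerate_rep_comp:
  assumes \<sigma>: "nondegenerate_rep \<sigma>" and j: "nondegenerate_hom j"
  shows "nondegenerate_rep (\<sigma> \<circ> j)"
proof -
  have hom: "star_hom \<sigma>" using \<sigma> by (simp add: nondegenerate_rep_def)
  let ?M = "closure (span {(\<sigma> \<circ> j) a \<cdot> h |a h. True})"
  have "closed ?M" by simp
  have "\<sigma> b \<cdot> h \<in> ?M" for b h
  proof -
    have lin: "bounded_linear (\<lambda>b. \<sigma> b \<cdot> h)"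
      by (rule bounded_linear_compose[OF bounded_linear_bop_apply star_hom_bounded_linear[OF hom]])
    have "(\<lambda>b. \<sigma> b \<cdot> h) ` span {j a * b |a b. True} \<subseteq> span {(\<sigma> \<circ> j) a \<cdot> h |a h. True}"
      unfolding linear_span_image[OF bounded_linear.linear[OF lin], symmetric]
      by (rule span_mono) (force simp: star_homD[OF hom] bop_times_apply)
    then have "closure ((\<lambda>b. \<sigma> b \<cdot> h) ` span {j a * b |a b. True}) \<subseteq> ?M" by (rule closure_mono)
    then have "(\<lambda>b. \<sigma> b \<cdot> h) ` closure (span {j a * b |a b. True}) \<subseteq> ?M"
      using closure_bounded_linear_image_subset[OF lin] by blast
    then show ?thesis using j by (auto simp: nondegenerate_hom_def)
  qed
  then have "span {\<sigma> a \<cdot> h |a h. True} \<subseteq> ?M"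
    by (intro span_minimal subspace_closure_span) auto
  then have "closure (span {\<sigma> a \<cdot> h |a h. True}) \<subseteq> ?M" by (rule closure_minimal) simp
  moreover have "star_hom (\<sigma> \<circ> j)" using hom j by (simp add: star_hom_comp nondegenerate_hom_def)
  ultimately show ?thesis using \<sigma> by (auto simp: nondegenerate_rep_def)
qed

lemma nondegenerate_rep_factor:
  assumes "star_hom \<rho>" "nondegenerate_rep (\<rho> \<circ> j)"
  shows "nondegenerate_rep \<rho>"
proof -
  have "closure (span {(\<rho> \<circ> j) a \<cdot> h |a h. True}) \<subseteq> closure (span {\<rho> a \<cdot> h |a h. True})"
    by (intro closure_mono span_mono) auto
  then show ?thesis using assms by (auto simp: nondegenerate_rep_def)
qed

section \<open>From covariant pairs to Toeplitz representations\<close>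

context twisted_dynamics
begin

text \<open>The net \<open>\<pi> (\<beta> s (u i) * x)\<close> is computed twice: by
  \<open>p_limit\<close>, and by covariance, which turns it into
  \<open>V s * \<pi> (u i) * star (V s) * \<pi> x\<close> with \<open>\<pi> (u i)\<close> tending
  strongly to 1.\<close>

lemma toeplitz_covariant_rep_range:
  assumes "toeplitz_covariant_rep \<beta> \<omega> \<pi> V"
  shows "V s * (star (V s) * \<pi> x) = \<pi> (lmul (p s) x)"
proof (rule bop_eqI)
  fix h
  have nd: "nondegenerate_rep \<pi>" and cov: "\<And>a. \<pi> (\<beta> s a) = V s * \<pi> a * star (V s)"
    using assms by (auto simp: toeplitz_covariant_rep_def)
  have hom: "star_hom \<pi>" using nd by (simp add: nondegenerate_rep_def)
  have 1: "((\<lambda>i. \<pi> (\<beta> s (u i) * x) \<cdot> h) \<longlongrightarrow> \<pi> (lmul (p s) x) \<cdot> h) F"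
    by (intro tendsto_bop_apply bounded_linear.tendsto[OF star_hom_bounded_linear[OF hom]] p_limit)
  have "((\<lambda>i. V s \<cdot> (\<pi> (u i) \<cdot> (star (V s) \<cdot> (\<pi> x \<cdot> h)))) \<longlongrightarrow> V s \<cdot> (star (V s) \<cdot> (\<pi> x \<cdot> h))) F"
    by (intro bounded_linear.tendsto[OF bop_bounded_linear] approximate_unit_rep[OF nd u])
  then have 2: "((\<lambda>i. \<pi> (\<beta> s (u i) * x) \<cdot> h) \<longlongrightarrow> (V s * (star (V s) * \<pi> x)) \<cdot> h) F"
    by (simp add: star_homD[OF hom] cov bop_times_apply)
  show "(V s * (star (V s) * \<pi> x)) \<cdot> h = \<pi> (lmul (p s) x) \<cdot> h"
    by (rule tendsto_unique[OF F 2 1])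
qed

text \<open>An \<omega>-representation need not be unital by definition. The range formula with
  \<open>p 1\<close> acting as the identity gives \<open>V 1 * star (V 1) = 1\<close>, and
  \<open>\<omega> 1 1 = 1\<close> makes \<open>V 1\<close> idempotent; an idempotent with a right
  inverse is 1.\<close>

lemma toeplitz_covariant_rep_one:
  assumes cov: "toeplitz_covariant_rep \<beta> \<omega> \<pi> V"
  shows "V 1 = 1"
proof -
  have nd: "nondegenerate_rep \<pi>" and om: "omega_rep \<omega> V"
    using cov by (auto simp: toeplitz_covariant_rep_def)
  have VV: "V 1 * star (V 1) = 1"
    by (rule nondegenerate_rep_eqI[OF nd])
      (simp add: mult.assoc toeplitz_covariant_rep_range[OF cov])
  have "V 1 * V 1 = V 1" using om by (simp add: omega_rep_def omega_one)
  then have "V 1 * (V 1 * star (V 1)) = V 1 * star (V 1)" by (metis mult.assoc)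
  then show ?thesis by (simp add: VV)
qed

lemma toeplitz_rep_of_covariant:
  assumes cov: "toeplitz_covariant_rep \<beta> \<omega> \<pi> V"
  shows "toeplitz_rep X (\<lambda>z. star (V (fst z)) * \<pi> (snd z))"
proof -
  have hom: "star_hom \<pi>" and om: "\<And>s t. V s * V t = \<omega> s t *\<^sub>C V (s * t)"
    and pi: "\<And>s. V s * star (V s) * V s = V s"
    and c: "\<And>s a. \<pi> (\<beta> s a) = V s * \<pi> a * star (V s)"
    and comm: "\<And>s a. star (V s) * V s * \<pi> a = \<pi> a * star (V s) * V s"
    using cov by (auto simp: toeplitz_covariant_rep_def nondegenerate_rep_def omega_rep_def
        partial_isometry_def)
  note h = star_homD[OF hom]
  have V1: "V 1 = 1" by (rule toeplitz_covariant_rep_one[OF cov])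
  \<comment> \<open>Moving \<open>\<pi> x\<close> past \<open>star (V t)\<close> is what makes the
    map multiplicative; it combines the partial isometry identity with the commutation of
    \<open>\<pi> x\<close> and \<open>star (V t) * V t\<close>.\<close>
  have move: "\<pi> x * star (V t) = star (V t) * \<pi> (\<beta> t x)" for x t
  proof -
    have "star (V t * star (V t) * V t) = star (V t)" by (simp add: pi)
    then have "star (V t) * V t * star (V t) = star (V t)"
      by (simp add: star_mult star_star mult.assoc)
    then have "\<pi> x * star (V t) = \<pi> x * star (V t) * V t * star (V t)" by (metis mult.assoc)
    then show ?thesis by (simp add: c flip: comm) (simp add: mult.assoc)
  qed
  \<comment> \<open>Adjoints reverse products and conjugate scalars: this is the source of the
    opposite semigroup and of \<open>cnj (\<omega> t s)\<close> in the product system.\<close>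
  have om': "star (V s) * star (V t) = cnj (\<omega> t s) *\<^sub>C star (V (t * s))" for s t
    by (metis om star_mult star_scaleC)
  have "star (star (V s) * \<pi> x) * (star (V s) * \<pi> y) = \<pi> (star x * y)"
    if "lmul (p s) y = y" for s x y
    using toeplitz_covariant_rep_range[OF cov, of s y] that
    by (simp add: star_mult star_star h mult.assoc)
  moreover have "star (V (t * s)) * \<pi> (cnj (\<omega> t s) *\<^sub>C (\<beta> t x * y)) =
      star (V s) * \<pi> x * (star (V t) * \<pi> y)" for s t x y
  proof -
    have "star (V s) * \<pi> x * (star (V t) * \<pi> y) = star (V s) * (\<pi> x * star (V t)) * \<pi> y"
      by (simp add: mult.assoc)
    also have "\<dots> = star (V s) * star (V t) * (\<pi> (\<beta> t x) * \<pi> y)"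
      by (simp add: move mult.assoc)
    finally show ?thesis by (simp add: om' h scaleC_mult_left scaleC_mult_right)
  qed
  ultimately show ?thesis
    unfolding toeplitz_rep_iff
    using hom by (auto simp: V1 star_one h distrib_left scaleC_mult_right)
qed

lemma toeplitz_covariant_rep_of_covariant:
  "covariant_rep \<beta> \<omega> \<pi> V \<Longrightarrow> toeplitz_covariant_rep \<beta> \<omega> \<pi> V"
  by (auto simp: covariant_rep_def toeplitz_covariant_rep_def isometry_def partial_isometry_def mult.assoc)

text \<open>Compression of \<open>\<pi> d\<close> by \<open>V s\<close> is multiplicative on the
  corner because \<open>V s * star (V s)\<close> fixes \<open>\<pi> e\<close> there. At
  \<open>\<beta> s a\<close> it gives \<open>star (V s) * V s * \<pi> a * star (V s) * V s\<close>,
  which collapses for an isometry.\<close>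

lemma cuntz_pimsner_covariant_of_covariant:
  assumes c: "covariant_rep \<beta> \<omega> \<pi> V"
  shows "cuntz_pimsner_covariant X (\<lambda>z. star (V (fst z)) * \<pi> (snd z))"
  unfolding cuntz_pimsner_covariant_iff
proof (intro allI)
  fix s a
  note cov = toeplitz_covariant_rep_of_covariant[OF c]
  have hom: "star_hom \<pi>" and iso: "star (V s) * V s = 1"
    and ca: "\<pi> (\<beta> s a) = V s * \<pi> a * star (V s)"
    using c by (auto simp: covariant_rep_def nondegenerate_rep_def isometry_def)
  note h = star_homD[OF hom]
  have iso': "star (V s) * (V s * x) = x" for x by (metis iso mult.assoc mult.left_neutral)
  have "compacts_hom (twisted_fibre \<beta> s) (\<lambda>z. star (V (fst z)) * \<pi> (snd z)) (corner_op s (\<beta> s a)) =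
      star (V s) * \<pi> (\<beta> s a) * V s"
  proof (rule compacts_hom_corner[where k="\<lambda>d. star (V s) * \<pi> d * V s"])
    show "star (V s) * \<pi> (d * e) * V s = star (V s) * \<pi> d * V s * (star (V s) * \<pi> e * V s)"
      if "e \<in> corner s" for d e
    proof -
      have "V s * (star (V s) * \<pi> e) = \<pi> e"
        by (simp add: toeplitz_covariant_rep_range[OF cov] corner_p(1)[OF that])
      then have "star (V s) * \<pi> d * (V s * (star (V s) * \<pi> e)) * V s = star (V s) * \<pi> d * \<pi> e * V s"
        by simp
      then show ?thesis by (simp add: h mult.assoc)
    qed
  qed (simp_all add: h star_mult star_star mult.assoc distrib_left distrib_right
      scaleC_mult_left scaleC_mult_right beta_corner)
  also have "\<dots> = \<pi> a" by (simp add: ca mult.assoc iso iso')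
  finally show "compacts_hom (twisted_fibre \<beta> s) (\<lambda>z. star (V (fst z)) * \<pi> (snd z))
      (corner_op s (\<beta> s a)) = star (V (fst (1, a))) * \<pi> (snd (1, a))"
    by (simp add: toeplitz_covariant_rep_one[OF cov] star_one)
qed

end

section \<open>From generating Toeplitz representations to covariant pairs of multipliers\<close>

locale generating_toeplitz_rep = twisted_dynamics \<beta> \<omega> F u
  for \<beta> :: "'p::{monoid_mult, countable} \<Rightarrow> 'a::cstar_algebra \<Rightarrow> 'a"
    and \<omega> and F :: "'i filter" and u :: "'i \<Rightarrow> 'a" +
  fixes \<psi> :: "'p \<times> 'a \<Rightarrow> 'b::cstar_algebra"
  assumes rep: "toeplitz_rep X \<psi>" and gen: "cstar_generated (\<psi> ` total X) = UNIV"
begin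

abbreviation "jA \<equiv> canonical_A \<psi>"

abbreviation "jP \<equiv> canonical_P \<beta> F u \<psi>"

text \<open>\<open>\<psi>\<close> is controlled only on pairs with \<open>lmul (p s) x = x\<close>.
  Inserting the projection gives a bounded linear map on the whole algebra, so that limits and
  products need no membership conditions.\<close>

definition J :: "'p \<Rightarrow> 'a \<Rightarrow> 'b" where
  "J s x = \<psi> (s, lmul (p s) x)"

lemma psi:
  "lmul (p s) x = x \<Longrightarrow> lmul (p s) y = y \<Longrightarrow> \<psi> (s, x + y) = \<psi> (s, x) + \<psi> (s, y)"
  "lmul (p s) x = x \<Longrightarrow> lmul (p s) y = y \<Longrightarrow> star (\<psi> (s, x)) * \<psi> (s, y) = jA (star x * y)"
  "lmul (p s) x = x \<Longrightarrow> \<psi> (s, c *\<^sub>C x) = c *\<^sub>C \<psi> (s, x)"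
  "lmul (p s) x = x \<Longrightarrow> lmul (p t) y = y \<Longrightarrow>
     \<psi> (s, x) * \<psi> (t, y) = \<psi> (t * s, cnj (\<omega> t s) *\<^sub>C (\<beta> t x * y))"
  using rep unfolding toeplitz_rep_iff canonical_A_def by auto

lemma hom_jA: "star_hom jA"
proof -
  have "jA = (\<lambda>a. \<psi> (1, a))" by (rule ext) (simp add: canonical_A_def)
  then show ?thesis using rep unfolding toeplitz_rep_iff by simp
qed

lemmas jA = star_homD[OF hom_jA]

lemma psi_J: "lmul (p s) x = x \<Longrightarrow> \<psi> (s, x) = J s x"
  by (simp add: J_def)

lemma jA_J_one: "jA a = J 1 a"
  by (simp add: J_def canonical_A_def)

lemma J_p [simp]: "J s (lmul (p s) x) = J s x"
  by (simp add: J_def)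

lemma J_inner: "star (J s x) * J s y = jA (star x * lmul (p s) y)"
proof -
  have "star (lmul (p s) x) * lmul (p s) y = rmul (star x) (p s) * lmul (p s) y"
    by (simp add: rmul_p star_star)
  then show ?thesis by (simp add: J_def psi(2) rmul_lmul)
qed

lemma J_linear: "bounded_linear (J s)"
proof (rule bounded_linear_intro[where K=1])
  show "J s (x + y) = J s x + J s y" for x y by (simp add: J_def lmul_add psi(1))
  show "J s (r *\<^sub>R x) = r *\<^sub>R J s x" for r x
    by (simp add: J_def lmul_scaleC psi(3) flip: scaleC_of_real)
  show "norm (J s x) \<le> norm x * 1" for x
  proof -
    have "(norm (J s x))\<^sup>2 = norm (jA (star x * lmul (p s) x))"
      by (simp add: J_inner flip: norm_star_mult)
    also have "\<dots> \<le> norm (star x * lmul (p s) x)" by (rule star_hom_contractive[OF hom_jA])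
    also have "\<dots> \<le> norm (star x) * norm (lmul (p s) x)" by (rule norm_mult_ineq)
    also have "\<dots> \<le> norm x * norm x" by (simp add: norm_star mult_left_mono norm_p)
    finally have "(norm (J s x))\<^sup>2 \<le> (norm x)\<^sup>2" by (simp only: power2_eq_square)
    then have "norm (J s x) \<le> norm x" by (rule power2_le_imp_le) simp
    then show ?thesis by simp
  qed
qed

lemmas lim_J = bounded_linear.tendsto[OF J_linear]

lemma J_mult: "J s x * J t y = cnj (\<omega> t s) *\<^sub>C J (t * s) (\<beta> t (lmul (p s) x) * y)"
  by (simp add: J_def psi(4)) (simp add: lmul_mult p_beta_p psi(3))

lemma jA_mult_J: "jA a * J s x = J s (\<beta> s a * x)"
  by (simp add: jA_J_one J_mult omega_one)

lemma J_mult_jA: "J s x * jA a = J s (x * a)"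
proof -
  have "J s (lmul (p s) x * a) = J s (x * a)" by (simp add: J_def lmul_mult)
  then show ?thesis by (simp add: jA_J_one J_mult omega_one beta_one)
qed

text \<open>Multiplication by \<open>jA (u i)\<close> on the left approximates \<open>J s x\<close>
  because \<open>\<beta> s (u i) * x\<close> tends to \<open>lmul (p s) x\<close>, and approximates
  its adjoint because \<open>x * u i\<close> tends to \<open>x\<close>. So the closed span of the
  \<open>jA a * b\<close> contains the generators and their adjoints.\<close>

lemma nondegenerate_jA: "nondegenerate_hom jA"
proof -
  define G where "G = {jA a * b |a b. True}"
  define M where "M = closure (span G)"
  \<comment> \<open>\<open>M\<close> is a closed right ideal with no evident closure under
    \<open>star\<close>; its intersection with its adjoint is a C*-subalgebra.\<close>
  let ?N = "M \<inter> star -` M"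
  have G_M: "jA a * b \<in> M" for a b
    unfolding M_def by (rule subsetD[OF closure_subset span_base]) (auto simp: G_def)
  have M_add: "x + y \<in> M" if "x \<in> M" "y \<in> M" for x y
    using that unfolding M_def by (rule closure_span_add)
  have M_mult: "x * c \<in> M" if "x \<in> M" for x c
    using that unfolding M_def
    by (rule closure_span_image[OF bounded_linear_mult_left, rotated]) (clarsimp simp: G_def mult.assoc, blast)
  have M_scaleC: "c *\<^sub>C x \<in> M" if "x \<in> M" for x c
    using that unfolding M_def
    by (rule closure_span_image[OF bounded_linear_scaleC, rotated]) (force simp: G_def simp flip: scaleC_mult_right)
  have "closed M" "0 \<in> M" unfolding M_def by (simp, meson closure_subset span_zero subsetD)
  have M_lim: "l \<in> M" if "\<And>i. f i \<in> M" "(f \<longlongrightarrow> l) F" for f l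
    by (rule Lim_in_closed_set[OF \<open>closed M\<close> always_eventually F that(2)]) (simp add: that(1))
  from \<open>closed M\<close> have "closed ?N"
    by (intro closed_Int closed_vimage linear_continuous_on bounded_linear_star)
  with \<open>0 \<in> M\<close> have "cstar_subalgebra ?N"
    unfolding cstar_subalgebra_def
    by (auto simp: star_add star_mult star_scaleC star_star intro: M_add M_mult M_scaleC)
  moreover have "\<psi> ` total X \<subseteq> ?N"
  proof clarify
    fix s x assume "(s, x) \<in> total X"
    then have x: "lmul (p s) x = x" by (simp add: mem_total)
    have "jA (u i) * J s x \<in> M" for i by (rule G_M)
    moreover have "((\<lambda>i. jA (u i) * J s x) \<longlongrightarrow> J s (lmul (p s) x)) F"
      unfolding jA_mult_J by (intro lim_J p_limit)
    ultimately have "J s (lmul (p s) x) \<in> M" by (rule M_lim)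
    then have 1: "J s x \<in> M" by simp
    have "jA (u i) * star (J s x) \<in> M" for i by (rule G_M)
    moreover have "((\<lambda>i. jA (u i) * star (J s x)) \<longlongrightarrow> star (J s x)) F"
    proof -
      have "((\<lambda>i. star (J s x * jA (u i))) \<longlongrightarrow> star (J s x)) F"
        unfolding J_mult_jA
        by (intro lim_J bounded_linear.tendsto[OF bounded_linear_star] approximate_identityD(5)[OF u])
      then show ?thesis
        by (simp add: star_mult approximate_identityD(3)[OF u] flip: jA(4))
    qed
    ultimately have "star (J s x) \<in> M" by (rule M_lim)
    with 1 show "\<psi> (s, x) \<in> ?N" by (simp add: psi_J[OF x])
  qed
  ultimately have "cstar_generated (\<psi> ` total X) \<subseteq> ?N"
    unfolding cstar_generated_def by (intro hull_minimal)
  then have "M = UNIV" using gen by auto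
  then show ?thesis using hom_jA by (simp add: nondegenerate_hom_def M_def G_def)
qed

lemmas eqI_left = nondegenerate_hom_eqI_left[OF nondegenerate_jA]
lemmas eqI_right = nondegenerate_hom_eqI_right[OF nondegenerate_jA]

text \<open>The net \<open>v i = J s (\<beta> s (u i))\<close> is bounded by 1, and
  \<open>v i\<close> and \<open>star (v i)\<close> both converge after right multiplication by
  \<open>jA a\<close>, by \<open>J_mult_jA\<close> and \<open>jA_mult_J\<close>. The limit of
  \<open>star (v i)\<close> is the left action of the multiplier; that of \<open>v i\<close> gives
  the right action after taking adjoints.\<close>

lemma jP_limits:
  shows jP_lmul_limit: "((\<lambda>i. star (J s (\<beta> s (u i))) * b) \<longlongrightarrow> lmul (jP s) b) F"
    and jP_rmul_limit: "((\<lambda>i. b * star (J s (\<beta> s (u i)))) \<longlongrightarrow> rmul b (jP s)) F"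
proof -
  define v where "v i = J s (\<beta> s (u i))" for i
  have dense: "closure (span {jA a * b |a b. True}) = UNIV"
    using nondegenerate_jA by (simp add: nondegenerate_hom_def)
  have n1: "norm (v i) \<le> 1" for i
  proof -
    have "norm (v i) * norm (v i) = norm (star (v i) * v i)" by (simp add: norm_star_mult power2_eq_square)
    also have "\<dots> \<le> norm (star (\<beta> s (u i)) * \<beta> s (u i))"
      unfolding v_def J_inner using star_hom_contractive[OF hom_jA] by simp
    also have "\<dots> \<le> 1"
    proof -
      have "norm (\<beta> s (u i)) \<le> 1"
        using star_hom_contractive[OF hom_beta] approximate_identityD(2)[OF u] order_trans by blast
      then show ?thesis by (simp add: norm_star_mult power_le_one)
    qed
    finally show ?thesis by (metis abs_norm_cancel abs_square_le_1 power2_eq_square)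
  qed
  have bd: "norm (v i * x) \<le> 1 * norm x" "norm (star (v i) * x) \<le> 1 * norm x" for i x
    by (rule order_trans[OF norm_mult_ineq mult_right_mono]; simp add: n1 norm_star)+
  have "((\<lambda>i. v i * (jA a * b)) \<longlongrightarrow> J s a * b) F" for a b
  proof -
    have "((\<lambda>i. J s (\<beta> s (u i) * a) * b) \<longlongrightarrow> J s (lmul (p s) a) * b) F"
      by (intro tendsto_intros lim_J p_limit)
    then show ?thesis by (simp add: v_def flip: J_mult_jA mult.assoc)
  qed
  then obtain L' where L': "bounded_linear L'" "\<And>x. ((\<lambda>i. v i * x) \<longlongrightarrow> L' x) F"
    using bounded_limit_operator[of F "\<lambda>i x. v i * x" 1 "{jA a * b |a b. True}",
        OF F bounded_linear_mult_right bd(1) _ dense] by blast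
  have "((\<lambda>i. star (v i) * (jA a * b)) \<longlongrightarrow> star (J s (\<beta> s (star a))) * b) F" for a b
  proof -
    have "((\<lambda>i. star (J s (\<beta> s (star a * u i))) * b) \<longlongrightarrow> star (J s (\<beta> s (star a))) * b) F"
      by (intro tendsto_intros lim_J lim_beta bounded_linear.tendsto[OF bounded_linear_star]
          approximate_identityD(5)[OF u])
    moreover have "J s (\<beta> s (star a * u i)) = star (jA a) * v i" for i
      by (simp add: v_def beta(3) jA_mult_J flip: jA(4))
    ultimately show ?thesis by (simp add: star_mult star_star mult.assoc)
  qed
  then obtain L where L: "bounded_linear L" "\<And>x. ((\<lambda>i. star (v i) * x) \<longlongrightarrow> L x) F"
    using bounded_limit_operator[of F "\<lambda>i x. star (v i) * x" 1 "{jA a * b |a b. True}",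
        OF F bounded_linear_mult_right bd(2) _ dense] by blast
  define R where "R x = star (L' (star x))" for x
  have R_lin: "bounded_linear R"
    unfolding R_def
    by (intro bounded_linear_compose[OF bounded_linear_star]
        bounded_linear_compose[OF L'(1) bounded_linear_star])
  have R: "((\<lambda>i. x * star (v i)) \<longlongrightarrow> R x) F" for x
    using bounded_linear.tendsto[OF bounded_linear_star L'(2)[of "star x"]]
    by (simp add: R_def star_mult star_star)
  have RL: "R a * b = a * L b" for a b
  proof (rule tendsto_unique[OF F])
    show "((\<lambda>i. a * star (v i) * b) \<longlongrightarrow> R a * b) F" by (intro tendsto_intros R)
    show "((\<lambda>i. a * star (v i) * b) \<longlongrightarrow> a * L b) F"
      unfolding mult.assoc by (intro tendsto_intros L(2))
  qed
  note m = lmul_multiplier[OF L(1) R_lin RL] rmul_multiplier[OF L(1) R_lin RL]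
  have lim: "limitin strict_topology (\<lambda>i. mult_of (star (\<psi> (s, \<beta> s (u i))))) (multiplier L R) F"
    using L(2) R by (simp add: limitin_strict_iff mult_of_apply m v_def psi_J)
  have "jP s = multiplier L R"
    unfolding canonical_P_def strict_lim_def
    by (rule the_equality, rule lim, rule limitin_strict_unique[OF _ lim F])
  then show "((\<lambda>i. star (J s (\<beta> s (u i))) * b) \<longlongrightarrow> lmul (jP s) b) F"
    "((\<lambda>i. b * star (J s (\<beta> s (u i)))) \<longlongrightarrow> rmul b (jP s)) F"
    using L(2) R by (simp_all add: m v_def)
qed

lemma rmul_jA_jP: "rmul (jA a) (jP s) = star (J s (star a))"
proof (rule tendsto_unique[OF F jP_rmul_limit])
  have "((\<lambda>i. star (J s (\<beta> s (u i) * star a))) \<longlongrightarrow> star (J s (lmul (p s) (star a)))) F"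
    by (intro lim_J bounded_linear.tendsto[OF bounded_linear_star] p_limit)
  then show "((\<lambda>i. jA a * star (J s (\<beta> s (u i)))) \<longlongrightarrow> star (J s (star a))) F"
    by (simp add: star_mult star_star jA(4) flip: J_mult_jA)
qed

lemma star_jP_jA: "lmul (star (jP s)) (jA a) = J s a"
  by (simp add: lmul_star rmul_jA_jP star_star flip: jA(4))

lemma jP_J: "lmul (jP s) (J s x) = jA (lmul (p s) x)"
proof (rule tendsto_unique[OF F jP_lmul_limit])
  have "((\<lambda>i. jA (\<beta> s (u i) * x)) \<longlongrightarrow> jA (lmul (p s) x)) F"
    by (intro bounded_linear.tendsto[OF star_hom_bounded_linear[OF hom_jA]] p_limit)
  then show "((\<lambda>i. star (J s (\<beta> s (u i))) * J s x) \<longlongrightarrow> jA (lmul (p s) x)) F"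
    by (simp add: J_inner approximate_identityD(3)[OF u] flip: beta(4))
qed

text \<open>The products \<open>J t (\<beta> t (u i)) * J s y\<close> are evaluated by
  \<open>J_mult\<close> before the limit is taken. This is where the multiplier \<omega> enters the
  composition law of \<open>jP\<close>.\<close>

lemma star_jP_J: "lmul (star (jP t)) (J s y) = cnj (\<omega> s t) *\<^sub>C J (s * t) y"
proof (rule tendsto_unique[OF F])
  show "((\<lambda>i. J t (\<beta> t (u i)) * J s y) \<longlongrightarrow> lmul (star (jP t)) (J s y)) F"
    using bounded_linear.tendsto[OF bounded_linear_star jP_rmul_limit[of "star (J s y)" t]]
    by (simp add: star_mult star_star lmul_star)
  have "((\<lambda>i. cnj (\<omega> s t) *\<^sub>C J (s * t) (\<beta> (s * t) (u i) * y)) \<longlongrightarrow>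
      cnj (\<omega> s t) *\<^sub>C J (s * t) (lmul (p (s * t)) y)) F"
    by (intro tendsto_scaleC lim_J p_limit)
  then show "((\<lambda>i. J t (\<beta> t (u i)) * J s y) \<longlongrightarrow> cnj (\<omega> s t) *\<^sub>C J (s * t) y) F"
    by (simp add: J_mult beta_beta)
qed

lemma omega_rep_jP: "omega_rep \<omega> jP"
  unfolding omega_rep_def
proof (intro allI)
  fix s t
  have "star (jP t) * star (jP s) = cnj (\<omega> s t) *\<^sub>C star (jP (s * t))"
    by (rule eqI_left) (simp add: lmul_simps star_jP_jA star_jP_J)
  then have "star (star (jP t) * star (jP s)) = star (cnj (\<omega> s t) *\<^sub>C star (jP (s * t)))" by simp
  then show "jP s * jP t = \<omega> s t *\<^sub>C jP (s * t)"
    by (simp add: star_mult star_star star_scaleC)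
qed

lemma partial_isometry_jP: "partial_isometry (jP s)"
proof -
  have "star (jP s) * jP s * star (jP s) = star (jP s)"
    by (rule eqI_left) (simp add: lmul_simps star_jP_jA jP_J)
  then have "star (star (jP s) * jP s * star (jP s)) = star (star (jP s))" by simp
  then show ?thesis by (simp add: partial_isometry_def star_mult star_star mult.assoc)
qed

lemma covariance: "mult_of (jA (\<beta> s a)) = jP s * mult_of (jA a) * star (jP s)"
  by (rule eqI_left)
    (simp add: lmul_simps mult_of_apply star_jP_jA jA_mult_J jP_J lmul_mult flip: jA(3))

text \<open>The multiplier form of moving \<open>\<pi> x\<close> past \<open>star (V t)\<close>; it
  gives the commutation with the source projections and later evaluates the Cuntz-Pimsner
  condition.\<close>

lemma jA_star_jP: "mult_of (jA a) * star (jP s) = star (jP s) * mult_of (jA (\<beta> s a))"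
  by (rule eqI_left) (simp add: lmul_simps mult_of_apply star_jP_jA jA_mult_J flip: jA(3))

lemma jP_jA: "jP s * mult_of (jA a) = mult_of (jA (\<beta> s a)) * jP s"
proof -
  have "star (mult_of (jA (star a)) * star (jP s)) = star (star (jP s) * mult_of (jA (\<beta> s (star a))))"
    by (simp only: jA_star_jP)
  then show ?thesis
    by (simp add: star_mult star_star beta(4) jA(4) flip: mult_of_star)
qed

lemma source_commutes: "star (jP s) * jP s * mult_of (jA a) = mult_of (jA a) * star (jP s) * jP s"
  by (simp add: mult.assoc jP_jA) (simp add: jA_star_jP flip: mult.assoc)

lemma mult_of_J: "mult_of (J s x) = star (jP s) * mult_of (jA x)"
  by (simp add: mult_mult_of star_jP_jA)

text \<open>\<open>\<psi> (s, x)\<close> is the adjoint of \<open>rmul (jA (star x)) (jP s)\<close>,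
  so a C*-subalgebra containing these products contains the range of \<open>\<psi>\<close>.\<close>

lemma generated_jA_jP: "cstar_generated {rmul (jA a) (jP s) |a s. True} = UNIV"
proof -
  have "C = UNIV" if C: "cstar_subalgebra C" "{rmul (jA a) (jP s) |a s. True} \<subseteq> C" for C
  proof -
    have "\<psi> ` total X \<subseteq> C"
    proof clarify
      fix s x assume "(s, x) \<in> total X"
      then have "\<psi> (s, x) = star (rmul (jA (star x)) (jP s))"
        by (simp add: mem_total rmul_jA_jP star_star psi_J)
      also have "\<dots> \<in> C" using C unfolding cstar_subalgebra_def by blast
      finally show "\<psi> (s, x) \<in> C" .
    qed
    then show ?thesis
      using hull_minimal[of "\<psi> ` total X" C cstar_subalgebra] C(1) gen
      by (auto simp: cstar_generated_def)
  qed
  then show ?thesis unfolding cstar_generated_def hull_def by blast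
qed

lemma approximate_identity_jA: "approximate_identity F (jA \<circ> u)"
  by (rule approximate_identity_image[OF nondegenerate_jA u])

text \<open>The relations already hold in the multiplier algebra, and
  \<open>mult_ext \<sigma>\<close> is a star homomorphism; nondegeneracy of the composition is the
  only extra point.\<close>

lemma toeplitz_covariant_rep_mult_ext:
  assumes \<sigma>: "nondegenerate_rep \<sigma>"
  shows "toeplitz_covariant_rep \<beta> \<omega> (\<sigma> \<circ> jA) (mult_ext \<sigma> \<circ> jP)"
proof -
  note ext = mult_ext_rep[OF \<sigma> approximate_identity_jA]
  note g = star_homD[OF ext(1)]
  have hom: "star_hom \<sigma>" using \<sigma> by (simp add: nondegenerate_rep_def)
  have "nondegenerate_rep (\<sigma> \<circ> jA)"
    using nondegenerate_rep_comp[OF \<sigma> nondegenerate_jA] .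
  moreover have "omega_rep \<omega> (mult_ext \<sigma> \<circ> jP)"
    using omega_rep_jP by (simp add: omega_rep_def flip: g)
  moreover have "partial_isometry ((mult_ext \<sigma> \<circ> jP) s)" for s
    using partial_isometry_jP[of s] by (simp add: partial_isometry_def flip: g)
  moreover have "(\<sigma> \<circ> jA) (\<beta> s a) =
      (mult_ext \<sigma> \<circ> jP) s * (\<sigma> \<circ> jA) a * star ((mult_ext \<sigma> \<circ> jP) s)" for s a
    using arg_cong[OF covariance[of s a], of "mult_ext \<sigma>"] by (simp add: g ext(2))
  moreover have "star ((mult_ext \<sigma> \<circ> jP) s) * (mult_ext \<sigma> \<circ> jP) s * (\<sigma> \<circ> jA) a =
      (\<sigma> \<circ> jA) a * star ((mult_ext \<sigma> \<circ> jP) s) * (mult_ext \<sigma> \<circ> jP) s" for s a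
    using arg_cong[OF source_commutes[of s a], of "mult_ext \<sigma>"] by (simp add: g ext(2))
  ultimately show ?thesis unfolding toeplitz_covariant_rep_def by blast
qed

lemma isometry_jP:
  assumes "cuntz_pimsner_covariant X \<psi>"
  shows "isometry (jP s)"
proof -
  \<comment> \<open>\<open>compacts_hom\<close> takes values in the algebra itself, so the
    compression is written with \<open>lmul\<close> and \<open>rmul\<close>; its identities are
    checked after the injective map \<open>mult_of\<close>.\<close>
  define k where "k d = lmul (star (jP s)) (rmul (jA d) (jP s))" for d
  have k: "mult_of (k d) = star (jP s) * mult_of (jA d) * jP s" for d
  proof -
    have "mult_of (k d) = star (jP s) * (mult_of (jA d) * jP s)"
      by (simp add: k_def mult_of_mult mult_mult_of)
    then show ?thesis by (simp only: mult.assoc)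
  qed
  have range_jP: "jP s * (star (jP s) * mult_of (jA e)) = mult_of (jA e)" if "e \<in> corner s" for e
    by (rule eqI_left)
      (simp add: lmul_simps mult_of_apply star_jP_jA jP_J lmul_mult corner_p(1)[OF that] flip: jA(3))
  have "compacts_hom (twisted_fibre \<beta> s) \<psi> (corner_op s (\<beta> s a)) = k (\<beta> s a)" for a
  proof (rule compacts_hom_corner)
    show "k (d * e) = k d * k e" if "d \<in> corner s" "e \<in> corner s" for d e
    proof (rule mult_of_inj)
      have "mult_of (k d * k e) =
          star (jP s) * mult_of (jA d) * (jP s * (star (jP s) * mult_of (jA e))) * jP s"
        by (simp add: mult_of_times k mult.assoc)
      then show "mult_of (k (d * e)) = mult_of (k d * k e)"
        unfolding range_jP[OF that(2)] by (simp add: k jA(3) mult_of_times mult.assoc)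
    qed
    show "k (x * star y) = \<psi> (s, x) * star (\<psi> (s, y))"
      if "lmul (p s) x = x" "lmul (p s) y = y" for x y
      by (rule mult_of_inj)
        (simp add: k mult_of_times mult_of_star psi_J that mult_of_J star_mult star_star jA mult.assoc)
    show "k (star d) = star (k d)" for d
      by (rule mult_of_inj) (simp add: k mult_of_star star_mult star_star jA mult.assoc)
  qed (simp_all add: k_def jA lmul_add rmul_add lmul_scaleC rmul_scaleC beta_corner)
  then have kb: "k (\<beta> s a) = jA a" for a
    using assms unfolding cuntz_pimsner_covariant_iff canonical_A_def by metis
  \<comment> \<open>Covariance identifies \<open>jA a\<close> with
    \<open>star (jP s) * jA (\<beta> s a) * jP s\<close>, and \<open>jA_star_jP\<close> moves
    \<open>jA a\<close> to the front.\<close>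
  have source: "mult_of (jA a) = mult_of (jA a) * star (jP s) * jP s" for a
    by (metis k kb jA_star_jP)
  have "rmul (jA a) (star (jP s) * jP s) = rmul (jA a) 1" for a
  proof (rule mult_of_inj)
    have "mult_of (rmul (jA a) (star (jP s) * jP s)) = mult_of (jA a) * star (jP s) * jP s"
      by (simp only: mult_of_mult[symmetric] mult.assoc)
    then show "mult_of (rmul (jA a) (star (jP s) * jP s)) = mult_of (rmul (jA a) 1)"
      using source[of a] by (simp add: rmul_one)
  qed
  then show ?thesis unfolding isometry_def by (rule eqI_right)
qed

lemma covariant_rep_mult_ext:
  assumes cp: "cuntz_pimsner_covariant X \<psi>" and \<sigma>: "nondegenerate_rep \<sigma>"
  shows "covariant_rep \<beta> \<omega> (\<sigma> \<circ> jA) (mult_ext \<sigma> \<circ> jP)"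
proof -
  note ext = mult_ext_rep[OF \<sigma> approximate_identity_jA]
  have "star (mult_ext \<sigma> (jP s)) * mult_ext \<sigma> (jP s) = 1" for s
    using arg_cong[OF isometry_jP[OF cp, of s, unfolded isometry_def], of "mult_ext \<sigma>"]
    by (simp add: star_homD[OF ext(1)] ext(5))
  then show ?thesis
    using toeplitz_covariant_rep_mult_ext[OF \<sigma>]
    by (simp add: covariant_rep_def toeplitz_covariant_rep_def isometry_def)
qed

text \<open>The adjoints are compared on the operators \<open>\<pi> a\<close>: the left side is the
  image of \<open>J s a\<close>, namely \<open>star (V s) * \<pi> (lmul (p s) a)\<close>, and the
  range formula with the partial isometry identity absorbs the projection.\<close>

lemma mult_ext_jP_eq:
  assumes cov: "toeplitz_covariant_rep \<beta> \<omega> \<pi> V" and hom: "star_hom \<rho>"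
    and \<rho>: "\<And>s x. lmul (p s) x = x \<Longrightarrow> \<rho> (\<psi> (s, x)) = star (V s) * \<pi> x"
  shows "\<rho> \<circ> jA = \<pi>" "mult_ext \<rho> \<circ> jP = V"
proof -
  have nd: "nondegenerate_rep \<pi>" using cov by (simp add: toeplitz_covariant_rep_def)
  show jA: "\<rho> \<circ> jA = \<pi>"
    using \<rho>[of 1] toeplitz_covariant_rep_one[OF cov] by (auto simp: canonical_A_def star_one)
  have nd': "nondegenerate_rep \<rho>"
    by (rule nondegenerate_rep_factor[OF hom, where j=jA]) (use nd jA in simp)
  note ext = mult_ext_rep[OF nd' approximate_identity_jA]
  have "star (mult_ext \<rho> (jP s)) = star (V s)" for s
  proof (rule nondegenerate_rep_eqI[OF nd])
    fix a
    have "star (mult_ext \<rho> (jP s)) * \<pi> a = \<rho> (lmul (star (jP s)) (jA a))"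
      using ext(3)[of "star (jP s)" "jA a"] fun_cong[OF jA, of a] by (simp add: star_homD[OF ext(1)])
    also have "\<dots> = star (V s) * \<pi> (lmul (p s) a)"
      unfolding star_jP_jA J_def by (simp add: \<rho>)
    also have "\<dots> = star (V s) * (V s * (star (V s) * \<pi> a))"
      by (simp add: toeplitz_covariant_rep_range[OF cov])
    also have "\<dots> = star (V s * star (V s) * V s) * \<pi> a"
      by (simp add: star_mult star_star mult.assoc)
    also have "V s * star (V s) * V s = V s"
      using cov by (simp add: toeplitz_covariant_rep_def partial_isometry_def)
    finally show "star (mult_ext \<rho> (jP s)) * \<pi> a = star (V s) * \<pi> a" .
  qed
  then have "star (star (mult_ext \<rho> (jP s))) = star (star (V s))" for s by simp
  then show "mult_ext \<rho> \<circ> jP = V" by (simp add: star_star fun_eq_iff)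
qed

end

section \<open>Universal properties\<close>

lemma closed_range_isometric:
  fixes \<sigma> :: "'b::cstar_algebra \<Rightarrow> 'c::cstar_algebra"
  assumes hom: "star_hom \<sigma>" and iso: "\<And>b. norm (\<sigma> b) = norm b"
  shows "closed (range \<sigma>)"
  unfolding closed_sequential_limits
proof (intro allI impI)
  fix y l assume "(\<forall>n. y n \<in> range \<sigma>) \<and> y \<longlonglongrightarrow> l"
  then have y: "\<forall>n. \<exists>b. y n = \<sigma> b" "y \<longlonglongrightarrow> l" by auto
  from choice[OF y(1)] obtain b where b: "\<And>n. y n = \<sigma> (b n)" by blast
  have "Cauchy (\<lambda>n. \<sigma> (b n))" using LIMSEQ_imp_Cauchy[OF y(2)] by (simp add: b flip: b)
  then have "Cauchy b" by (simp add: Cauchy_def dist_norm iso flip: star_hom_diff[OF hom])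
  then obtain c where "b \<longlonglongrightarrow> c" using Cauchy_convergent_iff convergent_def by blast
  then have "y \<longlonglongrightarrow> \<sigma> c"
    unfolding b[abs_def] by (rule bounded_linear.tendsto[OF star_hom_bounded_linear[OF hom]])
  then show "l \<in> range \<sigma>" using LIMSEQ_unique[OF y(2)] by blast
qed

text \<open>The elements that \<open>\<rho>\<close> sends into the range of \<open>\<sigma>\<close>
  form a C*-subalgebra, closed because an isometric image is complete. It contains the generators,
  hence everything, and \<open>\<sigma>\<close> can be inverted.\<close>

lemma star_hom_lift_isometric:
  fixes \<sigma> :: "'b::cstar_algebra \<Rightarrow> 'd::cstar_algebra" and \<rho> :: "'c::cstar_algebra \<Rightarrow> 'd"
  assumes \<sigma>: "star_hom \<sigma>" and iso: "\<And>b. norm (\<sigma> b) = norm b" and \<rho>: "star_hom \<rho>"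
    and gen: "cstar_generated S = UNIV" and sub: "\<rho> ` S \<subseteq> range \<sigma>"
  obtains \<theta> where "star_hom \<theta>" "\<And>c. \<sigma> (\<theta> c) = \<rho> c"
proof -
  have ops: "a + b \<in> range \<sigma>" "a * b \<in> range \<sigma>" "z *\<^sub>C a \<in> range \<sigma>" "star a \<in> range \<sigma>"
    if "a \<in> range \<sigma>" "b \<in> range \<sigma>" for a b z
    using that by (auto simp flip: star_homD[OF \<sigma>])
  have "0 \<in> range \<sigma>" by (metis star_hom_zero[OF \<sigma>] rangeI)
  moreover have "closed (\<rho> -` range \<sigma>)"
    by (intro closed_vimage closed_range_isometric \<sigma> iso linear_continuous_on star_hom_bounded_linear \<rho>)
  ultimately have "cstar_subalgebra (\<rho> -` range \<sigma>)"
    by (simp add: cstar_subalgebra_def star_homD[OF \<rho>] star_hom_zero[OF \<rho>] ops)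
  then have "cstar_generated S \<subseteq> \<rho> -` range \<sigma>"
    unfolding cstar_generated_def by (rule hull_minimal[rotated]) (use sub in blast)
  then have "\<forall>c. \<exists>b. \<sigma> b = \<rho> c" using gen by (metis UNIV_I imageE subsetD vimageE)
  from choice[OF this] obtain \<theta> where \<theta>: "\<And>c. \<sigma> (\<theta> c) = \<rho> c" by blast
  have inj: "a = b" if "\<sigma> a = \<sigma> b" for a b
    using iso[of "a - b"] that by (simp add: star_hom_diff[OF \<sigma>])
  have "star_hom \<theta>"
    unfolding star_hom_def by (intro conjI allI inj) (simp_all add: \<theta> star_homD[OF \<sigma>] star_homD[OF \<rho>])
  with \<theta> that show thesis by blast
qed

text \<open>The universal property produces only maps into operators on \<open>'h\<close>. A
  faithful representation \<open>\<sigma>\<close> turns the second triple into such a pair; the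
  resulting \<open>\<rho>\<close> sends generators into the range of \<open>\<sigma>\<close> and is
  pulled back through it.\<close>

lemma universal_triple_morphism:
  fixes \<C> :: "('a::cstar_algebra \<Rightarrow> 'h::complex_hilbert_space bop) \<Rightarrow> ('p \<Rightarrow> 'h bop) \<Rightarrow> bool"
    and jA :: "'a \<Rightarrow> 'b::cstar_algebra" and kA :: "'a \<Rightarrow> 'c::cstar_algebra"
    and F :: "'i filter" and u :: "'i \<Rightarrow> 'a"
  assumes u: "approximate_identity F u"
    and nd: "\<forall>\<pi> V. \<C> \<pi> V \<longrightarrow> nondegenerate_rep \<pi>"
    and j: "universal_triple \<C> jA jP" and k: "universal_triple \<C> kA kP"
    and faithful: "faithfully_representable TYPE('h) TYPE('c)"
  obtains \<theta> where "star_hom \<theta>" "\<And>a. \<theta> (jA a) = kA a"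
    "\<And>a s. \<theta> (rmul (jA a) (jP s)) = rmul (kA a) (kP s)"
proof -
  obtain \<sigma> :: "'c \<Rightarrow> 'h bop" where \<sigma>: "nondegenerate_rep \<sigma>" and iso: "\<And>b. norm (\<sigma> b) = norm b"
    using faithful by (auto simp: faithfully_representable_def)
  have hom: "star_hom \<sigma>" using \<sigma> by (simp add: nondegenerate_rep_def)
  have C: "\<C> (\<sigma> \<circ> kA) (mult_ext \<sigma> \<circ> kP)" using k \<sigma> by (simp add: universal_triple_def)
  then obtain \<rho> where \<rho>: "star_hom \<rho>" "\<rho> \<circ> jA = \<sigma> \<circ> kA" "mult_ext \<rho> \<circ> jP = mult_ext \<sigma> \<circ> kP"
    using j unfolding universal_triple_def by blast
  have \<rho>nd: "nondegenerate_rep \<rho>"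
    using nondegenerate_rep_factor[OF \<rho>(1), of jA] nd C by (simp add: \<rho>(2))
  have jn: "nondegenerate_hom jA" "nondegenerate_hom kA" using j k by (auto simp: universal_triple_def)
  note rj = mult_ext_rep_rmul[OF \<rho>nd approximate_identity_image[OF jn(1) u]]
  note rk = mult_ext_rep_rmul[OF \<sigma> approximate_identity_image[OF jn(2) u]]
  have gens: "\<rho> (rmul (jA a) (jP s)) = \<sigma> (rmul (kA a) (kP s))" for a s
    using fun_cong[OF \<rho>(2), of a] fun_cong[OF \<rho>(3), of s] by (simp flip: rj rk)
  have gen: "cstar_generated {rmul (jA a) (jP s) |a s. True} = UNIV"
    using j by (simp add: universal_triple_def)
  have "\<rho> ` {rmul (jA a) (jP s) |a s. True} \<subseteq> range \<sigma>" by (auto simp: gens)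
  then obtain \<theta> where \<theta>: "star_hom \<theta>" "\<And>c. \<sigma> (\<theta> c) = \<rho> c"
    using star_hom_lift_isometric[OF hom iso \<rho>(1) gen] by blast
  have inj: "a = b" if "\<sigma> a = \<sigma> b" for a b
    using iso[of "a - b"] that by (simp add: star_hom_diff[OF hom])
  show thesis
  proof (rule that[OF \<theta>(1)])
    show "\<theta> (jA a) = kA a" for a using fun_cong[OF \<rho>(2), of a] by (intro inj) (simp add: \<theta>(2))
    show "\<theta> (rmul (jA a) (jP s)) = rmul (kA a) (kP s)" for a s by (intro inj) (simp add: \<theta>(2) gens)
  qed
qed

lemma universal_triple_unique:
  fixes \<C> :: "('a::cstar_algebra \<Rightarrow> 'h::complex_hilbert_space bop) \<Rightarrow> ('p \<Rightarrow> 'h bop) \<Rightarrow> bool"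
    and jA :: "'a \<Rightarrow> 'b::cstar_algebra" and kA :: "'a \<Rightarrow> 'c::cstar_algebra"
    and F :: "'i filter" and u :: "'i \<Rightarrow> 'a"
  assumes u: "approximate_identity F u"
    and nd: "\<forall>\<pi> V. \<C> \<pi> V \<longrightarrow> nondegenerate_rep \<pi>"
    and j: "universal_triple \<C> jA jP" and k: "universal_triple \<C> kA kP"
    and faithful: "faithfully_representable TYPE('h) TYPE('b)" "faithfully_representable TYPE('h) TYPE('c)"
  shows "canonically_isomorphic jA jP kA kP"
proof -
  obtain \<theta> where \<theta>: "star_hom \<theta>" "\<And>a. \<theta> (jA a) = kA a"
    "\<And>a s. \<theta> (rmul (jA a) (jP s)) = rmul (kA a) (kP s)"
    using universal_triple_morphism[OF u nd j k faithful(2)] by blast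
  obtain \<eta> where \<eta>: "star_hom \<eta>" "\<And>a. \<eta> (kA a) = jA a"
    "\<And>a s. \<eta> (rmul (kA a) (kP s)) = rmul (jA a) (jP s)"
    using universal_triple_morphism[OF u nd k j faithful(1)] by blast
  have id: "star_hom (id :: 'd::cstar_algebra \<Rightarrow> 'd)" by (simp add: star_hom_def)
  have "\<eta> \<circ> \<theta> = id"
  proof (rule star_hom_eq_on_generators[OF star_hom_comp[OF \<eta>(1) \<theta>(1)] id])
    show "cstar_generated {rmul (jA a) (jP s) |a s. True} = UNIV"
      using j by (simp add: universal_triple_def)
  qed (auto simp: \<theta>(3) \<eta>(3))
  moreover have "\<theta> \<circ> \<eta> = id"
  proof (rule star_hom_eq_on_generators[OF star_hom_comp[OF \<theta>(1) \<eta>(1)] id])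
    show "cstar_generated {rmul (kA a) (kP s) |a s. True} = UNIV"
      using k by (simp add: universal_triple_def)
  qed (auto simp: \<theta>(3) \<eta>(3))
  ultimately have bij: "bij \<theta>" using o_bij by blast
  have nj: "nondegenerate_hom jA" and nk: "nondegenerate_hom kA"
    using j k by (auto simp: universal_triple_def)
  \<comment> \<open>The products \<open>rmul (kA a)\<close> with the two multipliers agree;
    nondegeneracy of \<open>kA\<close> turns this into equality of the multipliers.\<close>
  note r = mult_ext_surj_rmul[OF \<theta>(1) bij_is_surj[OF bij] approximate_identity_image[OF nj u]]
  have "mult_ext (mult_of \<circ> \<theta>) (jP s) = kP s" for s
    by (rule nondegenerate_hom_eqI_right[OF nk]) (metis r \<theta>(2,3))
  with \<theta> bij show ?thesis
    unfolding canonically_isomorphic_def by (intro exI[of _ \<theta>]) (auto simp: fun_eq_iff)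
qed

section \<open>The crossed product axioms and the passage to the quotient\<close>

context generating_toeplitz_rep
begin

lemma toeplitz_crossed_product_of_universal:
  assumes univ: "\<And>\<phi> :: 'p \<times> 'a \<Rightarrow> 'h::complex_hilbert_space bop. toeplitz_rep X \<phi> \<Longrightarrow>
    \<exists>\<rho>. star_hom \<rho> \<and> (\<forall>z\<in>total X. \<rho> (\<psi> z) = \<phi> z)"
  shows "toeplitz_crossed_product TYPE('h) \<beta> \<omega> jA jP"
  unfolding toeplitz_crossed_product_def universal_triple_def
proof (intro conjI allI impI nondegenerate_jA generated_jA_jP toeplitz_covariant_rep_mult_ext)
  fix \<pi> :: "'a \<Rightarrow> 'h bop" and V assume cov: "toeplitz_covariant_rep \<beta> \<omega> \<pi> V"
  obtain \<rho> where \<rho>: "star_hom \<rho>" "\<And>z. z \<in> total X \<Longrightarrow> \<rho> (\<psi> z) = star (V (fst z)) * \<pi> (snd z)"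
    using univ[OF toeplitz_rep_of_covariant[OF cov]] by blast
  have "\<rho> (\<psi> (s, x)) = star (V s) * \<pi> x" if "lmul (p s) x = x" for s x
    using \<rho>(2)[of "(s, x)"] that by (simp add: mem_total)
  from \<rho>(1) mult_ext_jP_eq[OF cov \<rho>(1) this]
  show "\<exists>\<rho>. star_hom \<rho> \<and> \<rho> \<circ> jA = \<pi> \<and> mult_ext \<rho> \<circ> jP = V" by blast
qed

lemma crossed_product_of_universal:
  assumes cp: "cuntz_pimsner_covariant X \<psi>"
    and univ: "\<And>\<phi> :: 'p \<times> 'a \<Rightarrow> 'h::complex_hilbert_space bop. toeplitz_rep X \<phi> \<Longrightarrow>
      cuntz_pimsner_covariant X \<phi> \<Longrightarrow> \<exists>\<rho>. star_hom \<rho> \<and> (\<forall>z\<in>total X. \<rho> (\<psi> z) = \<phi> z)"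
  shows "crossed_product TYPE('h) \<beta> \<omega> jA jP"
  unfolding crossed_product_def universal_triple_def
proof (intro conjI allI impI nondegenerate_jA generated_jA_jP covariant_rep_mult_ext cp)
  fix \<pi> :: "'a \<Rightarrow> 'h bop" and V assume c: "covariant_rep \<beta> \<omega> \<pi> V"
  note cov = toeplitz_covariant_rep_of_covariant[OF c]
  obtain \<rho> where \<rho>: "star_hom \<rho>" "\<And>z. z \<in> total X \<Longrightarrow> \<rho> (\<psi> z) = star (V (fst z)) * \<pi> (snd z)"
    using univ[OF toeplitz_rep_of_covariant[OF cov] cuntz_pimsner_covariant_of_covariant[OF c]] by blast
  have "\<rho> (\<psi> (s, x)) = star (V s) * \<pi> x" if "lmul (p s) x = x" for s x
    using \<rho>(2)[of "(s, x)"] that by (simp add: mem_total)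
  from \<rho>(1) mult_ext_jP_eq[OF cov \<rho>(1) this]
  show "\<exists>\<rho>. star_hom \<rho> \<and> \<rho> \<circ> jA = \<pi> \<and> mult_ext \<rho> \<circ> jP = V" by blast
qed

text \<open>\<open>jP s\<close> is determined by the products
  \<open>rmul (jA a) (jP s) = star (J s (star a))\<close>, and \<open>q\<close> carries
  \<open>J\<close> to its counterpart for \<open>\<phi>\<close>. This avoids exchanging
  \<open>q\<close> with a strict limit.\<close>

lemma canonical_maps_image:
  fixes \<phi> :: "'p \<times> 'a \<Rightarrow> 'c::cstar_algebra"
  assumes \<phi>: "generating_toeplitz_rep \<beta> \<omega> F u \<phi>"
    and q: "star_hom q" "surj q" "\<And>z. z \<in> total X \<Longrightarrow> q (\<psi> z) = \<phi> z"
  shows "q \<circ> jA = canonical_A \<phi>" "mult_ext (mult_of \<circ> q) \<circ> jP = canonical_P \<beta> F u \<phi>"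
proof -
  interpret \<phi>: generating_toeplitz_rep \<beta> \<omega> F u \<phi> by fact
  have qJ: "q (J s x) = \<phi>.J s x" for s x
    by (simp add: J_def \<phi>.J_def q(3) mem_total)
  then have qA: "q (jA a) = canonical_A \<phi> a" for a by (simp add: jA_J_one \<phi>.jA_J_one)
  then show "q \<circ> jA = canonical_A \<phi>" by auto
  note r = mult_ext_surj_rmul[OF q(1,2) approximate_identity_jA]
  have "mult_ext (mult_of \<circ> q) (jP s) = canonical_P \<beta> F u \<phi> s" for s
  proof (rule \<phi>.eqI_right)
    show "rmul (canonical_A \<phi> a) (mult_ext (mult_of \<circ> q) (jP s)) =
        rmul (canonical_A \<phi> a) (canonical_P \<beta> F u \<phi> s)" for a
      by (simp add: r rmul_jA_jP \<phi>.rmul_jA_jP star_homD[OF q(1)] qJ flip: qA)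
        (simp add: \<phi>.rmul_jA_jP qA)
  qed
  then show "mult_ext (mult_of \<circ> q) \<circ> jP = canonical_P \<beta> F u \<phi>" by auto
qed

end

theorem proposition3p4:
  fixes \<beta> :: "'p::{monoid_mult, countable} \<Rightarrow> 'a::cstar_algebra \<Rightarrow> 'a"
    and \<omega> :: "'p \<Rightarrow> 'p \<Rightarrow> complex"
    and F :: "'i filter" and u :: "'i \<Rightarrow> 'a"
    and iX :: "'p \<times> 'a \<Rightarrow> 't::cstar_algebra"
    and kX :: "'p \<times> 'a \<Rightarrow> 'o::cstar_algebra"
    and q :: "'t \<Rightarrow> 'o"
  assumes "separable_space (euclidean :: 'a topology)"
    and "twisted_system \<beta> \<omega>"
    and "approximate_identity F u"
    and "universal_toeplitz_rep TYPE('h::complex_hilbert_space bop) (twisted_product_system \<beta> \<omega>) iX"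
    and "universal_cuntz_pimsner_rep TYPE('h bop) (twisted_product_system \<beta> \<omega>) kX"
    and "canonical_projection (twisted_product_system \<beta> \<omega>) iX kX q"
  shows "toeplitz_crossed_product TYPE('h) \<beta> \<omega> (canonical_A iX) (canonical_P \<beta> F u iX) \<and>
    crossed_product TYPE('h) \<beta> \<omega>
      (q \<circ> canonical_A iX) (mult_ext (mult_of \<circ> q) \<circ> canonical_P \<beta> F u iX) \<and>
    (\<forall>(jA :: 'a \<Rightarrow> 'b::cstar_algebra) jP. toeplitz_crossed_product TYPE('h) \<beta> \<omega> jA jP \<and>
       faithfully_representable TYPE('h) TYPE('t) \<and> faithfully_representable TYPE('h) TYPE('b) \<longrightarrow>
       canonically_isomorphic (canonical_A iX) (canonical_P \<beta> F u iX) jA jP) \<and>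
    (\<forall>(jA :: 'a \<Rightarrow> 'c::cstar_algebra) jP. crossed_product TYPE('h) \<beta> \<omega> jA jP \<and>
       faithfully_representable TYPE('h) TYPE('o) \<and> faithfully_representable TYPE('h) TYPE('c) \<longrightarrow>
       canonically_isomorphic
         (q \<circ> canonical_A iX) (mult_ext (mult_of \<circ> q) \<circ> canonical_P \<beta> F u iX) jA jP)"
proof -
  note u = assms(3)
  interpret iX: generating_toeplitz_rep \<beta> \<omega> F u iX
    using assms(2-4)
    by unfold_locales (simp_all add: universal_toeplitz_rep_def universal_rep_def)
  interpret kX: generating_toeplitz_rep \<beta> \<omega> F u kX
    using assms(5)
    by unfold_locales (simp_all add: universal_cuntz_pimsner_rep_def universal_rep_def)
  have T: "toeplitz_crossed_product TYPE('h) \<beta> \<omega> (canonical_A iX) (canonical_P \<beta> F u iX)"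
    using assms(4) unfolding universal_toeplitz_rep_def universal_rep_def
    by (intro iX.toeplitz_crossed_product_of_universal) blast
  \<comment> \<open>The axioms are checked for the Cuntz-Pimsner representation \<open>kX\<close>
    itself; its canonical maps are then recognised as the images under \<open>q\<close> of those of
    \<open>iX\<close>.\<close>
  have "crossed_product TYPE('h) \<beta> \<omega> (canonical_A kX) (canonical_P \<beta> F u kX)"
    using assms(5) unfolding universal_cuntz_pimsner_rep_def universal_rep_def
    by (intro kX.crossed_product_of_universal) blast+
  moreover have "q \<circ> canonical_A iX = canonical_A kX"
    "mult_ext (mult_of \<circ> q) \<circ> canonical_P \<beta> F u iX = canonical_P \<beta> F u kX"
    using assms(6) unfolding canonical_projection_def
    by (auto intro!: iX.canonical_maps_image kX.generating_toeplitz_rep_axioms)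
  ultimately have O: "crossed_product TYPE('h) \<beta> \<omega>
      (q \<circ> canonical_A iX) (mult_ext (mult_of \<circ> q) \<circ> canonical_P \<beta> F u iX)" by simp
  have nd: "\<forall>\<pi> V. toeplitz_covariant_rep \<beta> \<omega> (\<pi> :: 'a \<Rightarrow> 'h bop) V \<longrightarrow> nondegenerate_rep \<pi>"
    "\<forall>\<pi> V. covariant_rep \<beta> \<omega> (\<pi> :: 'a \<Rightarrow> 'h bop) V \<longrightarrow> nondegenerate_rep \<pi>"
    by (simp_all add: toeplitz_covariant_rep_def covariant_rep_def)
  show ?thesis
    using T O universal_triple_unique[OF u nd(1)] universal_triple_unique[OF u nd(2)]
    unfolding toeplitz_crossed_product_def crossed_product_def
    by (intro conjI allI impI) blast+
qed

end
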